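(* Let $Z_n=\sum_{i=1}^n\xi_{S_i}$ ($Z_0=0$) be the random walk in random scenery described in the context, with normalization $a_n$ given there, and let $Z_n^*:=\max_{k=1,\ldots,n}Z_k$. Let $\beta'>1$ be such that $\mathbb E[\max(0,-\xi_0)^{\beta'}]<\infty$. Then: (a) for every $m\in\mathbb R$ there exists $c>0$ such that $\mathbb P(Z_n^*\le m)\le c\,a_n/n$ for every $n\ge1$; (b) for every $m\ge0$ there exists $c>0$ such that $\mathbb P(Z_n^*\le m)\ge c\left(\frac{a_n}{n}\right)^{1+\frac2{\beta'}}$ for every $n\ge1$; (c) for every $m<0$ such that $\mathbb P(\xi_0\le m)>0$ there exists $c>0$ such that $\mathbb P(Z_n^*\le m)\ge c\left(\frac{a_n}{n}\right)^{1+\frac2{\beta'}}$ for every $n\ge1$.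
   Context: Random walk in random scenery. Let $d\ge1$, let $S=(S_n)_{n\ge 0}$ be a random walk on $\mathbb Z^d$ with $S_0=0$ and i.i.d. steps $X_n=S_n-S_{n-1}$, $n\ge 1$, and let $\xi=(\xi_x)_{x\in\mathbb Z^d}$ be i.i.d. real random variables independent of $S$. $\mathbb P$ is the joint law of $S$ and $\xi$, and $\mathbb E$ the corresponding expectation. Standing assumptions: the support of the law of $X_1$ is not contained in a proper subgroup of $\mathbb Z^d$; the closed subgroup of $\mathbb R$ generated by the support of the law of $\xi_0$ is either $\mathbb Z$ or $\mathbb R$; $\xi_0$ is centered and square integrable. If $S$ is recurrent (possible only for $d\in\{1,2\}$), assume moreover that the law of $X_1$ is in the normal domain of attraction of a stable distribution of index $\alpha\in[d,2]$ (if $d=2$: $n^{-1/2}S_n$ converges in distribution to a bidimensional Gaussian random variable; if $d=1<\alpha$: $(n^{-1/\alpha}S_{\lfloor nt\rfloor})_{t\ge0}$ converges in distribution, for the Skorokhod $J_1$ topology, to an $\alpha$-stable Lévy process). The normalization is $$a_n:=\begin{cases}n^{1-\frac1{2\alpha}}&\text{if } S \text{ is recurrent and } d=1,\ \alpha\in(1,2],\\ \sqrt{n\log n}&\text{if } S\text{ is recurrent and }\alpha=d\in\{1,2\},\\ \sqrt n&\text{if } S\text{ is transient.}\end{cases}$$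
   Formalization: In the case a_n = √(n log n), the value a_1 is taken to be 1 instead of √(1·log 1) = 0, since with a_1 = 0 part (a) fails at n = 1; a_n is as stated for all n ≥ 2. *)

theory Defs
  imports "HOL-Probability.Probability"
begin

section \<open>Stable and Gaussian laws\<close>

definition nondegenerate_law :: "'a::euclidean_space measure \<Rightarrow> bool" where
  "nondegenerate_law \<mu> \<longleftrightarrow>
    (\<forall>v c. v \<noteq> 0 \<longrightarrow> measure \<mu> {x. v \<bullet> x = c} \<noteq> 1)"

text \<open>If \<open>X\<^sub>1\<close>, \<open>X\<^sub>2\<close> are independent with law \<open>\<mu>\<close>, then \<open>A X\<^sub>1 + B X\<^sub>2\<close> has the law of
  \<open>(A powr \<alpha> + B powr \<alpha>) powr (1/\<alpha>) X\<^sub>1 + D\<close> for some deterministic \<open>D\<close>.\<close>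

definition stable_law :: "real \<Rightarrow> 'a::euclidean_space measure \<Rightarrow> bool" where
  "stable_law \<alpha> \<mu> \<longleftrightarrow>
    prob_space \<mu> \<and> sets \<mu> = sets borel \<and> nondegenerate_law \<mu> \<and>
    (\<forall>A>0. \<forall>B>0. \<exists>D.
       distr (\<mu> \<Otimes>\<^sub>M \<mu>) borel (\<lambda>(x, y). A *\<^sub>R x + B *\<^sub>R y) =
       distr \<mu> borel (\<lambda>x. (A powr \<alpha> + B powr \<alpha>) powr (1 / \<alpha>) *\<^sub>R x + D))"

text \<open>All one-dimensional projections are normal; requiring \<open>\<sigma> > 0\<close> makes the covariance
  matrix positive definite.\<close>

definition gaussian_law :: "'a::euclidean_space measure \<Rightarrow> bool" where
  "gaussian_law \<mu> \<longleftrightarrow>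
    prob_space \<mu> \<and> sets \<mu> = sets borel \<and>
    (\<forall>v. v \<noteq> 0 \<longrightarrow> (\<exists>m. \<exists>\<sigma>>0.
       distr \<mu> borel (\<lambda>x. v \<bullet> x) = density lborel (normal_density m \<sigma>)))"


section \<open>Convergence in distribution and the Skorokhod topology\<close>

text \<open>Convergence in distribution, for the topology \<open>T\<close>, of the \<open>T\<close>-valued variables \<open>Y n\<close> on
  \<open>M\<close> to the variable \<open>Y'\<close> on \<open>N\<close>. It is to be used only for variables that are measurable for
  the Borel sets of \<open>T\<close>, so that no integral below is that of a non-measurable function.\<close>

definition converges_in_distribution ::
    "'b topology \<Rightarrow> 'w measure \<Rightarrow> (nat \<Rightarrow> 'w \<Rightarrow> 'b) \<Rightarrow> 'v measure \<Rightarrow> ('v \<Rightarrow> 'b) \<Rightarrow> bool" where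
  "converges_in_distribution T M Y N Y' \<longleftrightarrow>
    (\<forall>F :: 'b \<Rightarrow> real. continuous_map T euclideanreal F \<and> bounded (F ` topspace T) \<longrightarrow>
       (\<lambda>n. \<integral>\<omega>. F (Y n \<omega>) \<partial>M) \<longlonglongrightarrow> (\<integral>\<omega>. F (Y' \<omega>) \<partial>N))"

definition cadlag_paths :: "(real \<Rightarrow> 'a::metric_space) set" where
  "cadlag_paths =
    {f \<in> extensional {0..}.
       (\<forall>t\<ge>0. (f \<longlongrightarrow> f t) (at_right t)) \<and> (\<forall>t>0. \<exists>l. (f \<longlongrightarrow> l) (at_left t))}"

definition time_changes :: "(real \<Rightarrow> real) set" where
  "time_changes = {\<tau>. strict_mono_on {0..} \<tau> \<and> \<tau> ` {0..} = {0..}}"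

text \<open>The members of \<^const>\<open>time_changes\<close> are automatically continuous and vanish at 0.
  The following is the usual description of sequential convergence for the \<open>J\<^sub>1\<close> topology on
  the time interval \<open>{0..}\<close> (Jacod and Shiryaev, Theorem VI.1.14).\<close>

definition J1_limit :: "(nat \<Rightarrow> real \<Rightarrow> 'a::metric_space) \<Rightarrow> (real \<Rightarrow> 'a) \<Rightarrow> bool" where
  "J1_limit fs f \<longleftrightarrow>
    (\<exists>\<tau>. (\<forall>n. \<tau> n \<in> time_changes) \<and>
         uniform_limit {0..} \<tau> (\<lambda>s. s) sequentially \<and>
         (\<forall>b>0. uniform_limit {0..b} (\<lambda>n s. fs n (\<tau> n s)) f sequentially))"

text \<open>The \<open>J\<^sub>1\<close> topology is metrizable, hence it is determined by its convergent sequences: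
  its open sets are the sequentially open ones.\<close>

definition J1_open :: "(real \<Rightarrow> 'a::metric_space) set \<Rightarrow> bool" where
  "J1_open U \<longleftrightarrow> U \<subseteq> cadlag_paths \<and>
    (\<forall>f fs. f \<in> U \<and> (\<forall>n. fs n \<in> cadlag_paths) \<and> J1_limit fs f \<longrightarrow>
       (\<forall>\<^sub>F n in sequentially. fs n \<in> U))"

definition skorokhod_J1 :: "(real \<Rightarrow> 'a::metric_space) topology" where
  "skorokhod_J1 = topology J1_open"

lemma istopology_J1_open: "istopology J1_open"
  unfolding istopology_def
proof (intro conjI allI impI)
  fix U V :: "(real \<Rightarrow> 'a) set"
  assume "J1_open U" "J1_open V"
  then show "J1_open (U \<inter> V)"
    unfolding J1_open_def by (auto intro!: eventually_conj)
next
  fix K :: "(real \<Rightarrow> 'a) set set"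
  assume K: "\<forall>U\<in>K. J1_open U"
  show "J1_open (\<Union>K)"
    unfolding J1_open_def
  proof (intro conjI allI impI)
    show "\<Union>K \<subseteq> cadlag_paths"
      using K unfolding J1_open_def by blast
  next
    fix f and fs :: "nat \<Rightarrow> real \<Rightarrow> 'a"
    assume f: "f \<in> \<Union>K \<and> (\<forall>n. fs n \<in> cadlag_paths) \<and> J1_limit fs f"
    then obtain U where U: "U \<in> K" "f \<in> U" by blast
    with K f have "\<forall>\<^sub>F n in sequentially. fs n \<in> U"
      unfolding J1_open_def by blast
    then show "\<forall>\<^sub>F n in sequentially. fs n \<in> \<Union>K"
      by eventually_elim (use U in blast)
  qed
qed

lemma openin_skorokhod_J1: "openin skorokhod_J1 U \<longleftrightarrow> J1_open U"
  by (simp add: skorokhod_J1_def topology_inverse' istopology_J1_open)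

lemma topspace_skorokhod_J1: "topspace skorokhod_J1 = cadlag_paths"
proof -
  have "J1_open cadlag_paths"
    by (simp add: J1_open_def)
  then show ?thesis
    unfolding topspace_def openin_skorokhod_J1 by (auto simp: J1_open_def)
qed


section \<open>Stable Levy processes\<close>

definition levy_process :: "'v measure \<Rightarrow> (real \<Rightarrow> 'v \<Rightarrow> 'a::euclidean_space) \<Rightarrow> bool" where
  "levy_process N Y \<longleftrightarrow>
    prob_space N \<and>
    (\<forall>t\<ge>0. Y t \<in> borel_measurable N) \<and>
    (\<forall>\<omega>\<in>space N. restrict (\<lambda>t. Y t \<omega>) {0..} \<in> cadlag_paths) \<and>
    (AE \<omega> in N. Y 0 \<omega> = 0) \<and>
    (\<forall>t :: nat \<Rightarrow> real. 0 \<le> t 0 \<and> mono t \<longrightarrow>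
       prob_space.indep_vars N (\<lambda>_. borel) (\<lambda>i \<omega>. Y (t (Suc i)) \<omega> - Y (t i) \<omega>) UNIV) \<and>
    (\<forall>s\<ge>0. \<forall>h\<ge>0. distr N borel (\<lambda>\<omega>. Y (s + h) \<omega> - Y s \<omega>) = distr N borel (Y h))"

definition stable_levy_process ::
    "real \<Rightarrow> 'v measure \<Rightarrow> (real \<Rightarrow> 'v \<Rightarrow> 'a::euclidean_space) \<Rightarrow> bool" where
  "stable_levy_process \<alpha> N Y \<longleftrightarrow> levy_process N Y \<and> stable_law \<alpha> (distr N borel (Y 1))"


section \<open>Subgroups and supports\<close>

definition additive_subgroup :: "'a::ab_group_add set \<Rightarrow> bool" where
  "additive_subgroup H \<longleftrightarrow> 0 \<in> H \<and> (\<forall>x\<in>H. \<forall>y\<in>H. x + y \<in> H) \<and> (\<forall>x\<in>H. - x \<in> H)"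

definition closed_subgroup_generated :: "real set \<Rightarrow> real set" where
  "closed_subgroup_generated A = \<Inter>{H. additive_subgroup H \<and> closed H \<and> A \<subseteq> H}"

definition law_support :: "real measure \<Rightarrow> real set" where
  "law_support \<mu> = {x. \<forall>U. open U \<and> x \<in> U \<longrightarrow> measure \<mu> U > 0}"


section \<open>Random walk in random scenery\<close>

definition lattice_embed :: "int ^ 'd \<Rightarrow> real ^ 'd" where
  "lattice_embed x = (\<chi> i. real_of_int (x $ i))"

definition walk_step :: "(nat \<Rightarrow> 'w \<Rightarrow> int ^ 'd) \<Rightarrow> nat \<Rightarrow> 'w \<Rightarrow> int ^ 'd" where
  "walk_step S n \<omega> = S n \<omega> - S (n - 1) \<omega>"

definition recurrent_walk :: "'w measure \<Rightarrow> (nat \<Rightarrow> 'w \<Rightarrow> int ^ 'd) \<Rightarrow> bool" where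
  "recurrent_walk M S \<longleftrightarrow> (AE \<omega> in M. \<exists>\<^sub>\<infinity>n. S n \<omega> = 0)"

definition scaled_walk ::
    "real \<Rightarrow> (nat \<Rightarrow> 'w \<Rightarrow> int ^ 'd) \<Rightarrow> nat \<Rightarrow> 'w \<Rightarrow> real ^ 'd" where
  "scaled_walk \<alpha> S n \<omega> = real n powr (- 1 / \<alpha>) *\<^sub>R lattice_embed (S n \<omega>)"

definition scaled_walk_path ::
    "real \<Rightarrow> (nat \<Rightarrow> 'w \<Rightarrow> int ^ 'd) \<Rightarrow> nat \<Rightarrow> 'w \<Rightarrow> real \<Rightarrow> real ^ 'd" where
  "scaled_walk_path \<alpha> S n \<omega> =
    restrict (\<lambda>t. real n powr (- 1 / \<alpha>) *\<^sub>R lattice_embed (S (nat \<lfloor>real n * t\<rfloor>) \<omega>)) {0..}"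

text \<open>No centering is allowed: \<open>n powr (-1/\<alpha>) S\<^sub>n\<close> itself converges in distribution.\<close>

definition normal_domain_of_attraction ::
    "real \<Rightarrow> 'w measure \<Rightarrow> (nat \<Rightarrow> 'w \<Rightarrow> int ^ 'd) \<Rightarrow> bool" where
  "normal_domain_of_attraction \<alpha> M S \<longleftrightarrow>
    (\<exists>\<mu> :: (real ^ 'd) measure. stable_law \<alpha> \<mu> \<and>
       converges_in_distribution euclidean M (scaled_walk \<alpha> S) \<mu> (\<lambda>x. x))"

text \<open>The existential over the limiting process ranges over processes defined on the type of
  paths; since only the law of the process matters and the canonical realization lives there,
  this is no restriction. The parameter \<open>\<alpha>\<close> plays no role when the walk is transient.\<close>

locale random_walk_random_scenery = prob_space M
  for M :: "'w measure" +
  fixes S :: "nat \<Rightarrow> 'w \<Rightarrow> int ^ 'd"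
    and \<xi> :: "int ^ 'd \<Rightarrow> 'w \<Rightarrow> real"
    and \<alpha> :: real
  assumes walk_measurable: "\<And>n. S n \<in> measurable M (count_space UNIV)"
    and walk_start: "\<And>\<omega>. \<omega> \<in> space M \<Longrightarrow> S 0 \<omega> = 0"
    and steps_indep: "indep_vars (\<lambda>_. count_space UNIV) (walk_step S) {1..}"
    and steps_identical:
      "\<And>n. n \<ge> 1 \<Longrightarrow>
         distr M (count_space UNIV) (walk_step S n) = distr M (count_space UNIV) (walk_step S 1)"
    and scenery_indep: "indep_vars (\<lambda>_. borel) \<xi> UNIV"
    and scenery_identical: "\<And>x. distr M borel (\<xi> x) = distr M borel (\<xi> 0)"
    and walk_scenery_indep:
      "indep_set
         (sets (vimage_algebra (space M) (\<lambda>\<omega> n. S n \<omega>) (Pi\<^sub>M UNIV (\<lambda>_. count_space UNIV))))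
         (sets (vimage_algebra (space M) (\<lambda>\<omega> x. \<xi> x \<omega>) (Pi\<^sub>M UNIV (\<lambda>_. borel))))"
    and step_support:
      "\<nexists>H. additive_subgroup H \<and> H \<noteq> UNIV \<and>
            {x. prob {\<omega> \<in> space M. walk_step S 1 \<omega> = x} > 0} \<subseteq> H"
    and scenery_support:
      "closed_subgroup_generated (law_support (distr M borel (\<xi> 0))) \<in> {\<int>, UNIV}"
    and scenery_integrable: "integrable M (\<xi> 0)"
    and scenery_centered: "expectation (\<xi> 0) = 0"
    and scenery_square_integrable: "integrable M (\<lambda>\<omega>. (\<xi> 0 \<omega>)\<^sup>2)"
    and index_range: "recurrent_walk M S \<Longrightarrow> real CARD('d) \<le> \<alpha> \<and> \<alpha> \<le> 2"
    and attraction: "recurrent_walk M S \<Longrightarrow> normal_domain_of_attraction \<alpha> M S"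
    and attraction_dim2:
      "recurrent_walk M S \<Longrightarrow> CARD('d) = 2 \<Longrightarrow>
         \<exists>\<mu> :: (real ^ 'd) measure. gaussian_law \<mu> \<and>
           converges_in_distribution euclidean M (scaled_walk 2 S) \<mu> (\<lambda>x. x)"
    and attraction_dim1:
      "recurrent_walk M S \<Longrightarrow> CARD('d) = 1 \<Longrightarrow> \<alpha> > 1 \<Longrightarrow>
         \<exists>(N :: (real \<Rightarrow> real ^ 'd) measure) Y. stable_levy_process \<alpha> N Y \<and>
           converges_in_distribution skorokhod_J1 M (scaled_walk_path \<alpha> S)
             N (\<lambda>\<omega>. restrict (\<lambda>t. Y t \<omega>) {0..})"

text \<open>In the second case the formula \<open>sqrt (n log n)\<close> would give 0 at \<open>n = 1\<close>; the value there
  is set to 1, the common value of the other two cases.\<close>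

definition rwrs_norm :: "'w measure \<Rightarrow> (nat \<Rightarrow> 'w \<Rightarrow> int ^ 'd) \<Rightarrow> real \<Rightarrow> nat \<Rightarrow> real" where
  "rwrs_norm M S \<alpha> n =
    (if recurrent_walk M S \<and> CARD('d) = 1 \<and> \<alpha> \<in> {1<..2} then real n powr (1 - 1 / (2 * \<alpha>))
     else if recurrent_walk M S \<and> \<alpha> = real CARD('d) \<and> CARD('d) \<in> {1, 2} then
       (if n = 1 then 1 else sqrt (real n * ln (real n)))
     else sqrt (real n))"

definition rwrs ::
    "(nat \<Rightarrow> 'w \<Rightarrow> int ^ 'd) \<Rightarrow> (int ^ 'd \<Rightarrow> 'w \<Rightarrow> real) \<Rightarrow> nat \<Rightarrow> 'w \<Rightarrow> real" where
  "rwrs S \<xi> n \<omega> = (\<Sum>i=1..n. \<xi> (S i \<omega>) \<omega>)"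

definition rwrs_max ::
    "(nat \<Rightarrow> 'w \<Rightarrow> int ^ 'd) \<Rightarrow> (int ^ 'd \<Rightarrow> 'w \<Rightarrow> real) \<Rightarrow> nat \<Rightarrow> 'w \<Rightarrow> real" where
  "rwrs_max S \<xi> n \<omega> = Max ((\<lambda>k. rwrs S \<xi> k \<omega>) ` {1..n})"

end

theory Submission
  imports Defs
begin

text \<open>
  Let \<open>M\<^sub>n = max (0, Z\<^sub>1, \<dots>, Z\<^sub>n)\<close>. The increments of \<open>Z\<close> being stationary, shifting time by one
  gives \<open>\<E> M\<^sub>n\<^sub>+\<^sub>1 - \<E> M\<^sub>n = \<E> max (0, - Z\<^sup>*\<^sub>n\<^sub>+\<^sub>1)\<close>, which is nonincreasing in \<open>n\<close>; so it is of order
  \<open>a\<^sub>n / n\<close> as soon as \<open>\<E> M\<^sub>n\<close> is of order \<open>a\<^sub>n\<close>. It compares with persistence probabilities since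
  \<open>- Z\<^sup>*\<^sub>n \<le> - \<xi>\<close> at the first visited site, whose negative part has a moment of order
  \<open>max (2, \<beta>')\<close>, and since levels can be changed at the cost of a constant by forcing the first
  values of the scenery, which is positively correlated with \<open>{Z\<^sup>*\<^sub>n \<le> m}\<close>.

  Given the walk, \<open>\<E> M\<^sub>n\<close> is comparable to the square root of the number \<open>V\<^sub>n\<close> of
  self-intersections: from above by the maximal inequality of Newman and Wright, from below because
  \<open>\<E> \<bar>Z\<^sub>n\<bar>\<close> is controlled by the characteristic function of \<open>Z\<^sub>n\<close>. Finally, with \<open>G\<^sub>n\<close> the Green
  function at the origin and \<open>R\<^sub>n\<close> the range, \<open>\<E> V\<^sub>n \<le> 2 n G\<^sub>n\<close>, \<open>V\<^sub>n \<ge> n\<^sup>2 / R\<^sub>n\<close> and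
  \<open>\<E> R\<^sub>n \<le> \<Sum>k<n. 1 / G\<^sub>k\<close>, so everything reduces to the growth of \<open>G\<^sub>n\<close>. In the recurrent case this
  is read off the characteristic function of the steps near the origin; only nonnegative
  trigonometric sums are used, so that a possible periodicity of the walk plays no role.
\<close>

text \<open>Bounds up to constants suffice because the gaps are monotone, so that increments of the
  mean maximum over long blocks control a single gap. The exponent of the lower bounds comes from
  truncating the negative part of one scenery value: with b = max(2, \<beta>') the balance yields 1
  + 1/(b - 1), which never exceeds 1 + 2/\<beta>'. The mean maximum is governed by the mean of sqrt
  V_n, which the mean of V_n controls only from above. From below, the range enters through a
  tangent of x^(-1/2), which is linear and so sees only the mean range. For the Green function the
  obstacle is that neither aperiodicity nor a second moment of the steps is assumed, so local limit
  theorems are avoided. Return probabilities are bounded above by a Fejer kernel with small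
  frequencies only; the Green function is bounded below through the mean of V_n, a positive
  quadratic form in which large frequencies can be discarded.\<close>

lemma integrable_mult_of_squares:
  fixes f g :: "'a \<Rightarrow> real"
  assumes [measurable]: "f \<in> borel_measurable M" "g \<in> borel_measurable M"
    and "integrable M (\<lambda>x. (f x)\<^sup>2)" "integrable M (\<lambda>x. (g x)\<^sup>2)"
  shows "integrable M (\<lambda>x. f x * g x)"
proof (rule Bochner_Integration.integrable_bound)
  show "integrable M (\<lambda>x. (f x)\<^sup>2 + (g x)\<^sup>2)"
    using assms by auto
  have "\<bar>a * b\<bar> \<le> a\<^sup>2 + b\<^sup>2" for a b :: real
  proof -
    have "2 * \<bar>a * b\<bar> \<le> a\<^sup>2 + b\<^sup>2"
      using zero_le_power2[of "\<bar>a\<bar> - \<bar>b\<bar>"] by (simp add: power2_diff abs_mult)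
    then show ?thesis by simp
  qed
  then show "AE x in M. norm (f x * g x) \<le> norm ((f x)\<^sup>2 + (g x)\<^sup>2)"
    by (intro AE_I2) (smt (verit) real_norm_def)
qed auto

lemma (in finite_measure) integrable_of_square:
  fixes f :: "'a \<Rightarrow> real"
  assumes [measurable]: "f \<in> borel_measurable M" and "integrable M (\<lambda>x. (f x)\<^sup>2)"
  shows "integrable M f"
  using integrable_mult_of_squares[of f M "\<lambda>_. 1"] assms by simp

lemma (in prob_space) expectation_le_sqrt_square:
  fixes f :: "'a \<Rightarrow> real"
  assumes [measurable]: "f \<in> borel_measurable M" and "integrable M (\<lambda>x. (f x)\<^sup>2)"
  shows "expectation f \<le> sqrt (expectation (\<lambda>x. (f x)\<^sup>2))"
proof -
  have "0 \<le> variance f" by simp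
  also have "variance f = expectation (\<lambda>x. (f x)\<^sup>2) - (expectation f)\<^sup>2"
    by (rule variance_eq[OF integrable_of_square[OF assms] assms(2)])
  finally show ?thesis by (intro real_le_rsqrt) simp
qed

section \<open>Sums and maxima along a fixed path\<close>

definition site_sum :: "nat \<Rightarrow> (nat \<Rightarrow> 'i) \<Rightarrow> ('i \<Rightarrow> real) \<Rightarrow> real" where
  "site_sum n s x = (\<Sum>i<n. x (s i))"

text \<open>The maximum of 0 and the first \<open>n\<close> partial sums. Recursing on the first
  step builds in the time shift on which stationarity acts, and makes monotonicity in the scenery a
  direct induction.\<close>

primrec top0 :: "nat \<Rightarrow> (nat \<Rightarrow> 'i) \<Rightarrow> ('i \<Rightarrow> real) \<Rightarrow> real" where
  "top0 0 s x = 0"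
| "top0 (Suc n) s x = max 0 (x (s 0) + top0 n (\<lambda>i. s (Suc i)) x)"

text \<open>Beware of the shift: \<open>peak n\<close> is the maximum of the first \<open>n + 1\<close> partial sums.\<close>

definition peak :: "nat \<Rightarrow> (nat \<Rightarrow> 'i) \<Rightarrow> ('i \<Rightarrow> real) \<Rightarrow> real" where
  "peak n s x = x (s 0) + top0 n (\<lambda>i. s (Suc i)) x"

text \<open>The number V_n of self-intersections: ordered pairs, diagonal included, so that it is
  never below \<open>n\<close>.\<close>

definition pairs :: "nat \<Rightarrow> (nat \<Rightarrow> 'i) \<Rightarrow> real" where
  "pairs n s = (\<Sum>i<n. \<Sum>j<n. of_bool (s i = s j))"

lemma site_sum_Suc: "site_sum (Suc n) s x = x (s 0) + site_sum n (\<lambda>i. s (Suc i)) x"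
  by (simp add: site_sum_def sum.lessThan_Suc_shift del: sum.lessThan_Suc)

lemma top0_Suc_peak: "top0 (Suc n) s x = max 0 (peak n s x)"
  by (simp add: peak_def)

lemma peak_Suc: "peak (Suc n) s x = x (s 0) + max 0 (peak n (\<lambda>i. s (Suc i)) x)"
  by (simp add: peak_def)

declare top0.simps(2)[simp del]

lemma top0_nonneg: "0 \<le> top0 n s x"
  by (cases n) (auto simp: top0_Suc_peak)

lemma site_sum_le_top0: "site_sum n s x \<le> top0 n s x"
proof (induction n arbitrary: s)
  case (Suc n)
  from Suc[of "\<lambda>i. s (Suc i)"] show ?case by (auto simp: site_sum_Suc top0.simps(2))
qed (simp add: site_sum_def)

lemma top0_le_sum_abs: "top0 n s x \<le> (\<Sum>i<n. \<bar>x (s i)\<bar>)"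
proof (induction n arbitrary: s)
  case (Suc n)
  from Suc[of "\<lambda>i. s (Suc i)"] show ?case
    by (simp add: sum.lessThan_Suc_shift top0.simps(2) add_nonneg_nonneg sum_nonneg
        del: sum.lessThan_Suc)
qed simp

lemma top0_mono_arg: "(\<And>a. x a \<le> y a) \<Longrightarrow> top0 n s x \<le> top0 n s y"
proof (induction n arbitrary: s)
  case (Suc n)
  from Suc.IH[OF Suc.prems, of "\<lambda>i. s (Suc i)"] Suc.prems[of "s 0"] show ?case
    by (auto simp: top0.simps(2))
qed simp

lemma peak_mono_arg: "(\<And>a. x a \<le> y a) \<Longrightarrow> peak n s x \<le> peak n s y"
  unfolding peak_def by (intro add_mono top0_mono_arg)

text \<open>The difference is the minimum over k \<le> n of the sums of \<open>x (s i)\<close> over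
  k \<le> i < n, and a minimum of nondecreasing functions is nondecreasing. In the induction it
  reads min (x0 + Z') (Z' - M'), with Z' and M' taken along the shifted path.\<close>

lemma site_sum_minus_top0_mono_arg:
  "(\<And>a. x a \<le> y a) \<Longrightarrow> site_sum n s x - top0 n s x \<le> site_sum n s y - top0 n s y"
proof (induction n arbitrary: s)
  case (Suc n)
  have s: "site_sum n (\<lambda>i. s (Suc i)) x \<le> site_sum n (\<lambda>i. s (Suc i)) y"
    using Suc.prems by (auto simp: site_sum_def intro: sum_mono)
  from Suc.IH[OF Suc.prems, of "\<lambda>i. s (Suc i)"] Suc.prems[of "s 0"] s show ?case
    by (auto simp: top0.simps(2) site_sum_Suc max_def)
qed (simp add: site_sum_def)

lemma top0_mono: "m \<le> n \<Longrightarrow> top0 m s x \<le> top0 n s x"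
proof (induction n arbitrary: s m)
  case (Suc n)
  show ?case
  proof (cases m)
    case (Suc k)
    with Suc.prems Suc.IH[of k "\<lambda>i. s (Suc i)"] show ?thesis by (auto simp: top0.simps(2))
  qed (simp add: top0_nonneg)
qed simp

lemma peak_mono: "m \<le> n \<Longrightarrow> peak m s x \<le> peak n s x"
  by (simp add: peak_def top0_mono)

lemma first_le_peak: "x (s 0) \<le> peak n s x"
  by (simp add: peak_def top0_nonneg)

lemma top0_reindex: "top0 n s (\<lambda>a. x (f a)) = top0 n (\<lambda>i. f (s i)) x"
proof (induction n arbitrary: s)
  case (Suc n)
  show ?case using Suc[of "\<lambda>i. s (Suc i)"] by (simp add: top0.simps(2) o_def)
qed simp

lemma peak_reindex: "peak n s (\<lambda>a. x (f a)) = peak n (\<lambda>i. f (s i)) x"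
  using top0_reindex[of n "\<lambda>i. s (Suc i)" x f] by (simp add: peak_def o_def)

lemma top0_eq_Max: "top0 n s x = Max ((\<lambda>k. site_sum k s x) ` {..n})"
proof (induction n arbitrary: s)
  case 0 show ?case by (simp add: site_sum_def)
next
  case (Suc n)
  have "{..Suc n} = insert 0 (Suc ` {..n})"
    by (simp add: atMost_Suc_eq_insert_0)
  then have "(\<lambda>k. site_sum k s x) ` {..Suc n} =
      insert 0 ((\<lambda>t. x (s 0) + t) ` (\<lambda>k. site_sum k (\<lambda>i. s (Suc i)) x) ` {..n})"
    by (auto simp: image_image site_sum_Suc site_sum_def[of 0])
  moreover have "Max ((\<lambda>t. x (s 0) + t) ` (\<lambda>k. site_sum k (\<lambda>i. s (Suc i)) x) ` {..n}) =
      x (s 0) + Max ((\<lambda>k. site_sum k (\<lambda>i. s (Suc i)) x) ` {..n})"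
    by (subst mono_Max_commute[symmetric]) (auto simp: mono_def)
  ultimately show ?case by (simp only: top0.simps(2) Suc[of "\<lambda>i. s (Suc i)"]) simp
qed

lemma peak_eq_Max: "peak n s x = Max ((\<lambda>k. site_sum k s x) ` {1..Suc n})"
proof -
  have "{1..Suc n} = Suc ` {..n}"
    by (auto simp: image_iff) (metis Suc_le_D atMost_iff not_less_eq_eq)
  then have "(\<lambda>k. site_sum k s x) ` {1..Suc n} =
      (\<lambda>t. x (s 0) + t) ` (\<lambda>k. site_sum k (\<lambda>i. s (Suc i)) x) ` {..n}"
    by (auto simp: image_image site_sum_Suc)
  moreover have "Max ((\<lambda>t. x (s 0) + t) ` (\<lambda>k. site_sum k (\<lambda>i. s (Suc i)) x) ` {..n}) =
      x (s 0) + Max ((\<lambda>k. site_sum k (\<lambda>i. s (Suc i)) x) ` {..n})"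
    by (subst mono_Max_commute[symmetric]) (auto simp: mono_def)
  ultimately show ?thesis by (simp add: peak_def top0_eq_Max)
qed

text \<open>Path and scenery may both depend on \<open>z\<close>: this covers a fixed path as well
  as the pair of a random walk and its scenery.\<close>

lemma measurable_top0:
  fixes s :: "'z \<Rightarrow> nat \<Rightarrow> 'i"
  assumes "\<And>i. (\<lambda>z. X z (s z i)) \<in> borel_measurable N"
  shows "(\<lambda>z. top0 n (s z) (X z)) \<in> borel_measurable N"
  using assms
proof (induction n arbitrary: s)
  case (Suc n)
  have [measurable]: "(\<lambda>z. top0 n (\<lambda>i. s z (Suc i)) (X z)) \<in> borel_measurable N"
    using Suc.IH[of "\<lambda>z i. s z (Suc i)"] Suc.prems by (simp add: o_def)
  have [measurable]: "(\<lambda>z. X z (s z 0)) \<in> borel_measurable N"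
    by (rule Suc.prems)
  show ?case unfolding top0.simps by measurable
qed simp

lemma measurable_peak:
  fixes s :: "'z \<Rightarrow> nat \<Rightarrow> 'i"
  assumes "\<And>i. (\<lambda>z. X z (s z i)) \<in> borel_measurable N"
  shows "(\<lambda>z. peak n (s z) (X z)) \<in> borel_measurable N"
proof -
  have [measurable]: "(\<lambda>z. top0 n (\<lambda>i. s z (Suc i)) (X z)) \<in> borel_measurable N"
    using measurable_top0[of X "\<lambda>z i. s z (Suc i)"] assms by (simp add: o_def)
  have [measurable]: "(\<lambda>z. X z (s z 0)) \<in> borel_measurable N"
    by (rule assms)
  show ?thesis unfolding peak_def by measurable
qed

lemma pairs_eq_sum_card: "pairs n s = (\<Sum>a\<in>s ` {..<n}. (real (card {i\<in>{..<n}. s i = a}))\<^sup>2)"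
proof -
  have "pairs n s = (\<Sum>i<n. real (card {j\<in>{..<n}. s j = s i}))"
    unfolding pairs_def by (intro sum.cong) (auto simp: of_bool_def sum.If_cases Int_def eq_commute)
  also have "\<dots> = (\<Sum>a\<in>s ` {..<n}. \<Sum>i\<in>{i\<in>{..<n}. s i = a}. real (card {j\<in>{..<n}. s j = s i}))"
    by (rule sum.image_gen) simp
  also have "\<dots> = (\<Sum>a\<in>s ` {..<n}. (real (card {i\<in>{..<n}. s i = a}))\<^sup>2)"
    by (intro sum.cong) (auto simp: power2_eq_square)
  finally show ?thesis .
qed

text \<open>Grouping by sites exhibits the sum as a combination of distinct, hence independent,
  scenery values weighted by local times; \<open>pairs\<close> is the sum of the squared
  weights.\<close>

lemma site_sum_eq_sum_card:
  "site_sum n s x = (\<Sum>a\<in>s ` {..<n}. real (card {i\<in>{..<n}. s i = a}) * x a)"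
proof -
  have "site_sum n s x = (\<Sum>a\<in>s ` {..<n}. \<Sum>i\<in>{i\<in>{..<n}. s i = a}. x (s i))"
    unfolding site_sum_def by (rule sum.image_gen) simp
  also have "\<dots> = (\<Sum>a\<in>s ` {..<n}. real (card {i\<in>{..<n}. s i = a}) * x a)"
    by (intro sum.cong) auto
  finally show ?thesis .
qed

section \<open>Random scenery along a fixed path\<close>

text \<open>\<open>\<nu>\<close> is the law of the scenery at one site. Positivity of the variance
  is deduced from the assumption on the support when the locale is interpreted.\<close>

locale scenery = prob_space \<nu> for \<nu> :: "real measure" +
  assumes sets_scenery [measurable_cong]: "sets \<nu> = sets borel"
    and square_integrable: "integrable \<nu> (\<lambda>r. r\<^sup>2)"
    and centered: "(\<integral>r. r \<partial>\<nu>) = 0"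
    and nondegenerate: "0 < (\<integral>r. r\<^sup>2 \<partial>\<nu>)"
begin

definition \<sigma>2 :: real where "\<sigma>2 = (\<integral>r. r\<^sup>2 \<partial>\<nu>)"

abbreviation sceneries :: "('i \<Rightarrow> real) measure" where
  "sceneries \<equiv> Pi\<^sub>M UNIV (\<lambda>_. \<nu>)"

lemma space_scenery [simp]: "space \<nu> = UNIV"
  using sets_eq_imp_space_eq[OF sets_scenery] by simp

lemma space_sceneries [simp]: "space (sceneries :: ('i \<Rightarrow> real) measure) = UNIV"
  by (simp add: space_PiM)

lemma prob_space_sceneries: "prob_space (sceneries :: ('i \<Rightarrow> real) measure)"
  by (intro prob_space_PiM) unfold_locales

sublocale X: prob_space "sceneries :: ('i \<Rightarrow> real) measure"
  by (rule prob_space_sceneries)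

lemma measurable_coord [measurable]: "(\<lambda>x. x a) \<in> borel_measurable (sceneries :: ('i \<Rightarrow> real) measure)"
proof -
  have "(\<lambda>x. x a) \<in> measurable (sceneries :: ('i \<Rightarrow> real) measure) \<nu>" by simp
  then show ?thesis by (simp only: measurable_cong_sets[OF refl sets_scenery])
qed

lemma distr_coord: "distr sceneries \<nu> (\<lambda>x. x (a::'i)) = \<nu>"
  by (intro distr_PiM_component) (auto intro: prob_space_axioms)

lemma integral_coord:
  fixes f :: "real \<Rightarrow> 'b::{banach, second_countable_topology}"
  assumes [measurable]: "f \<in> borel_measurable borel"
  shows "(\<integral>x. f (x (a::'i)) \<partial>sceneries) = (\<integral>r. f r \<partial>\<nu>)"
    and "integrable sceneries (\<lambda>x. f (x a)) \<longleftrightarrow> integrable \<nu> f"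
proof -
  have m: "(\<lambda>x. x a) \<in> measurable (sceneries :: ('i \<Rightarrow> real) measure) \<nu>" by simp
  have f: "f \<in> borel_measurable \<nu>"
    using assms measurable_cong_sets[OF sets_scenery refl, of borel] by blast
  show "(\<integral>x. f (x (a::'i)) \<partial>sceneries) = (\<integral>r. f r \<partial>\<nu>)"
    using integral_distr[OF m f]
    by (simp add: distr_coord)
  show "integrable sceneries (\<lambda>x. f (x a)) \<longleftrightarrow> integrable \<nu> f"
    using integrable_distr_eq[OF m f]
    by (simp add: distr_coord)
qed

lemma indep_coords: "X.indep_vars (\<lambda>_. \<nu>) (\<lambda>a x. x a) (UNIV :: 'i set)"
proof (subst X.indep_vars_iff_distr_eq_PiM)
  show "distr sceneries (Pi\<^sub>M UNIV (\<lambda>_. \<nu>)) (\<lambda>x. \<lambda>i\<in>UNIV. x (i::'i)) =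
      Pi\<^sub>M UNIV (\<lambda>i. distr sceneries \<nu> (\<lambda>x. x i))"
    by (simp add: distr_coord restrict_UNIV distr_id)
qed auto

text \<open>A function insensitive to the coordinate \<open>a\<close> is a function of the other
  coordinates, hence independent of that one.\<close>

lemma integral_coord_mult:
  fixes H :: "('i \<Rightarrow> real) \<Rightarrow> real" and a :: 'i
  assumes [measurable]: "f \<in> borel_measurable borel" "H \<in> borel_measurable sceneries"
    and f: "integrable \<nu> f" and H: "integrable sceneries H"
    and dep: "\<And>x. H (x(a := t)) = H x"
  shows "(\<integral>x. f (x a) * H x \<partial>sceneries) = (\<integral>r. f r \<partial>\<nu>) * (\<integral>x. H x \<partial>sceneries)"
    and "integrable sceneries (\<lambda>x. f (x a) * H x)"
proof -
  let ?B = "UNIV - {a}"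
  \<comment> \<open>\<open>H\<close> read as a function of the remaining coordinates, the missing
    one being filled with \<open>t\<close>.\<close>
  define G where "G z = H (\<lambda>i. if i = a then t else z i)" for z
  have "(\<lambda>z i. if i = a then t else z i) \<in> measurable (Pi\<^sub>M ?B (\<lambda>_. \<nu>)) (sceneries :: ('i \<Rightarrow> real) measure)"
  proof (rule measurable_PiM_single')
    fix i show "(\<lambda>z. if i = a then t else z i) \<in> measurable (Pi\<^sub>M ?B (\<lambda>_. \<nu>)) \<nu>"
      by (cases "i = a") (auto intro!: measurable_component_singleton)
  qed (auto simp: space_PiM)
  then have [measurable]: "G \<in> borel_measurable (Pi\<^sub>M ?B (\<lambda>_. \<nu>))"
    unfolding G_def by measurable
  have "X.indep_var (Pi\<^sub>M {a} (\<lambda>_. \<nu>)) (\<lambda>x. restrict (\<lambda>i. x i) {a}) (Pi\<^sub>M ?B (\<lambda>_. \<nu>)) (\<lambda>x. restrict (\<lambda>i. x i) ?B)"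
    by (rule X.indep_var_restrict[OF indep_coords]) auto
  then have "X.indep_var borel ((\<lambda>z. f (z a)) \<circ> (\<lambda>x. restrict (\<lambda>i. x i) {a})) borel (G \<circ> (\<lambda>x. restrict (\<lambda>i. x i) ?B))"
  proof (rule X.indep_var_compose)
    have "(\<lambda>z. z a) \<in> measurable (Pi\<^sub>M {a} (\<lambda>_. \<nu>)) \<nu>" by simp
    then have [measurable]: "(\<lambda>z. z a) \<in> borel_measurable (Pi\<^sub>M {a} (\<lambda>_. \<nu>))"
      using measurable_cong_sets[OF refl sets_scenery] by blast
    show "(\<lambda>z. f (z a)) \<in> borel_measurable (Pi\<^sub>M {a} (\<lambda>_. \<nu>))" by measurable
  qed auto
  moreover have "(\<lambda>z. f (z a)) \<circ> (\<lambda>x. restrict (\<lambda>i. x i) {a}) = (\<lambda>x. f (x a))"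
    by (auto simp: fun_eq_iff)
  moreover have "G \<circ> (\<lambda>x. restrict (\<lambda>i. x i) ?B) = H"
  proof
    fix x
    have "(\<lambda>i. if i = a then t else restrict x ?B i) = x(a := t)" by auto
    then show "(G \<circ> (\<lambda>x. restrict (\<lambda>i. x i) ?B)) x = H x" by (simp add: G_def dep)
  qed
  ultimately have ind: "X.indep_var borel (\<lambda>x. f (x a)) borel H" by simp
  have "integrable sceneries (\<lambda>x. f (x a))" using f by (simp add: integral_coord)
  from X.indep_var_lebesgue_integral[OF ind this H] X.indep_var_integrable[OF ind this H]
  show "(\<integral>x. f (x a) * H x \<partial>sceneries) = (\<integral>r. f r \<partial>\<nu>) * (\<integral>x. H x \<partial>sceneries)"
    "integrable sceneries (\<lambda>x. f (x a) * H x)" by (simp_all add: integral_coord)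
qed

lemma measurable_upd: "(\<lambda>x. x(a := t)) \<in> measurable sceneries (sceneries :: ('i \<Rightarrow> real) measure)"
proof (rule measurable_PiM_single')
  fix i :: 'i
  show "(\<lambda>x. (x(a := t)) i) \<in> measurable sceneries \<nu>"
    by (cases "i = a") (auto intro!: measurable_component_singleton)
qed (auto simp: space_PiM)

text \<open>The only correlation inequality needed: replacing the coordinate \<open>a\<close> by the constant \<open>t\<close>
  makes the two factors independent, and it can only decrease the expectation.\<close>

lemma integral_coord_mult_nonneg:
  fixes K :: "('i \<Rightarrow> real) \<Rightarrow> real" and a :: 'i
  assumes [measurable]: "f \<in> borel_measurable borel" "K \<in> borel_measurable sceneries"
    and f: "integrable \<nu> f" "(\<integral>r. f r \<partial>\<nu>) = 0"
    and K: "integrable sceneries (\<lambda>x. K (x(a := t)))" "integrable sceneries (\<lambda>x. f (x a) * K x)"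
    and le: "\<And>x. 0 \<le> f (x a) * (K x - K (x(a := t)))"
  shows "0 \<le> (\<integral>x. f (x a) * K x \<partial>sceneries)"
proof -
  have [measurable]: "(\<lambda>x. K (x(a := t))) \<in> borel_measurable sceneries"
    using measurable_upd by measurable
  have m: "(\<integral>x. f (x a) * K (x(a := t)) \<partial>sceneries) = 0"
    "integrable sceneries (\<lambda>x. f (x a) * K (x(a := t)))"
    using integral_coord_mult[of f "\<lambda>x. K (x(a := t))" a t] f K by simp_all
  have "(\<integral>x. f (x a) * K (x(a := t)) \<partial>sceneries) \<le> (\<integral>x. f (x a) * K x \<partial>sceneries)"
    by (intro integral_mono m K) (use le in \<open>simp add: algebra_simps\<close>)
  with m show ?thesis by simp
qed

lemma measurable_scenery_iff [simp]: "measurable \<nu> N = measurable borel N"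
  by (rule measurable_cong_sets[OF sets_scenery refl])

lemma prob_UNIV [simp]: "X.prob UNIV = 1" "prob UNIV = 1"
  using X.prob_space prob_space by simp_all

lemma integrable_id: "integrable \<nu> (\<lambda>r. r)"
  using square_integrable by (rule integrable_of_square[rotated, of "\<lambda>r. r"]) (simp add: measurable_cong_sets[OF sets_scenery refl])

lemma integrable_coord_square: "integrable sceneries (\<lambda>x. (x (a::'i))\<^sup>2)"
  using integral_coord(2)[of "\<lambda>r. r\<^sup>2"] square_integrable by simp

lemma integrable_coord: "integrable sceneries (\<lambda>x. x (a::'i))"
  by (rule integral_coord(2)[of "\<lambda>r. r", THEN iffD2]) (auto intro: integrable_id)

lemma integrable_coord_prod: "integrable sceneries (\<lambda>x. x (a::'i) * x b)"
  by (intro integrable_mult_of_squares integrable_coord_square) simp_all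

lemma expectation_coord: "X.expectation (\<lambda>x. x (a::'i)) = 0"
  unfolding centered[symmetric] by (rule integral_coord(1)[of "\<lambda>r. r"]) auto

lemma expectation_coord_prod:
  "X.expectation (\<lambda>x. x (a::'i) * x b) = \<sigma>2 * of_bool (a = b)"
proof (cases "a = b")
  case True
  then show ?thesis
    using integral_coord(1)[of "\<lambda>r. r * r" a] by (simp add: \<sigma>2_def power2_eq_square)
next
  case False
  have "X.expectation (\<lambda>x. x a * x b) = expectation (\<lambda>r. r) * X.expectation (\<lambda>x. x b)"
    by (rule integral_coord_mult(1)[where f = "\<lambda>r. r" and t = 0])
       (use False in \<open>auto intro: integrable_id integrable_coord\<close>)
  with False centered show ?thesis by simp
qed

section \<open>Second moments and the maximal inequality along a path\<close>

lemma measurable_site_sum [measurable]: "site_sum n s \<in> borel_measurable sceneries"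
  unfolding site_sum_def by measurable

lemma measurable_top0_path [measurable]: "top0 n s \<in> borel_measurable sceneries"
  using measurable_top0[of "\<lambda>x. x" "\<lambda>_. s"] by simp

lemma measurable_peak_path [measurable]: "peak n s \<in> borel_measurable sceneries"
  using measurable_peak[of "\<lambda>x. x" "\<lambda>_. s"] by simp

lemma site_sum_square: "(site_sum n s x)\<^sup>2 = (\<Sum>i<n. \<Sum>j<n. x (s i) * x (s j))"
  by (simp add: site_sum_def power2_eq_square sum_product)

lemma integrable_site_sum_square: "integrable sceneries (\<lambda>x. (site_sum n s x)\<^sup>2)"
  unfolding site_sum_square by (intro Bochner_Integration.integrable_sum integrable_coord_prod)

lemma expectation_site_sum_square:
  "X.expectation (\<lambda>x. (site_sum n s x)\<^sup>2) = \<sigma>2 * pairs n s"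
  unfolding site_sum_square pairs_def
  by (simp only: integrable_coord_prod expectation_coord_prod sum_distrib_left
      Bochner_Integration.integral_sum Bochner_Integration.integrable_sum)

lemma expectation_site_sum: "X.expectation (site_sum n s) = 0"
  unfolding site_sum_def by (simp add: integrable_coord expectation_coord)

lemma integrable_site_sum: "integrable sceneries (site_sum n s)"
  unfolding site_sum_def by (simp add: integrable_coord)

lemma integrable_sum_abs_square: "integrable sceneries (\<lambda>x. (\<Sum>i<n. \<bar>x (s i :: 'i)\<bar>)\<^sup>2)"
proof -
  have "integrable sceneries (\<lambda>x. \<bar>x (a::'i)\<bar> * \<bar>x b\<bar>)" for a b
    by (intro integrable_mult_of_squares) (simp_all add: integrable_coord_square)
  then show ?thesis
    unfolding power2_eq_square sum_product by (intro Bochner_Integration.integrable_sum)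
qed

lemma integrable_top0_square: "integrable sceneries (\<lambda>x. (top0 n s x)\<^sup>2)"
proof (rule Bochner_Integration.integrable_bound[OF integrable_sum_abs_square])
  show "AE x in sceneries. norm ((top0 n s x)\<^sup>2) \<le> norm ((\<Sum>i<n. \<bar>x (s i)\<bar>)\<^sup>2)"
    by (intro AE_I2) (simp add: power_mono top0_le_sum_abs top0_nonneg)
qed measurable

lemma integrable_top0: "integrable sceneries (top0 n s)"
  by (rule X.integrable_of_square[OF _ integrable_top0_square]) measurable

lemma integrable_peak: "integrable sceneries (peak n s)"
  unfolding peak_def by (intro Bochner_Integration.integrable_add integrable_coord integrable_top0)

text \<open>The maximal inequality of Newman and Wright for associated variables.\<close>

lemma expectation_top0_square_le:
  "X.expectation (\<lambda>x. (top0 n s x)\<^sup>2) \<le> \<sigma>2 * pairs n (s :: nat \<Rightarrow> 'i)"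
  unfolding expectation_site_sum_square[symmetric]
proof (induction n arbitrary: s)
  case (Suc n)
  define a s' where "a = s 0" and "s' = (\<lambda>i. s (Suc i))"
  \<comment> \<open>A minimum of tail sums, nondecreasing in each coordinate; hence its correlation
    with the centered \<open>x a\<close> is nonnegative, even if the path returns to
    \<open>a\<close>.\<close>
  define K where "K x = site_sum n s' x - top0 n s' x" for x
  have [measurable]: "K \<in> borel_measurable sceneries"
    unfolding K_def by measurable
  have int_T: "integrable sceneries (\<lambda>x. x a * top0 n s' x)"
    by (intro integrable_mult_of_squares integrable_coord_square integrable_top0_square) measurable
  have int_Z: "integrable sceneries (\<lambda>x. x a * site_sum n s' x)"
    by (intro integrable_mult_of_squares integrable_coord_square integrable_site_sum_square) measurable
  have "0 \<le> X.expectation (\<lambda>x. x a * K x)"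
  proof (rule integral_coord_mult_nonneg[where f = "\<lambda>r. r" and t = 0])
    show "integrable sceneries (\<lambda>x. K (x(a := 0)))"
    proof (rule Bochner_Integration.integrable_bound)
      show "integrable sceneries (\<lambda>x. 2 * (\<Sum>i<n. \<bar>x (s' i)\<bar>))"
        by (auto intro!: integrable_coord)
      show "(\<lambda>x. K (x(a := 0))) \<in> borel_measurable sceneries"
        using measurable_upd by measurable
      have "\<bar>K (x(a := 0))\<bar> \<le> 2 * (\<Sum>i<n. \<bar>x (s' i)\<bar>)" for x
      proof -
        let ?y = "x(a := 0)"
        have "\<bar>site_sum n s' ?y\<bar> \<le> (\<Sum>i<n. \<bar>?y (s' i)\<bar>)" unfolding site_sum_def by (rule sum_abs)
        moreover have "top0 n s' ?y \<le> (\<Sum>i<n. \<bar>?y (s' i)\<bar>)" by (rule top0_le_sum_abs)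
        moreover have "(\<Sum>i<n. \<bar>?y (s' i)\<bar>) \<le> (\<Sum>i<n. \<bar>x (s' i)\<bar>)" by (intro sum_mono) auto
        ultimately show ?thesis using top0_nonneg[of n s' ?y] unfolding K_def by linarith
      qed
      then show "AE x in sceneries. norm (K (x(a := 0))) \<le> norm (2 * (\<Sum>i<n. \<bar>x (s' i)\<bar>))"
        by (intro AE_I2) (smt (verit) real_norm_def)
    qed
    show "integrable sceneries (\<lambda>x. x a * K x)"
      using int_T int_Z by (simp add: K_def right_diff_distrib)
    show "0 \<le> x a * (K x - K (x(a := 0)))" for x
    proof (cases "0 \<le> x a")
      case True
      then have "K (x(a := 0)) \<le> K x"
        unfolding K_def by (intro site_sum_minus_top0_mono_arg) auto
      with True show ?thesis by simp
    next
      case False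
      then have "K x \<le> K (x(a := 0))"
        unfolding K_def by (intro site_sum_minus_top0_mono_arg) auto
      with False show ?thesis by (simp add: mult_nonpos_nonpos)
    qed
    show "integrable \<nu> (\<lambda>r. r)" "expectation (\<lambda>r. r) = 0"
      by (fact integrable_id centered)+
  qed measurable
  also have "X.expectation (\<lambda>x. x a * K x) =
      X.expectation (\<lambda>x. x a * site_sum n s' x) - X.expectation (\<lambda>x. x a * top0 n s' x)"
    using int_T int_Z by (simp add: K_def right_diff_distrib)
  finally have cross: "X.expectation (\<lambda>x. x a * top0 n s' x) \<le> X.expectation (\<lambda>x. x a * site_sum n s' x)"
    by simp
  have "X.expectation (\<lambda>x. (top0 (Suc n) s x)\<^sup>2) \<le>
      X.expectation (\<lambda>x. (x a)\<^sup>2 + 2 * (x a * top0 n s' x) + (top0 n s' x)\<^sup>2)"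
  proof (rule integral_mono)
    fix x
    \<comment> \<open>Squaring removes the outer maximum at no cost, so that only the cross term has
      to be compared with that of the full sum.\<close>
    have "(max 0 (x a + top0 n s' x))\<^sup>2 \<le> (x a + top0 n s' x)\<^sup>2"
      by (auto simp: max_def)
    then show "(top0 (Suc n) s x)\<^sup>2 \<le> (x a)\<^sup>2 + 2 * (x a * top0 n s' x) + (top0 n s' x)\<^sup>2"
      by (simp add: top0.simps(2) a_def s'_def power2_sum)
  qed (auto intro!: Bochner_Integration.integrable_add integrable_mult_right int_T
        integrable_top0_square integrable_coord_square)
  also have "\<dots> = X.expectation (\<lambda>x. (x a)\<^sup>2) + 2 * X.expectation (\<lambda>x. x a * top0 n s' x)
      + X.expectation (\<lambda>x. (top0 n s' x)\<^sup>2)"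
    by (simp add: int_T integrable_top0_square integrable_coord_square)
  also have "\<dots> \<le> X.expectation (\<lambda>x. (x a)\<^sup>2) + 2 * X.expectation (\<lambda>x. x a * site_sum n s' x)
      + X.expectation (\<lambda>x. (site_sum n s' x)\<^sup>2)"
    using cross Suc.IH[of s'] by simp
  also have "\<dots> = X.expectation (\<lambda>x. (x a)\<^sup>2 + 2 * (x a * site_sum n s' x) + (site_sum n s' x)\<^sup>2)"
    by (simp add: int_Z integrable_site_sum_square integrable_coord_square)
  also have "\<dots> = X.expectation (\<lambda>x. (site_sum (Suc n) s x)\<^sup>2)"
    by (intro Bochner_Integration.integral_cong)
       (auto simp: site_sum_Suc a_def s'_def power2_sum)
  finally show ?case .
qed (simp add: site_sum_def)

lemma expectation_top0_le: "X.expectation (top0 n s) \<le> sqrt \<sigma>2 * sqrt (pairs n s)"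
proof -
  have "X.expectation (top0 n s) \<le> sqrt (X.expectation (\<lambda>x. (top0 n s x)\<^sup>2))"
    by (intro X.expectation_le_sqrt_square integrable_top0_square) measurable
  also have "\<dots> \<le> sqrt (\<sigma>2 * pairs n s)"
    using expectation_top0_square_le by simp
  finally show ?thesis by (simp add: real_sqrt_mult)
qed

text \<open>With only two moments the Taylor remainder has no rate: \<open>R\<close> tends to 0 by
  dominated convergence, and its monotonicity in |t| turns the limit along a sequence into a bound
  on an interval.\<close>

lemma char_bound: "\<exists>t0>0. \<forall>t. \<bar>t\<bar> \<le> t0 \<longrightarrow> cmod (char \<nu> t) \<le> 1 - t\<^sup>2 * \<sigma>2 / 4"
proof -
  interpret D: real_distribution \<nu>
    by unfold_locales (auto simp: sets_scenery)
  have s0: "\<sigma>2 > 0" using nondegenerate by (simp add: \<sigma>2_def)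
  define R where "R t = expectation (\<lambda>x. min (6 * x\<^sup>2) (\<bar>t\<bar> * \<bar>x\<bar> ^ 3))" for t :: real
  have int: "integrable \<nu> (\<lambda>x. min (6 * x\<^sup>2) (\<bar>t\<bar> * \<bar>x\<bar> ^ 3))" for t :: real
    by (rule Bochner_Integration.integrable_bound[of _ "\<lambda>x. 6 * x\<^sup>2"])
       (use square_integrable in \<open>auto simp: min_def\<close>)
  have "(\<lambda>n. R (inverse (real (Suc n)))) \<longlonglongrightarrow> expectation (\<lambda>x. 0)"
    unfolding R_def
  proof (rule integral_dominated_convergence[where w = "\<lambda>x. 6 * x\<^sup>2"])
    show "AE x in \<nu>. (\<lambda>n. min (6 * x\<^sup>2) (\<bar>inverse (real (Suc n))\<bar> * \<bar>x\<bar> ^ 3)) \<longlonglongrightarrow> 0"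
    proof (intro AE_I2)
      fix x :: real
      have "(\<lambda>n. min (6 * x\<^sup>2) (\<bar>inverse (real (Suc n))\<bar> * \<bar>x\<bar> ^ 3)) \<longlonglongrightarrow>
          min (6 * x\<^sup>2) (\<bar>0\<bar> * \<bar>x\<bar> ^ 3)"
        by (intro tendsto_intros LIMSEQ_inverse_real_of_nat)
      then show "(\<lambda>n. min (6 * x\<^sup>2) (\<bar>inverse (real (Suc n))\<bar> * \<bar>x\<bar> ^ 3)) \<longlonglongrightarrow> 0" by simp
    qed
  qed (use square_integrable in \<open>auto simp: min_def\<close>)
  then have "\<forall>\<^sub>F n in sequentially. R (inverse (real (Suc n))) < 3 * \<sigma>2 / 2"
    using s0 by (intro order_tendstoD(2)) auto
  then obtain n where n: "R (inverse (real (Suc n))) < 3 * \<sigma>2 / 2"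
    using eventually_happens'[OF sequentially_bot] by blast
  define t1 where "t1 = inverse (real (Suc n))"
  have t1: "t1 > 0" by (simp add: t1_def)
  \<comment> \<open>The second bound keeps 1 - t^2 \<open>\<sigma>2\<close> / 2 nonnegative, so that
    it equals its own modulus.\<close>
  define t0 where "t0 = min t1 (1 / sqrt \<sigma>2)"
  show ?thesis
  proof (intro exI[of _ t0] conjI allI impI)
    show "t0 > 0" using t1 s0 by (simp add: t0_def)
    fix t :: real assume t: "\<bar>t\<bar> \<le> t0"
    have "R t \<le> R t1"
      unfolding R_def using t t1
      by (intro integral_mono int min.mono mult_right_mono) (auto simp: t0_def)
    with n have "R t \<le> 3 * \<sigma>2 / 2" by (simp add: t1_def)
    have "cmod (char \<nu> t - (1 - t\<^sup>2 * \<sigma>2 / 2)) \<le> (t\<^sup>2 / 6) * R t"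
      unfolding R_def
      by (rule D.char_approx3) (use integrable_id square_integrable centered in \<open>auto simp: \<sigma>2_def\<close>)
    also have "\<dots> \<le> (t\<^sup>2 / 6) * (3 * \<sigma>2 / 2)"
      using \<open>R t \<le> 3 * \<sigma>2 / 2\<close> by (intro mult_left_mono) auto
    finally have *: "cmod (char \<nu> t - (1 - t\<^sup>2 * \<sigma>2 / 2)) \<le> t\<^sup>2 * \<sigma>2 / 4"
      by (simp add: mult.commute)
    have "\<bar>t\<bar>\<^sup>2 \<le> (1 / sqrt \<sigma>2)\<^sup>2"
      using t by (intro power_mono) (auto simp: t0_def)
    then have "t\<^sup>2 * \<sigma>2 \<le> 1"
      using s0 by (simp add: power_divide field_simps)
    then have "cmod (complex_of_real (1 - t\<^sup>2 * \<sigma>2 / 2)) = 1 - t\<^sup>2 * \<sigma>2 / 2"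
      unfolding norm_of_real by simp
    moreover have "cmod (char \<nu> t) \<le> cmod (char \<nu> t - (1 - t\<^sup>2 * \<sigma>2 / 2)) +
        cmod (complex_of_real (1 - t\<^sup>2 * \<sigma>2 / 2))"
      using norm_triangle_sub[of "char \<nu> t" "complex_of_real (1 - t\<^sup>2 * \<sigma>2 / 2)"] by simp
    ultimately show "cmod (char \<nu> t) \<le> 1 - t\<^sup>2 * \<sigma>2 / 4" using * by simp
  qed
qed

lemma expectation_iexp_sum:
  fixes c :: "'i \<Rightarrow> real"
  assumes "finite A"
  shows "(CLINT x|sceneries. iexp (\<Sum>a\<in>A. c a * x a)) = (\<Prod>a\<in>A. char \<nu> (c a))"
proof -
  have "X.indep_vars (\<lambda>_. \<nu>) (\<lambda>a x. x a) A"
    using X.indep_vars_subset[OF indep_coords] by auto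
  then have ind: "X.indep_vars (\<lambda>_. borel) (\<lambda>a x. iexp (c a * x a)) A"
    by (rule X.indep_vars_compose2[where Y = "\<lambda>a r. iexp (c a * r)"]) simp
  have "(CLINT x|sceneries. iexp (\<Sum>a\<in>A. c a * x a)) = (CLINT x|sceneries. \<Prod>a\<in>A. iexp (c a * x a))"
    using assms by (simp add: exp_sum sum_distrib_left)
  also have "\<dots> = (\<Prod>a\<in>A. CLINT x|sceneries. iexp (c a * x a))"
  proof (rule X.indep_vars_lebesgue_integral[OF assms ind])
    fix a
    show "integrable sceneries (\<lambda>x. iexp (c a * x a))"
      by (rule X.integrable_const_bound[where B = 1]) (auto simp: norm_exp_i_times)
  qed
  also have "\<dots> = (\<Prod>a\<in>A. char \<nu> (c a))"
    unfolding char_def by (intro prod.cong refl integral_coord(1)[of "\<lambda>r. iexp (_ * r)"]) auto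
  finally show ?thesis .
qed

text \<open>For every t > 0, 1 - |E exp(i t Z)| is at most t E|Z|. At t = \<open>t0 / sqrt V\<close>
  the characteristic function factorizes over sites and is at most exp(-t^2 \<open>\<sigma>2\<close>
  V / 4) = \<open>q\<close>, a constant below 1 that depends neither on the path nor on
  \<open>n\<close>.\<close>

lemma expectation_abs_site_sum_ge:
  "\<exists>\<kappa>>0. \<forall>n (s :: nat \<Rightarrow> 'i). \<kappa> * sqrt (pairs n s) \<le> X.expectation (\<lambda>x. \<bar>site_sum n s x\<bar>)"
proof -
  obtain t0 where t0: "t0 > 0" and char: "\<And>t. \<bar>t\<bar> \<le> t0 \<Longrightarrow> cmod (char \<nu> t) \<le> 1 - t\<^sup>2 * \<sigma>2 / 4"
    using char_bound by blast
  have s0: "\<sigma>2 > 0" using nondegenerate by (simp add: \<sigma>2_def)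
  define q where "q = exp (- t0\<^sup>2 * \<sigma>2 / 4)"
  have q: "q < 1" using t0 s0 by (simp add: q_def)
  show ?thesis
  proof (intro exI[of _ "(1 - q) / t0"] conjI allI)
    show "(1 - q) / t0 > 0" using q t0 by simp
    fix n and s :: "nat \<Rightarrow> 'i"
    let ?A = "s ` {..<n}"
    define N where "N a = real (card {i\<in>{..<n}. s i = a})" for a
    define V where "V = pairs n s"
    have V: "V = (\<Sum>a\<in>?A. (N a)\<^sup>2)" by (simp add: V_def N_def pairs_eq_sum_card)
    have V0: "V \<ge> 0" unfolding V by (intro sum_nonneg) auto
    show "(1 - q) / t0 * sqrt (pairs n s) \<le> X.expectation (\<lambda>x. \<bar>site_sum n s x\<bar>)"
    proof (cases "V = 0")
      case True
      then show ?thesis by (simp add: V_def[symmetric])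
    next
      case False
      with V0 have Vp: "V > 0" by simp
      define t where "t = t0 / sqrt V"
      have t: "t > 0" using t0 Vp by (simp add: t_def)
      have "cmod (\<Prod>a\<in>?A. char \<nu> (t * N a)) \<le> (\<Prod>a\<in>?A. exp (- (t * N a)\<^sup>2 * \<sigma>2 / 4))"
        unfolding prod_norm[symmetric]
      proof (intro prod_mono conjI)
        fix a assume a: "a \<in> ?A"
        \<comment> \<open>No single local time exceeds the square root of \<open>V\<close>, so every
          argument stays in the range where the one-site bound holds.\<close>
        have "(N a)\<^sup>2 \<le> V" unfolding V using a by (intro member_le_sum) auto
        then have "N a \<le> sqrt V" by (simp add: real_le_rsqrt)
        then have "\<bar>t * N a\<bar> \<le> t0"
          using t0 Vp by (simp add: t_def N_def field_simps abs_mult)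
        then have "cmod (char \<nu> (t * N a)) \<le> 1 + (- (t * N a)\<^sup>2 * \<sigma>2 / 4)"
          using char by force
        also have "\<dots> \<le> exp (- (t * N a)\<^sup>2 * \<sigma>2 / 4)" by (rule exp_ge_add_one_self)
        finally show "cmod (char \<nu> (t * N a)) \<le> exp (- (t * N a)\<^sup>2 * \<sigma>2 / 4)" .
      qed auto
      also have "\<dots> = exp (\<Sum>a\<in>?A. - (t * N a)\<^sup>2 * \<sigma>2 / 4)" by (simp add: exp_sum)
      also have "(\<Sum>a\<in>?A. - (t * N a)\<^sup>2 * \<sigma>2 / 4) = - t\<^sup>2 * V * \<sigma>2 / 4"
        unfolding V by (simp add: sum_distrib_left sum_distrib_right sum_divide_distrib
            sum_negf power_mult_distrib algebra_simps)
      also have "\<dots> = - t0\<^sup>2 * \<sigma>2 / 4" using Vp by (simp add: t_def power_divide)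
      finally have *: "cmod (\<Prod>a\<in>?A. char \<nu> (t * N a)) \<le> q" by (simp add: q_def)
      have Z: "t * site_sum n s x = (\<Sum>a\<in>?A. t * N a * x a)" for x
        unfolding site_sum_eq_sum_card N_def by (simp add: sum_distrib_left mult.assoc)
      have int: "integrable sceneries (\<lambda>x. iexp (t * site_sum n s x))"
        by (rule X.integrable_const_bound[where B = 1]) (auto simp: norm_exp_i_times)
      have "1 - q \<le> 1 - cmod (CLINT x|sceneries. iexp (t * site_sum n s x))"
        using * expectation_iexp_sum[of ?A "\<lambda>a. t * N a"] by (simp add: Z)
      also have "\<dots> \<le> cmod (CLINT x|sceneries. iexp (t * site_sum n s x) - 1)"
        using int norm_triangle_ineq2[of 1 "CLINT x|sceneries. iexp (t * site_sum n s x)"]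
        by (simp add: norm_minus_commute X.prob_space)
      also have "\<dots> \<le> X.expectation (\<lambda>x. cmod (iexp (t * site_sum n s x) - 1))"
        by (rule integral_norm_bound)
      also have "\<dots> \<le> X.expectation (\<lambda>x. t * \<bar>site_sum n s x\<bar>)"
      proof (rule integral_mono)
        fix x
        show "cmod (iexp (t * site_sum n s x) - 1) \<le> t * \<bar>site_sum n s x\<bar>"
          using iexp_approx1[of "t * site_sum n s x" 0] t by (simp add: abs_mult)
      
        show "integrable sceneries (\<lambda>x. cmod (iexp (t * site_sum n s x) - 1))"
          using int by (intro integrable_norm Bochner_Integration.integrable_diff) auto
      qed (simp add: integrable_site_sum)
      also have "\<dots> = t0 / sqrt V * X.expectation (\<lambda>x. \<bar>site_sum n s x\<bar>)"
        by (simp add: t_def integrable_site_sum)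
      finally show ?thesis
        using t0 Vp by (simp add: V_def[symmetric] field_simps)
    qed
  qed
qed

text \<open>The sum is centered, so its positive part has half the mean of its absolute value, and
  \<open>top0\<close> dominates that positive part.\<close>

lemma expectation_top0_ge:
  "\<exists>\<kappa>>0. \<forall>n (s :: nat \<Rightarrow> 'i). \<kappa> * sqrt (pairs n s) \<le> X.expectation (top0 n s)"
proof -
  obtain \<kappa> where k: "\<kappa> > 0"
    and *: "\<And>n (s :: nat \<Rightarrow> 'i). \<kappa> * sqrt (pairs n s) \<le> X.expectation (\<lambda>x. \<bar>site_sum n s x\<bar>)"
    using expectation_abs_site_sum_ge by blast
  have "\<kappa> / 2 * sqrt (pairs n s) \<le> X.expectation (top0 n s)" for n and s :: "nat \<Rightarrow> 'i"
  proof -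
    have "\<kappa> / 2 * sqrt (pairs n s) \<le> X.expectation (\<lambda>x. (\<bar>site_sum n s x\<bar> + site_sum n s x) / 2)"
      using *[of n s] integrable_site_sum[of n s] expectation_site_sum[of n s] by simp
    also have "\<dots> \<le> X.expectation (top0 n s)"
    proof (rule integral_mono)
      fix x show "(\<bar>site_sum n s x\<bar> + site_sum n s x) / 2 \<le> top0 n s x"
        using site_sum_le_top0[of n s x] top0_nonneg[of n s x] by (simp add: abs_if)
    qed (auto simp: integrable_site_sum integrable_top0)
    finally show ?thesis .
  qed
  then show ?thesis using k by (intro exI[of _ "\<kappa> / 2"]) auto
qed

text \<open>If the first value is at most \<open>t\<close> and the later sums are at most
  \<open>m\<close>, all sums are at most \<open>max t (t + m)\<close>. The first site may be visited
  again, so the two events need not be independent; both are decreasing in the value there, which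
  correlates them positively.\<close>

lemma prob_peak_Suc_ge:
  "measure \<nu> {..t} * X.prob {x. peak n (\<lambda>i. s (Suc i)) x \<le> m} \<le>
    X.prob {x. peak (Suc n) (s :: nat \<Rightarrow> 'i) x \<le> max t (t + m)}"
proof -
  define a s' p where "a = s 0" and "s' = (\<lambda>i. s (Suc i))" and "p = measure \<nu> {..t}"
  define K where "K x = (indicator {x. peak n s' x \<le> m} x :: real)" for x
  have [measurable]: "{x. peak n s' x \<le> m} \<in> sets sceneries"
    using measurable_sets[OF measurable_peak_path[of n s'], of "{..m}"] by (simp add: vimage_def)
  have [measurable]: "{x. peak (Suc n) s x \<le> max t (t + m)} \<in> sets sceneries"
    using measurable_sets[OF measurable_peak_path[of "Suc n" s], of "{..max t (t + m)}"] by (simp add: vimage_def)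
  have [measurable]: "K \<in> borel_measurable sceneries"
    unfolding K_def by measurable
  \<comment> \<open>Centering the indicator brings the correlation into the form of
    \<open>integral_coord_mult_nonneg\<close>.\<close>
  define f :: "real \<Rightarrow> real" where "f r = indicator {..t} r - p" for r
  have [measurable]: "f \<in> borel_measurable borel" unfolding f_def by measurable
  have p: "0 \<le> p" "p \<le> 1" by (simp_all add: p_def)
  have int_i: "integrable \<nu> (indicator {..t} :: real \<Rightarrow> real)"
    by (rule integrable_const_bound[where B = 1]) (auto simp: indicator_def)
  have [measurable]: "(\<lambda>x. K (x(a := t))) \<in> borel_measurable sceneries"
    using measurable_upd by measurable
  have int_f: "integrable sceneries (\<lambda>x. f (x a) * K x)"
    by (rule X.integrable_const_bound[where B = 1])
       (use p in \<open>auto simp: f_def K_def indicator_def split: if_splits\<close>)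
  have int_K: "integrable sceneries K"
    by (rule X.integrable_const_bound[where B = 1]) (auto simp: K_def indicator_def)
  have int_iK: "integrable sceneries (\<lambda>x. indicator {..t} (x a) * K x)"
    by (rule X.integrable_const_bound[where B = 1]) (auto simp: K_def indicator_def)
  have "0 \<le> X.expectation (\<lambda>x. f (x a) * K x)"
  proof (rule integral_coord_mult_nonneg[where t = t])
    show "integrable \<nu> f" unfolding f_def using int_i by auto
    show "expectation f = 0"
      unfolding f_def using int_i by (simp add: p_def prob_space)
    show "integrable sceneries (\<lambda>x. K (x(a := t)))"
    proof (rule X.integrable_const_bound[where B = 1])
      show "AE x in sceneries. norm (K (x(a := t))) \<le> 1"
        by (auto simp: K_def indicator_def)
    qed measurable
    show "integrable sceneries (\<lambda>x. f (x a) * K x)" by (rule int_f)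
    show "0 \<le> f (x a) * (K x - K (x(a := t)))" for x
    proof (cases "x a \<le> t")
      case True
      then have "peak n s' x \<le> peak n s' (x(a := t))" by (intro peak_mono_arg) auto
      then have "K (x(a := t)) \<le> K x" by (auto simp: K_def indicator_def)
      with True p show ?thesis by (simp add: f_def)
    next
      case False
      then have "peak n s' (x(a := t)) \<le> peak n s' x" by (intro peak_mono_arg) auto
      then have "K x \<le> K (x(a := t))" by (auto simp: K_def indicator_def)
      with False p show ?thesis by (simp add: f_def mult_nonneg_nonpos)
    qed
  qed measurable
  also have "X.expectation (\<lambda>x. f (x a) * K x) =
      X.expectation (\<lambda>x. indicator {..t} (x a) * K x) - p * X.expectation K"
    using int_K int_iK by (simp add: f_def left_diff_distrib)
  finally have "p * X.expectation K \<le> X.expectation (\<lambda>x. indicator {..t} (x a) * K x)" by simp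
  also have "\<dots> \<le> X.expectation (indicator {x. peak (Suc n) s x \<le> max t (t + m)})"
  proof (rule integral_mono[OF int_iK])
    show "integrable sceneries (indicator {x. peak (Suc n) s x \<le> max t (t + m)} :: _ \<Rightarrow> real)"
      by (rule X.integrable_const_bound[where B = 1]) (auto simp: indicator_def)
    fix x
    show "indicator {..t} (x a) * K x \<le> (indicator {x. peak (Suc n) s x \<le> max t (t + m)} x :: real)"
      by (auto simp: K_def indicator_def peak_Suc a_def s'_def max_def)
  qed
  finally show ?thesis
    by (simp add: K_def[abs_def] p_def s'_def)
qed

text \<open>Relabelling the sites injectively preserves the law of the scenery; it is applied to the
  translation by the first step of the walk.\<close>

lemma distr_reindex:
  fixes f :: "'i \<Rightarrow> 'i"
  assumes "inj f"
  shows "distr sceneries sceneries (\<lambda>x a. x (f a)) = sceneries"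
  using distr_PiM_reindex[of UNIV "\<lambda>_. \<nu>" f UNIV] assms
  by (simp add: prob_space_axioms restrict_UNIV)

lemma measurable_reindex: "(\<lambda>x a. x (f a)) \<in> measurable sceneries (sceneries :: ('i \<Rightarrow> real) measure)"
  by (rule measurable_PiM_single') (auto simp: space_PiM)

lemma expectation_top0_inj:
  assumes "inj (f :: 'i \<Rightarrow> 'i)"
  shows "X.expectation (top0 n (\<lambda>i. f (s i))) = X.expectation (top0 n s)"
  using integral_distr[OF measurable_reindex measurable_top0_path, of f n s]
  by (simp add: distr_reindex[OF assms] top0_reindex)

lemma prob_peak_inj:
  assumes "inj (f :: 'i \<Rightarrow> 'i)"
  shows "X.prob {x. peak n (\<lambda>i. f (s i)) x \<le> m} = X.prob {x. peak n s x \<le> m}"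
proof -
  have [measurable]: "{x. peak n s x \<le> m} \<in> sets sceneries"
    using measurable_sets[OF measurable_peak_path[of n s], of "{..m}"] by (simp add: vimage_def)
  have "X.prob {x. peak n s x \<le> m} = measure (distr sceneries sceneries (\<lambda>x a. x (f a))) {x. peak n s x \<le> m}"
    by (simp add: distr_reindex[OF assms])
  also have "\<dots> = X.prob {x. peak n (\<lambda>i. f (s i)) x \<le> m}"
    by (subst measure_distr[OF measurable_reindex]) (auto simp: vimage_def peak_reindex)
  finally show ?thesis by simp
qed

end

section \<open>Returns, range and self-intersections of a random walk\<close>

definition pos :: "nat \<Rightarrow> (nat \<Rightarrow> 'g) \<Rightarrow> 'g::ab_group_add" where
  "pos n y = (\<Sum>k<n. y k)"

text \<open>The path starts at time 1, as the sum \<open>Z\<^sub>n\<close> does not involve the starting point.\<close>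

definition sites :: "(nat \<Rightarrow> 'g::ab_group_add) \<Rightarrow> nat \<Rightarrow> 'g" where
  "sites y i = pos (Suc i) y"

definition no_return :: "nat \<Rightarrow> (nat \<Rightarrow> 'g::ab_group_add) \<Rightarrow> bool" where
  "no_return n y \<longleftrightarrow> (\<forall>j\<in>{1..n}. pos j y \<noteq> 0)"

lemma pos_0 [simp]: "pos 0 y = 0"
  by (simp add: pos_def)

lemma pos_add: "pos (j + k) y = pos j y + pos k (\<lambda>i. y (j + i))"
  by (induction k) (simp_all add: pos_def add.assoc)

lemma sites_shift: "sites y (Suc i) = y 0 + sites (\<lambda>i. y (Suc i)) i"
  using pos_add[of 1 "Suc i" y] by (simp add: sites_def pos_def)

text \<open>Each visited point is charged to its last visit. Last rather than first visits, because
  being last is an event about the future increments, whose probability is an escape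
  probability.\<close>

lemma card_image_le_last:
  fixes s :: "nat \<Rightarrow> 'a"
  shows "card (s ` {..<n}) \<le> card {i\<in>{..<n}. \<forall>j. i < j \<longrightarrow> j < n \<longrightarrow> s j \<noteq> s i}" (is "_ \<le> card ?L")
proof -
  have "s ` {..<n} \<subseteq> s ` ?L"
  proof safe
    fix i assume i: "i < n"
    let ?M = "{k. k < n \<and> s k = s i}"
    define m where "m = Max ?M"
    have m: "m \<in> ?M" unfolding m_def by (rule Max_in) (use i in auto)
    have "s j \<noteq> s m" if "m < j" "j < n" for j
    proof
      assume "s j = s m"
      with m that have "j \<le> m" unfolding m_def by (intro Max_ge) auto
      with that show False by simp
    qed
    with m have "m \<in> ?L" "s i = s m" by auto
    then show "s i \<in> s ` ?L" by blast
  qed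
  then have "card (s ` {..<n}) \<le> card (s ` ?L)" by (intro card_mono) auto
  also have "\<dots> \<le> card ?L" by (intro card_image_le) auto
  finally show ?thesis .
qed

text \<open>The left side is the tangent at \<open>r\<close> of the convex function x^(-1/2). Being
  affine in \<open>x\<close>, it lets the mean of the range stand in for the range itself.\<close>

lemma inverse_sqrt_ge_tangent:
  fixes x r :: real
  assumes "x > 0" "r > 0"
  shows "(3 / 2 - x / (2 * r)) / sqrt r \<le> 1 / sqrt x"
proof -
  define a b where "a = sqrt x" and "b = sqrt r"
  have ab: "a > 0" "b > 0" "x = a\<^sup>2" "r = b\<^sup>2" using assms by (auto simp: a_def b_def)
  \<comment> \<open>Factorization of a^3 - 3 a b^2 + 2 b^3, which has the double root a = b by
    tangency.\<close>
  have "0 \<le> (a - b)\<^sup>2 * (a + 2 * b)" using ab by simp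
  then have "3 * b\<^sup>2 * a - a ^ 3 \<le> 2 * b ^ 3"
    by (simp add: power2_eq_square power3_eq_cube algebra_simps)
  then have "(3 * b\<^sup>2 - a\<^sup>2) / (2 * b ^ 3) \<le> 1 / a"
    using ab by (simp add: divide_simps power2_eq_square power3_eq_cube algebra_simps)
  moreover have "(3 / 2 - a\<^sup>2 / (2 * b\<^sup>2)) / b = (3 * b\<^sup>2 - a\<^sup>2) / (2 * b ^ 3)"
    using ab by (simp add: field_simps power2_eq_square power3_eq_cube)
  ultimately show ?thesis using ab by (simp add: real_sqrt_unique)
qed

text \<open>A distance |i - j| is attained by at most two \<open>j\<close>; the conditional writes
  it with truncated subtraction. Serves both for self-intersections and for the geometric sums in
  the Fejer bound.\<close>

lemma sum_dist_le:
  fixes p :: "nat \<Rightarrow> real"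
  assumes "\<And>k. 0 \<le> p k" "i < n"
  shows "(\<Sum>j<n. p (if i \<le> j then j - i else i - j)) \<le> 2 * (\<Sum>k\<le>n. p k)"
proof -
  have "(\<Sum>j<n. p (if i \<le> j then j - i else i - j)) =
      (\<Sum>j\<in>{..<n} \<inter> {i..}. p (j - i)) + (\<Sum>j\<in>{..<n} - {i..}. p (i - j))"
    by (subst sum.Int_Diff[of _ _ "{i..}"]) (auto intro!: arg_cong2[of _ _ _ _ "(+)"] sum.cong)
  also have "(\<Sum>j\<in>{..<n} \<inter> {i..}. p (j - i)) = sum p ((\<lambda>j. j - i) ` ({..<n} \<inter> {i..}))"
    by (subst sum.reindex) (auto simp: inj_on_def)
  also have "(\<Sum>j\<in>{..<n} - {i..}. p (i - j)) = sum p ((\<lambda>j. i - j) ` ({..<n} - {i..}))"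
    by (subst sum.reindex) (auto simp: inj_on_def)
  also have "sum p ((\<lambda>j. j - i) ` ({..<n} \<inter> {i..})) \<le> (\<Sum>k\<le>n. p k)"
    using assms by (intro sum_mono2) auto
  also have "sum p ((\<lambda>j. i - j) ` ({..<n} - {i..})) \<le> (\<Sum>k\<le>n. p k)"
    using assms by (intro sum_mono2) auto
  finally show ?thesis by simp
qed

text \<open>Cauchy-Schwarz: over the visited sites the local times sum to \<open>n\<close> and their
  squares to \<open>pairs n s\<close>.\<close>

lemma pairs_ge:
  assumes "n > 0"
  shows "real n / sqrt (real (card (s ` {..<n}))) \<le> sqrt (pairs n s)"
proof -
  let ?A = "s ` {..<n}"
  define N where "N a = real (card {i\<in>{..<n}. s i = a})" for a
  have c: "card ?A > 0" using assms by (auto simp: card_gt_0_iff)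
  have "real n = (\<Sum>a\<in>?A. N a)"
    using sum.image_gen[of "{..<n}" "\<lambda>_. 1::real" s] by (simp add: N_def)
  then have "(real n)\<^sup>2 \<le> (\<Sum>a\<in>?A. (N a)\<^sup>2) * card ?A"
    using sum_squared_le_sum_of_squares[of N ?A] by simp
  also have "(\<Sum>a\<in>?A. (N a)\<^sup>2) = pairs n s"
    by (simp add: pairs_eq_sum_card N_def)
  finally have "real n \<le> sqrt (pairs n s * card ?A)" by (rule real_le_rsqrt)
  then show ?thesis using c by (simp add: real_sqrt_mult field_simps)
qed

lemma pairs_nonneg: "0 \<le> pairs n s"
  by (auto simp: pairs_def intro!: sum_nonneg)

lemma pairs_le_square: "pairs n s \<le> (real n)\<^sup>2"
proof -
  have "pairs n s \<le> (\<Sum>i<n. \<Sum>j<n. 1)" unfolding pairs_def by (intro sum_mono) auto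
  then show ?thesis by (simp add: power2_eq_square)
qed

lemma pairs_ge_self: "real n \<le> pairs n s"
proof -
  have "real n = (\<Sum>i<n. 1)" by simp
  also have "\<dots> \<le> pairs n s"
    unfolding pairs_def
  proof (rule sum_mono)
    fix i assume "i \<in> {..<n}"
    then have "of_bool (s i = s i) \<le> (\<Sum>j<n. of_bool (s i = s j) :: real)"
      by (intro member_le_sum) auto
    then show "1 \<le> (\<Sum>j<n. of_bool (s i = s j) :: real)" by simp
  qed
  finally show ?thesis .
qed

locale group_walk = prob_space \<rho> for \<rho> :: "'g::{ab_group_add, countable} measure" +
  assumes sets_step: "sets \<rho> = sets (count_space UNIV)"
begin

abbreviation steps :: "(nat \<Rightarrow> 'g) measure" where
  "steps \<equiv> Pi\<^sub>M UNIV (\<lambda>_. \<rho>)"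

abbreviation mean_pairs :: "nat \<Rightarrow> real" where
  "mean_pairs n \<equiv> integral\<^sup>L steps (\<lambda>y. pairs n (sites y))"

abbreviation mean_sqrt_pairs :: "nat \<Rightarrow> real" where
  "mean_sqrt_pairs n \<equiv> integral\<^sup>L steps (\<lambda>y. sqrt (pairs n (sites y)))"

lemma space_step [simp]: "space \<rho> = UNIV"
  using sets_eq_imp_space_eq[OF sets_step] by simp

lemma measurable_step_iff [simp]: "measurable \<rho> N = measurable (count_space UNIV) N"
  by (rule measurable_cong_sets[OF sets_step refl])

lemma space_steps [simp]: "space steps = UNIV"
  by (simp add: space_PiM)

sublocale Y: prob_space steps
  by (intro prob_space_PiM) unfold_locales

lemma prob_UNIV [simp]: "Y.prob UNIV = 1" "prob UNIV = 1"
  using Y.prob_space prob_space by simp_all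

lemma measurable_to_step_iff: "f \<in> measurable M \<rho> \<longleftrightarrow> f \<in> measurable M (count_space UNIV)"
  by (simp add: measurable_cong_sets[OF refl sets_step])

lemma measurable_step [measurable]: "(\<lambda>y. y k) \<in> measurable steps (count_space UNIV)"
  using measurable_component_singleton[of k UNIV "\<lambda>_. \<rho>"] by (simp add: measurable_to_step_iff)

lemma measurable_pos [measurable]: "pos n \<in> measurable steps (count_space UNIV)"
proof (induction n)
  case (Suc n)
  have "(\<lambda>y. pos n y + y n) \<in> measurable steps (count_space UNIV)"
    by (rule measurable_compose_countable[OF _ Suc, where f = "\<lambda>g y. g + y n"]) measurable
  then show ?case by (simp add: pos_def[abs_def])
qed (simp add: pos_def[abs_def])

lemma measurable_shift: "(\<lambda>y i. y (j + i)) \<in> measurable steps steps"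
  by (rule measurable_PiM_single') (auto simp: space_PiM measurable_to_step_iff)

lemma pos_eq_sets: "{y. pos n y = g} \<in> sets steps"
  using measurable_sets[OF measurable_pos, of "{g}" n] by (simp add: vimage_def)

lemma pred_pos_eq [measurable]: "Measurable.pred steps (\<lambda>y. pos n y = g)"
  using pos_eq_sets by (simp add: pred_def)

lemma measurable_no_return [measurable]: "Measurable.pred steps (no_return n)"
  unfolding no_return_def by (intro pred_intros_finite pred_intros_logic pred_pos_eq) auto

lemma no_return_sets [measurable]: "{y. no_return n y} \<in> sets steps"
  using measurable_no_return[of n] by (simp add: pred_def)

lemma measurable_sites [measurable]: "(\<lambda>y. sites y i) \<in> measurable steps (count_space UNIV)"
  unfolding sites_def by (rule measurable_pos)

lemma distr_shift: "distr steps steps (\<lambda>y i. y (j + i)) = steps"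
  using distr_PiM_reindex[of UNIV "\<lambda>_. \<rho>" "\<lambda>i. j + i" UNIV]
  by (simp add: prob_space_axioms restrict_UNIV)

lemma prob_shift:
  assumes [measurable]: "Measurable.pred steps C"
  shows "Y.prob {y. C (\<lambda>i. y (j + i))} = Y.prob {y. C y}"
proof -
  have C: "{y. C y} \<in> sets steps" using assms by (simp add: pred_def)
  have "Y.prob {y. C y} = measure (distr steps steps (\<lambda>y i. y (j + i))) {y. C y}"
    by (simp add: distr_shift)
  also have "\<dots> = Y.prob {y. C (\<lambda>i. y (j + i))}"
    by (subst measure_distr[OF measurable_shift C]) (simp add: vimage_def)
  finally show ?thesis by simp
qed

lemma expectation_shift:
  assumes "F \<in> borel_measurable steps"
  shows "Y.expectation (\<lambda>y. F (\<lambda>i. y (j + i))) = (Y.expectation F :: real)"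
  using integral_distr[OF measurable_shift assms, of j] by (simp add: distr_shift)

lemma integrable_shift:
  assumes "integrable steps F"
  shows "integrable steps (\<lambda>y. F (\<lambda>i. y (j + i)) :: real)"
proof (rule integrable_distr[OF measurable_shift])
  show "integrable (distr steps steps (\<lambda>y i. y (j + i))) F"
    using assms by (simp only: distr_shift)
qed

text \<open>The Markov property at the fixed time \<open>j\<close>: gluing an independent sequence
  after the first \<open>j\<close> steps preserves the law.\<close>

lemma prob_split:
  assumes [measurable]: "Measurable.pred steps B" "Measurable.pred steps C"
    and dep: "\<And>y y'. (\<And>k. k < j \<Longrightarrow> y k = y' k) \<Longrightarrow> B y \<longleftrightarrow> B y'"
  shows "Y.prob {y. B y \<and> C (\<lambda>i. y (j + i))} = Y.prob {y. B y} * Y.prob {y. C y}"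
proof -
  interpret seq: sequence_space \<rho> ..
  interpret P: pair_prob_space steps steps ..
  have BC: "{y. B y} \<in> sets steps" "{y. C y} \<in> sets steps"
    using assms(1,2) by (simp_all add: pred_def)
  have [measurable]: "Measurable.pred steps (\<lambda>y. C (\<lambda>i. y (j + i)))"
    by (rule measurable_compose[OF measurable_shift assms(2)])
  have "Measurable.pred steps (\<lambda>y. B y \<and> C (\<lambda>i. y (j + i)))"
    by measurable
  then have S: "{y. B y \<and> C (\<lambda>i. y (j + i))} \<in> sets steps"
    by (simp add: pred_def)
  have "Y.prob {y. B y \<and> C (\<lambda>i. y (j + i))} =
      measure (distr (steps \<Otimes>\<^sub>M steps) steps (\<lambda>(\<omega>, \<omega>'). comb_seq j \<omega> \<omega>')) {y. B y \<and> C (\<lambda>i. y (j + i))}"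
    by (simp add: seq.PiM_comb_seq)
  also have "\<dots> = measure (steps \<Otimes>\<^sub>M steps)
      ((\<lambda>(\<omega>, \<omega>'). comb_seq j \<omega> \<omega>') -` {y. B y \<and> C (\<lambda>i. y (j + i))} \<inter> space (steps \<Otimes>\<^sub>M steps))"
    by (rule measure_distr[OF _ S]) measurable
  also have "(\<lambda>(\<omega>, \<omega>'). comb_seq j \<omega> \<omega>') -` {y. B y \<and> C (\<lambda>i. y (j + i))} \<inter> space (steps \<Otimes>\<^sub>M steps)
      = {y. B y} \<times> {y. C y}"
  proof -
    have "B (comb_seq j \<omega> \<omega>') \<longleftrightarrow> B \<omega>" for \<omega> \<omega>'
      by (rule dep) (simp add: comb_seq_def)
    moreover have "(\<lambda>i. comb_seq j \<omega> \<omega>' (j + i)) = \<omega>'" for \<omega> \<omega>' :: "nat \<Rightarrow> 'g"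
      by (simp add: comb_seq_def)
    ultimately show ?thesis by (auto simp: space_pair_measure)
  qed
  also have "measure (steps \<Otimes>\<^sub>M steps) ({y. B y} \<times> {y. C y}) = Y.prob {y. B y} * Y.prob {y. C y}"
    using BC by (simp add: measure_def Y.emeasure_pair_measure_Times enn2real_mult)
  finally show ?thesis .
qed

section \<open>Return probabilities, Green function and escape probabilities\<close>

definition ret :: "nat \<Rightarrow> real" where "ret n = Y.prob {y. pos n y = 0}"
definition green :: "nat \<Rightarrow> real" where "green n = (\<Sum>j\<le>n. ret j)"
definition escape :: "nat \<Rightarrow> real" where "escape n = Y.prob {y. no_return n y}"

lemma ret_nonneg: "0 \<le> ret n"
  by (simp add: ret_def)

lemma ret_0: "ret 0 = 1"
  by (simp add: ret_def)

lemma green_ge_1: "1 \<le> green n"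
  using member_le_sum[of 0 "{..n}" ret] by (simp add: green_def ret_nonneg ret_0)

lemma escape_antimono: "m \<le> n \<Longrightarrow> escape n \<le> escape m"
  unfolding escape_def by (intro Y.finite_measure_mono) (auto simp: no_return_def)

text \<open>Decompose according to the last visit to the origin before time \<open>n\<close>.\<close>

lemma escape_green_le: "escape n * green n \<le> 1"
proof -
  define L where "L j = {y :: nat \<Rightarrow> 'g. pos j y = 0 \<and> no_return (n - j) (\<lambda>i. y (j + i))}" for j
  have [measurable]: "Measurable.pred steps (\<lambda>y. no_return k (\<lambda>i. y (j + i)))" for k j
    by (rule measurable_compose[OF measurable_shift measurable_no_return])
  have "Measurable.pred steps (\<lambda>y. pos j y = 0 \<and> no_return (n - j) (\<lambda>i. y (j + i)))" for j
    by measurable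
  then have L: "L j \<in> sets steps" for j
    by (simp add: L_def pred_def)
  \<comment> \<open>\<open>L j\<close> says that the last visit up to time \<open>n\<close> occurs
    at \<open>j\<close>. As \<open>escape (n - j)\<close> is at least \<open>escape n\<close>,
    summing over \<open>j\<close> produces the product with \<open>green n\<close>.\<close>
  have "Y.prob (L j) = ret j * escape (n - j)" for j
    unfolding L_def ret_def escape_def
  proof (rule prob_split)
    show "pos j y = 0 \<longleftrightarrow> pos j y' = 0" if "\<And>k. k < j \<Longrightarrow> y k = y' k" for y y' :: "nat \<Rightarrow> 'g"
      using that by (simp add: pos_def)
  qed (rule pred_pos_eq measurable_no_return)+
  then have "escape n * green n \<le> (\<Sum>j\<le>n. Y.prob (L j))"
    unfolding green_def sum_distrib_left
    by (intro sum_mono) (simp add: mult.commute[of "escape n"] mult_left_mono ret_nonneg escape_antimono)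
  also have "\<dots> = Y.prob (\<Union>j\<in>{..n}. L j)"
  proof (rule Y.finite_measure_finite_Union[symmetric])
    show "disjoint_family_on L {..n}"
    proof -
      have "L j \<inter> L k = {}" if "j < k" "k \<le> n" for j k
      proof -
        have "pos (k - j) (\<lambda>i. y (j + i)) = 0" if "pos j y = 0" "pos k y = 0" for y :: "nat \<Rightarrow> 'g"
          using pos_add[of j "k - j" y] that \<open>j < k\<close> by simp
        moreover have "k - j \<in> {1..n - j}" using \<open>j < k\<close> \<open>k \<le> n\<close> by auto
        ultimately show ?thesis unfolding L_def no_return_def by blast
      qed
      then show ?thesis
        unfolding disjoint_family_on_def
        by (metis Int_commute atMost_iff linorder_neqE_nat)
    qed
  qed (use L in auto)
  also have "\<dots> \<le> 1" by (rule Y.prob_le_1)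
  finally show ?thesis .
qed

text \<open>If the escape probabilities stay above some \<epsilon>, then \<open>green n\<close> is
  at most 1 / \<epsilon>. Otherwise they become arbitrarily small, so no time is a last visit with
  positive probability; as the origin is visited at time 0, it is then almost surely visited
  infinitely often.\<close>

lemma green_bounded_of_transient:
  assumes "\<not> (AE y in steps. \<exists>\<^sub>\<infinity>n. pos n y = 0)"
  shows "\<exists>C>0. \<forall>n. green n \<le> C"
proof (cases "\<exists>\<epsilon>>0. \<forall>n. \<epsilon> \<le> escape n")
  case True
  then obtain \<epsilon> where e: "\<epsilon> > 0" "\<And>n. \<epsilon> \<le> escape n" by blast
  have "green n \<le> 1 / \<epsilon>" for n
  proof -
    have "\<epsilon> * green n \<le> escape n * green n"
      using e green_ge_1[of n] by (intro mult_right_mono) auto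
    also have "\<dots> \<le> 1" by (rule escape_green_le)
    finally show ?thesis using e by (simp add: field_simps)
  qed
  then show ?thesis using e by (intro exI[of _ "1 / \<epsilon>"]) auto
next
  case False
  then have small: "\<exists>n. escape n < \<epsilon>" if "\<epsilon> > 0" for \<epsilon>
    using that by (meson not_le)
  define E where "E j y \<longleftrightarrow> pos j y = 0 \<and> (\<forall>n. no_return n (\<lambda>i. y (j + i)))" for j and y :: "nat \<Rightarrow> 'g"
  have [measurable]: "Measurable.pred steps (\<lambda>y. no_return n (\<lambda>i. y (j + i)))" for n j
    by (rule measurable_compose[OF measurable_shift measurable_no_return])
  have [measurable]: "Measurable.pred steps (E j)" for j
    unfolding E_def by measurable
  have ES: "{y. E j y} \<in> sets steps" for j
    using \<open>\<And>j. Measurable.pred steps (E j)\<close>[of j] by (simp add: pred_def)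
  have "Y.prob {y. E j y} = 0" for j
  proof (rule ccontr)
    assume "Y.prob {y. E j y} \<noteq> 0"
    then have "Y.prob {y. E j y} > 0" using measure_nonneg[of steps "{y. E j y}"] by linarith
    then obtain n where n: "escape n < Y.prob {y. E j y}" using small by blast
    have "Y.prob {y. E j y} \<le> Y.prob {y. no_return n (\<lambda>i. y (j + i))}"
    proof (rule Y.finite_measure_mono)
      show "{y. no_return n (\<lambda>i. y (j + i))} \<in> Y.events"
        using \<open>\<And>n j. Measurable.pred steps (\<lambda>y. no_return n (\<lambda>i. y (j + i)))\<close>[of n j]
        by (simp add: pred_def)
    qed (auto simp: E_def)
    also have "\<dots> = escape n"
      unfolding escape_def by (rule prob_shift) measurable
    finally show False using n by simp
  qed
  then have "AE y in steps. \<not> E j y" for j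
    using ES by (intro AE_I[where N = "{y. E j y}"]) (auto simp: Y.emeasure_eq_measure)
  then have "AE y in steps. \<forall>j. \<not> E j y" by (simp add: AE_all_countable)
  then have "AE y in steps. \<exists>\<^sub>\<infinity>n. pos n y = 0"
  proof eventually_elim
    case (elim y)
    show ?case
    proof (rule ccontr)
      assume "\<not> (\<exists>\<^sub>\<infinity>n. pos n y = 0)"
      then have fin: "finite {n. pos n y = 0}" by (simp add: frequently_cofinite)
      define j where "j = Max {n. pos n y = 0}"
      have j: "pos j y = 0" using Max_in[OF fin] pos_0[of y] unfolding j_def by blast
      have "pos k (\<lambda>i. y (j + i)) \<noteq> 0" if "k \<ge> 1" for k
      proof
        assume "pos k (\<lambda>i. y (j + i)) = 0"
        then have "pos (j + k) y = 0" using pos_add[of j k y] j by simp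
        then have "j + k \<le> j" using Max_ge[OF fin] unfolding j_def by blast
        with that show False by simp
      qed
      with j elim show False by (auto simp: E_def no_return_def)
    qed
  qed
  with assms show ?thesis by blast
qed

lemma prob_pos_eq:
  assumes "i \<le> j"
  shows "Y.prob {y. pos i y = pos j y} = ret (j - i)"
proof -
  have "pos i y = pos j y \<longleftrightarrow> pos (j - i) (\<lambda>k. y (i + k)) = 0" for y :: "nat \<Rightarrow> 'g"
    using pos_add[of i "j - i" y] assms by auto
  then have "Y.prob {y. pos i y = pos j y} = Y.prob {y. pos (j - i) (\<lambda>k. y (i + k)) = 0}" by simp
  also have "\<dots> = ret (j - i)"
    unfolding ret_def by (rule prob_shift) measurable
  finally show ?thesis .
qed

section \<open>Mean number of self-intersections and mean range\<close>

lemma pred_sites_eq [measurable]: "Measurable.pred steps (\<lambda>y. sites y i = sites y j)"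
  unfolding sites_def
  by (rule measurable_compose_countable[where f = "\<lambda>g y. pos (Suc i) y = g",
        OF pred_pos_eq measurable_pos])

lemma sites_eq_sets: "{y. sites y i = sites y j} \<in> sets steps"
  using pred_sites_eq[of i j] by (simp add: pred_def)

lemma measurable_pairs [measurable]: "(\<lambda>y. pairs n (sites y)) \<in> borel_measurable steps"
  unfolding pairs_def by measurable

lemma integrable_pairs: "integrable steps (\<lambda>y. pairs n (sites y))"
  by (rule Y.integrable_const_bound[where B = "(real n)\<^sup>2"]) (auto simp: pairs_le_square pairs_nonneg)

lemma expectation_pairs:
  "mean_pairs n = (\<Sum>i<n. \<Sum>j<n. ret (if i \<le> j then j - i else i - j))"
proof -
  have int: "integrable steps (\<lambda>y. of_bool (sites y i = sites y j) :: real)" for i j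
    by (rule Y.integrable_const_bound[where B = 1]) auto
  have "Y.expectation (\<lambda>y. of_bool (sites y i = sites y j)) = ret (if i \<le> j then j - i else i - j)" for i j
  proof -
    have "(\<lambda>y :: nat \<Rightarrow> 'g. of_bool (sites y i = sites y j) :: real) = indicator {y. sites y i = sites y j}"
      by (auto simp: fun_eq_iff indicator_def)
    then have "Y.expectation (\<lambda>y. of_bool (sites y i = sites y j)) = Y.prob {y. sites y i = sites y j}"
      using sites_eq_sets[of i j] by simp
    also have "\<dots> = ret (if i \<le> j then j - i else i - j)"
      using prob_pos_eq[of "Suc i" "Suc j"] prob_pos_eq[of "Suc j" "Suc i"]
      by (auto simp: sites_def eq_commute)
    finally show ?thesis .
  qed
  then show ?thesis
    unfolding pairs_def
    by (simp only: int Bochner_Integration.integral_sum Bochner_Integration.integrable_sum)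
qed

lemma expectation_pairs_le: "mean_pairs n \<le> 2 * real n * green n"
proof -
  have "mean_pairs n \<le> (\<Sum>i<n. 2 * green n)"
    unfolding expectation_pairs green_def
    by (intro sum_mono sum_dist_le) (auto simp: ret_nonneg)
  then show ?thesis by simp
qed

lemma expectation_sqrt_pairs_le:
  "mean_sqrt_pairs n \<le> sqrt (2 * real n * green n)"
proof -
  have "mean_sqrt_pairs n \<le>
      sqrt (Y.expectation (\<lambda>y. (sqrt (pairs n (sites y)))\<^sup>2))"
    by (rule Y.expectation_le_sqrt_square) (auto simp: pairs_nonneg integrable_pairs)
  also have "\<dots> \<le> sqrt (2 * real n * green n)"
    using expectation_pairs_le[of n] by (simp add: pairs_nonneg)
  finally show ?thesis .
qed

lemma integrable_sqrt_pairs: "integrable steps (\<lambda>y. sqrt (pairs n (sites y)))"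
  by (rule Y.integrable_const_bound[where B = "real n"])
     (auto simp: pairs_nonneg pairs_le_square real_le_lsqrt)

lemma expectation_sqrt_pairs_ge_sqrt:
  "sqrt (real n) \<le> mean_sqrt_pairs n"
  using Y.integral_ge_const[OF integrable_sqrt_pairs, of "sqrt (real n)" n]
  by (auto simp: pairs_ge_self)

text \<open>Counts the times below \<open>n\<close> whose site is not visited again before
  \<open>n\<close>. Each term depends only on the increments from index \<open>Suc i\<close> on, so
  its mean is an escape probability.\<close>

definition range_card :: "nat \<Rightarrow> (nat \<Rightarrow> 'g) \<Rightarrow> real" where
  "range_card n y = (\<Sum>i<n. of_bool (no_return (n - Suc i) (\<lambda>k. y (Suc i + k))))"

lemma card_sites_le: "real (card (sites y ` {..<n})) \<le> range_card n y"
proof -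
  have "no_return (n - Suc i) (\<lambda>k. y (Suc i + k))"
    if "\<forall>j. i < j \<longrightarrow> j < n \<longrightarrow> sites y j \<noteq> sites y i" "i < n" for i
    unfolding no_return_def
  proof
    fix k assume k: "k \<in> {1..n - Suc i}"
    then have "sites y (i + k) \<noteq> sites y i"
      using that by (intro that(1)[rule_format]) auto
    then show "pos k (\<lambda>k. y (Suc i + k)) \<noteq> 0"
      using pos_add[of "Suc i" k y] by (auto simp: sites_def)
  qed
  then have "card {i\<in>{..<n}. \<forall>j. i < j \<longrightarrow> j < n \<longrightarrow> sites y j \<noteq> sites y i} \<le>
      card {i\<in>{..<n}. no_return (n - Suc i) (\<lambda>k. y (Suc i + k))}"
    by (intro card_mono) auto
  with card_image_le_last[of "sites y" n]
  have "card (sites y ` {..<n}) \<le> card {i\<in>{..<n}. no_return (n - Suc i) (\<lambda>k. y (Suc i + k))}"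
    by simp
  also have "real \<dots> = range_card n y"
    unfolding range_card_def by (simp add: of_bool_def sum.If_cases Int_def)
  finally show ?thesis by simp
qed

lemma expectation_range_card:
  "Y.expectation (range_card n) = (\<Sum>k<n. escape k)" "integrable steps (range_card n)"
proof -
  have m [measurable]: "Measurable.pred steps (\<lambda>y. no_return k (\<lambda>i. y (j + i)))" for k j
    by (rule measurable_compose[OF measurable_shift measurable_no_return])
  have int: "integrable steps (\<lambda>y. of_bool (no_return k (\<lambda>i. y (j + i))) :: real)" for k j
    by (rule Y.integrable_const_bound[where B = 1]) auto
  have e: "Y.expectation (\<lambda>y. of_bool (no_return k (\<lambda>i. y (j + i)))) = escape k" for k j
  proof -
    have "(\<lambda>y :: nat \<Rightarrow> 'g. of_bool (no_return k (\<lambda>i. y (j + i))) :: real) = indicator {y. no_return k (\<lambda>i. y (j + i))}"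
      by (auto simp: fun_eq_iff indicator_def)
    moreover have "{y :: nat \<Rightarrow> 'g. no_return k (\<lambda>i. y (j + i))} \<in> sets steps"
      using m[of k j] by (simp add: pred_def)
    ultimately have "Y.expectation (\<lambda>y. of_bool (no_return k (\<lambda>i. y (j + i)))) =
        Y.prob {y. no_return k (\<lambda>i. y (j + i))}" by simp
    also have "\<dots> = escape k" unfolding escape_def by (rule prob_shift) measurable
    finally show ?thesis .
  qed
  show "integrable steps (range_card n)" unfolding range_card_def by (intro Bochner_Integration.integrable_sum int)
  have "Y.expectation (range_card n) = (\<Sum>i<n. escape (n - Suc i))"
    unfolding range_card_def by (subst Bochner_Integration.integral_sum[OF int]) (simp only: e)
  then show "Y.expectation (range_card n) = (\<Sum>k<n. escape k)"
    by (simp add: sum.nat_diff_reindex)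
qed

text \<open>Jensen's inequality in tangent form for n divided by the square root of the range. The
  tangent is taken at the upper bound \<open>r\<close> of the mean range rather than at the mean
  itself.\<close>

lemma expectation_sqrt_pairs_ge:
  assumes "(\<Sum>k<n. 1 / green k) \<le> r" "0 < n"
  shows "real n / sqrt r \<le> mean_sqrt_pairs n"
proof -
  have "escape k \<le> 1 / green k" for k
    using escape_green_le[of k] green_ge_1[of k] by (simp add: field_simps)
  then have "Y.expectation (range_card n) \<le> (\<Sum>k<n. 1 / green k)"
    unfolding expectation_range_card by (intro sum_mono)
  with assms have er: "Y.expectation (range_card n) \<le> r" by simp
  have "1 \<le> range_card n y" for y :: "nat \<Rightarrow> 'g"
  proof -
    have "0 < card (sites y ` {..<n})" using assms by (auto simp: card_gt_0_iff)
    then show ?thesis using card_sites_le[of y n] by linarith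
  qed
  then have "1 \<le> Y.expectation (range_card n)"
    using Y.integral_ge_const[OF expectation_range_card(2), of 1 n] by auto
  with er have r: "r > 0" by simp
  \<comment> \<open>The factor is at least 1 because the mean range is at most
    \<open>r\<close>.\<close>
  have "real n / sqrt r \<le> real n / sqrt r * (3 / 2 - Y.expectation (range_card n) / (2 * r))"
    using mult_left_mono[OF er, of "real n"] r by (simp add: field_simps)
  also have "\<dots> = Y.expectation (\<lambda>y. real n / sqrt r * (3 / 2 - range_card n y / (2 * r)))"
    using expectation_range_card(2)[of n] by simp
  also have "\<dots> \<le> mean_sqrt_pairs n"
  proof (rule integral_mono)
    show "integrable steps (\<lambda>y. real n / sqrt r * (3 / 2 - range_card n y / (2 * r)))"
      using expectation_range_card(2)[of n] by auto
    fix y :: "nat \<Rightarrow> 'g"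
    let ?c = "real (card (sites y ` {..<n}))"
    have c: "?c > 0" using assms by (auto simp: card_gt_0_iff)
    have "real n / sqrt r * (3 / 2 - range_card n y / (2 * r)) \<le>
        real n * ((3 / 2 - ?c / (2 * r)) / sqrt r)"
      using card_sites_le[of y n] r by (simp add: divide_simps mult_left_mono)
    also have "\<dots> \<le> real n * (1 / sqrt ?c)"
      by (intro mult_left_mono inverse_sqrt_ge_tangent c r) auto
    also have "\<dots> \<le> sqrt (pairs n (sites y))"
      using pairs_ge[OF assms(2), of "sites y"] by simp
    finally show "real n / sqrt r * (3 / 2 - range_card n y / (2 * r)) \<le> sqrt (pairs n (sites y))" .
  qed (rule integrable_sqrt_pairs)
  finally show ?thesis .
qed

end

section \<open>Persistence probabilities\<close>

locale walk_in_scenery = scenery \<nu> + W: group_walk \<rho>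
  for \<nu> :: "real measure" and \<rho> :: "'g::{ab_group_add, countable} measure"
begin

abbreviation neg_peak :: "nat \<Rightarrow> (nat \<Rightarrow> 'g) \<Rightarrow> real" where
  "neg_peak n s \<equiv> X.expectation (\<lambda>x. max 0 (- peak n s x))"

abbreviation low_prob :: "nat \<Rightarrow> (nat \<Rightarrow> 'g) \<Rightarrow> real \<Rightarrow> real" where
  "low_prob n s m \<equiv> X.prob {x. peak n s x \<le> m}"

text \<open>Averaging is over the scenery first and the walk second, since the estimates hold for
  each fixed path. While \<open>mean_top n\<close> involves \<open>n\<close> sums,
  \<open>gap n\<close> and \<open>persist n\<close> inherit from \<open>peak\<close> one sum
  more.\<close>

definition mean_top :: "nat \<Rightarrow> real" where
  "mean_top n = W.Y.expectation (\<lambda>y. X.expectation (top0 n (sites y)))"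

definition gap :: "nat \<Rightarrow> real" where
  "gap n = W.Y.expectation (\<lambda>y. neg_peak n (sites y))"

definition persist :: "nat \<Rightarrow> real \<Rightarrow> real" where
  "persist n m = W.Y.expectation (\<lambda>y. low_prob n (sites y) m)"

text \<open>Evaluating the scenery at a random site is jointly measurable because the site ranges
  over a countable group.\<close>

lemma measurable_scenery_at_site:
  "(\<lambda>z. snd z (sites (fst z) i)) \<in> borel_measurable (W.steps \<Otimes>\<^sub>M (sceneries :: ('g \<Rightarrow> real) measure))"
proof (rule measurable_compose_countable[where f = "\<lambda>g z. snd z g"])
  show "(\<lambda>z. snd z g) \<in> borel_measurable (W.steps \<Otimes>\<^sub>M (sceneries :: ('g \<Rightarrow> real) measure))" for g
    by (rule measurable_compose[OF measurable_snd measurable_coord])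
  show "(\<lambda>z. sites (fst z) i) \<in> measurable (W.steps \<Otimes>\<^sub>M sceneries) (count_space UNIV)"
    by (rule measurable_compose[OF measurable_fst W.measurable_sites])
qed

lemma measurable_top0_pair [measurable]:
  "(\<lambda>(y, x). top0 n (sites y) x) \<in> borel_measurable (W.steps \<Otimes>\<^sub>M sceneries)"
  using measurable_top0[of snd "\<lambda>z. sites (fst z)", OF measurable_scenery_at_site]
  by (simp add: case_prod_beta)

lemma measurable_peak_pair [measurable]:
  "(\<lambda>(y, x). peak n (sites y) x) \<in> borel_measurable (W.steps \<Otimes>\<^sub>M sceneries)"
  using measurable_peak[of snd "\<lambda>z. sites (fst z)", OF measurable_scenery_at_site]
  by (simp add: case_prod_beta)

lemma measurable_mean_top [measurable]:
  "(\<lambda>y. X.expectation (top0 n (sites y))) \<in> borel_measurable W.steps"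
  using X.borel_measurable_lebesgue_integral[OF measurable_top0_pair] by simp

lemma peak_le_sets [measurable]: "{x. peak n s x \<le> m} \<in> sets sceneries"
  using measurable_sets[OF measurable_peak_path[of n s], of "{..m}"] by (simp add: vimage_def)

lemma measurable_persist [measurable]:
  "(\<lambda>y. low_prob n (sites y) m) \<in> borel_measurable W.steps"
proof -
  have "(\<lambda>z. indicator {..m} (peak n (sites (fst z)) (snd z)) :: real) \<in>
      borel_measurable (W.steps \<Otimes>\<^sub>M sceneries)"
    using measurable_compose[OF measurable_peak_pair[of n], of "indicator {..m}" borel]
    by (simp add: case_prod_beta)
  then have "(\<lambda>y. X.expectation (\<lambda>x. indicator {..m} (peak n (sites y) x) :: real)) \<in> borel_measurable W.steps"
    by (intro X.borel_measurable_lebesgue_integral) (simp add: case_prod_beta)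
  moreover have "X.expectation (\<lambda>x. indicator {..m} (peak n (sites y) x) :: real) =
      low_prob n (sites y) m" for y :: "nat \<Rightarrow> 'g"
  proof -
    have "(\<lambda>x. indicator {..m} (peak n (sites y) x) :: real) = indicator {x. peak n (sites y) x \<le> m}"
      by (auto simp: fun_eq_iff indicator_def)
    then show ?thesis by simp
  qed
  ultimately show ?thesis by simp
qed

lemma integrable_persist: "integrable W.steps (\<lambda>y. low_prob n (sites y) m)"
  by (rule W.Y.integrable_const_bound[where B = 1]) auto

lemma expectation_top0_nonneg: "0 \<le> X.expectation (top0 n s)"
  by (intro integral_nonneg_AE) (auto simp: top0_nonneg)

lemma sqrt_pairs_le: "sqrt (pairs n (s :: nat \<Rightarrow> 'g)) \<le> real n"
  using pairs_le_square[of n s] by (simp add: real_le_lsqrt pairs_nonneg)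

lemma integrable_mean_top: "integrable W.steps (\<lambda>y. X.expectation (top0 n (sites y)))"
proof (rule W.Y.integrable_const_bound[where B = "sqrt \<sigma>2 * real n"])
  have "X.expectation (top0 n s) \<le> sqrt \<sigma>2 * real n" for s :: "nat \<Rightarrow> 'g"
  proof -
    have "0 \<le> sqrt \<sigma>2" using nondegenerate by (simp add: \<sigma>2_def)
    from expectation_top0_le[of n s] mult_left_mono[OF sqrt_pairs_le[of n s] this]
    show ?thesis by (rule order_trans)
  qed
  then show "AE y in W.steps. norm (X.expectation (top0 n (sites y))) \<le> sqrt \<sigma>2 * real n"
    by (simp add: expectation_top0_nonneg)
qed measurable

lemma integrable_gap_path: "integrable sceneries (\<lambda>x. max 0 (- peak n s x))"
  by (intro integrable_max integrable_minus integrable_peak) auto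

lemma integrable_gap:
  "integrable W.steps (\<lambda>y. neg_peak n (sites y))"
proof (rule W.Y.integrable_const_bound)
  have "norm (neg_peak n s) \<le> expectation (\<lambda>r. \<bar>r\<bar>)"
    for s :: "nat \<Rightarrow> 'g"
  proof -
    have "neg_peak n s \<le> X.expectation (\<lambda>x. \<bar>x (s 0)\<bar>)"
    proof (rule integral_mono[OF integrable_gap_path])
      show "max 0 (- peak n s x) \<le> \<bar>x (s 0)\<bar>" for x
        using first_le_peak[of x s n] by simp
    qed (simp add: integrable_coord)
    also have "\<dots> = expectation (\<lambda>r. \<bar>r\<bar>)"
      by (rule integral_coord(1)) simp
    finally show ?thesis by simp
  qed
  then show "AE y in W.steps. norm (neg_peak n (sites y)) \<le>
      expectation (\<lambda>r. \<bar>r\<bar>)" by simp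
qed measurable

section \<open>Translation invariance and stationarity of the increments\<close>

lemma inj_translate: "inj ((+) (g :: 'g))"
  by simp

lemma expectation_top0_shift:
  fixes y :: "nat \<Rightarrow> 'g"
  shows "X.expectation (top0 n (\<lambda>i. sites y (Suc i))) = X.expectation (top0 n (sites (\<lambda>i. y (Suc i))))"
  unfolding sites_shift by (rule expectation_top0_inj[OF inj_translate])

lemma prob_peak_shift:
  fixes y :: "nat \<Rightarrow> 'g"
  shows "low_prob n (\<lambda>i. sites y (Suc i)) m = low_prob n (sites (\<lambda>i. y (Suc i))) m"
  unfolding sites_shift by (rule prob_peak_inj[OF inj_translate])

text \<open>By stationarity of the increments, the mean of \<open>max (0, Z\<^sub>1, \<dots>, Z\<^sub>n)\<close> equals that of
  \<open>max (Z\<^sub>1, \<dots>, Z\<^sub>n\<^sub>+\<^sub>1)\<close>.\<close>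

lemma mean_top_Suc: "mean_top (Suc n) = mean_top n + gap n"
proof -
  have "X.expectation (top0 (Suc n) s) =
      X.expectation (top0 n (\<lambda>i. s (Suc i))) + neg_peak n s"
    for s :: "nat \<Rightarrow> 'g"
  proof -
    \<comment> \<open>max(0, p) = p + max(0, -p) for the peak p, whose first term is a scenery value
      of mean zero.\<close>
    have "X.expectation (top0 (Suc n) s) =
        X.expectation (\<lambda>x. (x (s 0) + top0 n (\<lambda>i. s (Suc i)) x) + max 0 (- peak n s x))"
      by (intro Bochner_Integration.integral_cong) (auto simp: top0_Suc_peak peak_def)
    then show ?thesis
      by (simp add: integrable_coord integrable_top0 integrable_gap_path expectation_coord)
  qed
  then have "mean_top (Suc n) =
      W.Y.expectation (\<lambda>y. X.expectation (top0 n (sites (\<lambda>i. y (Suc i)))) +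
        neg_peak n (sites y))"
    unfolding mean_top_def by (simp only: expectation_top0_shift)
  also have "\<dots> = W.Y.expectation (\<lambda>y. X.expectation (top0 n (sites (\<lambda>i. y (Suc i))))) + gap n"
    unfolding gap_def
  proof (rule Bochner_Integration.integral_add[OF _ integrable_gap])
    show "integrable W.steps (\<lambda>y. X.expectation (top0 n (sites (\<lambda>i. y (Suc i)))))"
      using W.integrable_shift[OF integrable_mean_top[of n], of 1] by simp
  qed
  also have "W.Y.expectation (\<lambda>y. X.expectation (top0 n (sites (\<lambda>i. y (Suc i))))) = mean_top n"
    using W.expectation_shift[OF measurable_mean_top[of n], of 1] by (simp add: mean_top_def)
  finally show ?thesis .
qed

lemma mean_top_0: "mean_top 0 = 0"
proof -
  have "top0 0 s = (\<lambda>x. 0)" for s :: "nat \<Rightarrow> 'g"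
    by (simp add: fun_eq_iff)
  then show ?thesis by (simp add: mean_top_def)
qed

lemma mean_top_add: "mean_top (n + k) = mean_top n + (\<Sum>i<k. gap (n + i))"
  by (induction k) (simp_all add: mean_top_Suc)

lemma gap_antimono: "m \<le> n \<Longrightarrow> gap n \<le> gap m"
  unfolding gap_def
proof (intro integral_mono integrable_gap integrable_gap_path)
  fix y :: "nat \<Rightarrow> 'g" and x assume "m \<le> n"
  then show "max 0 (- peak n (sites y) x) \<le> max 0 (- peak m (sites y) x)"
    using peak_mono[of m n "sites y" x] by simp
qed

lemma gap_nonneg: "0 \<le> gap n"
  unfolding gap_def by (intro integral_nonneg_AE) auto

text \<open>\<open>mean_top (Suc n)\<close> is the sum of the gaps with index 0 to \<open>n\<close>,
  of which \<open>gap n\<close> is the smallest.\<close>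

lemma gap_le: "real (Suc n) * gap n \<le> mean_top (Suc n)"
proof -
  have "real (Suc n) * gap n = (\<Sum>i<Suc n. gap n)" by simp
  also have "\<dots> \<le> (\<Sum>i<Suc n. gap i)" by (intro sum_mono gap_antimono) auto
  also have "\<dots> = mean_top (Suc n)" using mean_top_add[of 0 "Suc n"] by (simp add: mean_top_0)
  finally show ?thesis .
qed

lemma gap_ge: "mean_top (n + k) - mean_top n \<le> real k * gap n"
proof -
  have "mean_top (n + k) - mean_top n = (\<Sum>i<k. gap (n + i))" by (simp add: mean_top_add)
  also have "\<dots> \<le> (\<Sum>i<k. gap n)" by (intro sum_mono gap_antimono) auto
  finally show ?thesis by simp
qed

section \<open>From gaps to persistence probabilities\<close>

lemma persist_mono: "m \<le> m' \<Longrightarrow> persist n m \<le> persist n m'"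
  unfolding persist_def
  by (intro integral_mono integrable_persist X.finite_measure_mono) auto

lemma persist_antimono: "k \<le> n \<Longrightarrow> persist n m \<le> persist k m"
  unfolding persist_def
  by (intro integral_mono integrable_persist X.finite_measure_mono)
     (use peak_mono order_trans in \<open>blast intro: peak_le_sets\<close>)+

text \<open>The path after its first step is a translate of a walk with the same law, so the bound
  for fixed paths averages to a recursion in \<open>n\<close>.\<close>

lemma persist_Suc_ge: "measure \<nu> {..t} * persist n m \<le> persist (Suc n) (max t (t + m))"
proof -
  have i: "integrable W.steps (\<lambda>y. low_prob n (sites (\<lambda>i. y (Suc i))) m)"
    using W.integrable_shift[OF integrable_persist[of n m], of 1] by simp
  have "persist n m = W.Y.expectation (\<lambda>y. low_prob n (sites (\<lambda>i. y (Suc i))) m)"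
    using W.expectation_shift[OF measurable_persist[of n m], of 1] by (simp add: persist_def)
  then have "measure \<nu> {..t} * persist n m =
      W.Y.expectation (\<lambda>y. measure \<nu> {..t} * low_prob n (sites (\<lambda>i. y (Suc i))) m)"
    by simp
  also have "\<dots> \<le> persist (Suc n) (max t (t + m))"
    unfolding persist_def
  proof (rule integral_mono[OF _ integrable_persist])
    show "integrable W.steps (\<lambda>y. measure \<nu> {..t} * low_prob n (sites (\<lambda>i. y (Suc i))) m)"
      using i by simp
    fix y :: "nat \<Rightarrow> 'g"
    show "measure \<nu> {..t} * low_prob n (sites (\<lambda>i. y (Suc i))) m \<le>
        X.prob {x. peak (Suc n) (sites y) x \<le> max t (t + m)}"
      using prob_peak_Suc_ge[of t n "sites y" m] by (simp only: prob_peak_shift)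
  qed
  finally show ?thesis .
qed

text \<open>Markov's inequality for the negative part of the peak.\<close>

lemma persist_le_gap: "\<delta> * persist n (- \<delta>) \<le> gap n"
proof -
  have "\<delta> * persist n (- \<delta>) = W.Y.expectation (\<lambda>y. \<delta> * low_prob n (sites y) (- \<delta>))"
    by (simp add: persist_def)
  also have "\<dots> \<le> gap n"
    unfolding gap_def
  proof (rule integral_mono[OF _ integrable_gap])
    show "integrable W.steps (\<lambda>y. \<delta> * low_prob n (sites y) (- \<delta>))"
      by (simp add: integrable_persist)
    fix y :: "nat \<Rightarrow> 'g"
    have "\<delta> * low_prob n (sites y) (- \<delta>) =
        X.expectation (\<lambda>x. \<delta> * indicator {x. peak n (sites y) x \<le> - \<delta>} x)"
      by simp
    also have "\<dots> \<le> neg_peak n (sites y)"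
    proof (rule integral_mono[OF _ integrable_gap_path])
      show "integrable sceneries (\<lambda>x. \<delta> * indicator {x. peak n (sites y) x \<le> - \<delta>} x)"
        by (intro integrable_mult_right X.integrable_const_bound[where B = 1]) (auto simp: indicator_def)
    qed (auto simp: indicator_def)
    finally show "\<delta> * low_prob n (sites y) (- \<delta>) \<le>
        neg_peak n (sites y)" .
  qed
  finally show ?thesis .
qed

text \<open>A truncation at level \<open>t\<close>, which replaces Hoelder's inequality: if the maximum is
  negative, its absolute value is at most \<open>- Z\<^sub>1\<close>.\<close>

lemma gap_le_persist:
  assumes b: "\<beta> > 1" and int: "integrable \<nu> (\<lambda>r. max 0 (- r) powr \<beta>)" and t: "t > 0"
  shows "gap n \<le> t * persist n 0 + t powr (1 - \<beta>) * expectation (\<lambda>r. max 0 (- r) powr \<beta>)"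
proof -
  define h where "h r = t powr (1 - \<beta>) * max 0 (- r) powr \<beta>" for r :: real
  have [measurable]: "h \<in> borel_measurable borel" unfolding h_def by measurable
  \<comment> \<open>t^(1 - \<beta>) u^\<beta> = u (u / t)^(\<beta> - 1), which is at least u beyond
    t.\<close>
  have trunc: "u \<le> t + t powr (1 - \<beta>) * u powr \<beta>" if u: "u > t" for u
  proof -
    have "t powr (1 - \<beta>) * u powr \<beta> = u * (t powr (1 - \<beta>) * u powr (\<beta> - 1))"
      using u t by (simp add: powr_diff)
    also have "t powr (1 - \<beta>) * u powr (\<beta> - 1) = (u / t) powr (\<beta> - 1)"
      using u t by (simp add: powr_divide powr_diff)
    also have "u * 1 \<le> u * (u / t) powr (\<beta> - 1)"
      using u t b by (intro mult_left_mono ge_one_powr_ge_zero) auto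
    finally show ?thesis using t by simp
  qed
  have le: "max 0 (- p) \<le> t * indicator {..0} p + h r" if "r \<le> p" for p r :: real
  proof (cases "p \<le> 0")
    case True
    have "max 0 (- p) \<le> max 0 (- r)" using that by simp
    also have "\<dots> \<le> t + h r"
      using trunc[of "max 0 (- r)"] t by (cases "max 0 (- r) \<le> t") (auto simp: h_def add_increasing2)
    finally show ?thesis using True by simp
  qed (simp add: h_def)
  have int_h: "integrable sceneries (\<lambda>x. h (x (a :: 'g)))" for a
    by (subst integral_coord(2)) (auto simp: h_def[abs_def] int)
  have eh: "X.expectation (\<lambda>x. h (x (a :: 'g))) = t powr (1 - \<beta>) * expectation (\<lambda>r. max 0 (- r) powr \<beta>)" for a
    by (subst integral_coord(1)) (auto simp: h_def[abs_def])
  have int_i: "integrable sceneries (\<lambda>x. t * indicator {x. peak n s x \<le> 0} x)" for s :: "nat \<Rightarrow> 'g"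
    by (intro integrable_mult_right X.integrable_const_bound[where B = 1]) (auto simp: indicator_def)
  have "gap n \<le> W.Y.expectation (\<lambda>y. t * low_prob n (sites y) 0 +
      t powr (1 - \<beta>) * expectation (\<lambda>r. max 0 (- r) powr \<beta>))"
    unfolding gap_def
  proof (rule integral_mono[OF integrable_gap])
    show "integrable W.steps (\<lambda>y. t * low_prob n (sites y) 0 +
        t powr (1 - \<beta>) * expectation (\<lambda>r. max 0 (- r) powr \<beta>))"
      by (simp add: integrable_persist)
    fix y :: "nat \<Rightarrow> 'g"
    have "neg_peak n (sites y) \<le>
        X.expectation (\<lambda>x. t * indicator {x. peak n (sites y) x \<le> 0} x + h (x (sites y 0)))"
    proof (rule integral_mono[OF integrable_gap_path])
      fix x
      show "max 0 (- peak n (sites y) x) \<le> t * indicator {x. peak n (sites y) x \<le> 0} x + h (x (sites y 0))"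
        using le[OF first_le_peak[of x "sites y" n]] by (simp add: indicator_def)
    qed (intro Bochner_Integration.integrable_add int_h int_i)
    also have "\<dots> = t * low_prob n (sites y) 0 +
        t powr (1 - \<beta>) * expectation (\<lambda>r. max 0 (- r) powr \<beta>)"
      by (subst Bochner_Integration.integral_add[OF int_i int_h]) (simp add: eh)
    finally show "neg_peak n (sites y) \<le>
        t * low_prob n (sites y) 0 + t powr (1 - \<beta>) * expectation (\<lambda>r. max 0 (- r) powr \<beta>)" .
  qed
  also have "\<dots> = t * persist n 0 + t powr (1 - \<beta>) * expectation (\<lambda>r. max 0 (- r) powr \<beta>)"
    by (simp add: persist_def integrable_persist)
  finally show ?thesis .
qed

text \<open>A law on the nonnegative half-line with mean zero is the point mass at 0, which the
  positive variance excludes.\<close>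

lemma prob_negative: "\<exists>\<delta>>0. measure \<nu> {..- \<delta>} > 0"
proof (rule ccontr)
  assume "\<not> ?thesis"
  then have z: "measure \<nu> {..- \<delta>} = 0" if "\<delta> > 0" for \<delta>
    using that measure_nonneg[of \<nu> "{..- \<delta>}"] by (meson not_le order_antisym)
  have "AE r in \<nu>. \<not> r \<le> - inverse (real (Suc k))" for k
    using z[of "inverse (real (Suc k))"]
    by (intro AE_I[where N = "{..- inverse (real (Suc k))}"])
       (auto simp: emeasure_eq_measure sets_scenery)
  then have "AE r in \<nu>. \<forall>k. \<not> r \<le> - inverse (real (Suc k))" by (simp add: AE_all_countable)
  then have nn: "AE r in \<nu>. 0 \<le> r"
  proof eventually_elim
    case (elim r)
    show ?case
    proof (rule ccontr)
      assume "\<not> 0 \<le> r"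
      then obtain k where "inverse (real (Suc k)) < - r"
        using reals_Archimedean[of "- r"] by auto
      with elim[rule_format, of k] show False by simp
    qed
  qed
  have "AE r in \<nu>. r = 0"
    using integral_nonneg_eq_0_iff_AE[OF integrable_id nn] centered by simp
  then have "expectation (\<lambda>r. r\<^sup>2) = expectation (\<lambda>r. 0)"
    by (intro integral_cong_AE) auto
  with nondegenerate show False by simp
qed

text \<open>Forcing the first scenery value below \<open>- \<delta>\<close>, \<open>K\<close> times
  over, lowers the level from \<open>m\<close> to \<open>- \<delta>\<close> at the price
  \<open>p ^ K\<close>; there Markov's inequality bounds the probability by the gap. The horizon
  grows by \<open>K\<close>, which is harmless because gaps decrease.\<close>

lemma persist_upper:
  assumes upper: "\<And>n. n \<ge> 1 \<Longrightarrow> mean_top n \<le> C * a n" and C: "C > 0" and a: "\<And>n. n \<ge> 1 \<Longrightarrow> a n > 0"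
  shows "\<exists>c>0. \<forall>n. persist n m \<le> c * (a (Suc n) / real (Suc n))"
proof -
  obtain \<delta> where d: "\<delta> > 0" and p: "measure \<nu> {..- \<delta>} > 0" using prob_negative by blast
  define p where "p = measure \<nu> {..- \<delta>}"
  have iter: "p ^ K * persist n m \<le> persist (n + K) (- \<delta>)" if "m \<le> real K * \<delta> - \<delta>" for K n m
    using that
  proof (induction K arbitrary: n m)
    case 0
    then show ?case by (simp add: persist_mono)
  next
    case (Suc K)
    have "p ^ Suc K * persist n m = p ^ K * (p * persist n m)" by simp
    also have "\<dots> \<le> p ^ K * persist (Suc n) (max (- \<delta>) (- \<delta> + m))"
      using persist_Suc_ge[of "- \<delta>" n m] by (intro mult_left_mono) (auto simp: p_def)
    also have "\<dots> \<le> persist (Suc n + K) (- \<delta>)"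
      using Suc.prems d by (intro Suc.IH) (auto simp: max_def algebra_simps)
    finally show ?case by simp
  qed
  obtain K where "(m + \<delta>) / \<delta> \<le> real K" using real_arch_simple by blast
  then have K: "m \<le> real K * \<delta> - \<delta>" using d by (simp add: field_simps)
  have pK: "p ^ K > 0" using p by (simp add: p_def)
  have "persist n m \<le> C / (p ^ K * \<delta>) * (a (Suc n) / real (Suc n))" for n
  proof -
    have "p ^ K * \<delta> * persist n m \<le> \<delta> * persist (n + K) (- \<delta>)"
      using mult_left_mono[OF iter[OF K, of n], of \<delta>] d by (simp add: mult_ac)
    also have "\<dots> \<le> gap (n + K)" by (rule persist_le_gap)
    also have "\<dots> \<le> gap n" by (rule gap_antimono) simp
    also have "\<dots> \<le> mean_top (Suc n) / real (Suc n)"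
      using gap_le[of n] by (simp add: field_simps)
    also have "\<dots> \<le> C * a (Suc n) / real (Suc n)"
      by (intro divide_right_mono upper) auto
    finally have "persist n m \<le> C * a (Suc n) / real (Suc n) / (p ^ K * \<delta>)"
      using pK d by (simp only: pos_le_divide_eq mult_pos_pos mult.commute[of "persist n m"])
    then show ?thesis by (simp add: mult.commute)
  qed
  then show ?thesis using C pK d by (intro exI[of _ "C / (p ^ K * \<delta>)"]) auto
qed

text \<open>From time N to time L N the mean maximum rises by at least c a(L N) - C a(N), hence by C
  a(N) once c sqrt(L) is at least 2 C. The rise is a sum of fewer than L N gaps, none above
  \<open>gap n\<close>.\<close>

lemma gap_lower:
  assumes upper: "\<And>n. n \<ge> 1 \<Longrightarrow> mean_top n \<le> C * a n" and C: "C > 0"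
    and lower: "\<And>n. n \<ge> 1 \<Longrightarrow> c * a n \<le> mean_top n" and c: "c > 0"
    and a: "\<And>n. n \<ge> 1 \<Longrightarrow> a n > 0"
    and growth: "\<And>L n. L \<ge> 3 \<Longrightarrow> n \<ge> 1 \<Longrightarrow> sqrt (real L) * a n \<le> a (L * n)"
  shows "\<exists>k>0. \<forall>n. k * (a (Suc n) / real (Suc n)) \<le> gap n"
proof -
  obtain L0 :: nat where L0: "((2 * C) / c)\<^sup>2 \<le> real L0" using real_arch_simple by blast
  \<comment> \<open>The growth hypothesis starts at 3, the first integer above e, on account of the
    logarithmic normalization.\<close>
  define L where "L = max 3 L0"
  have "((2 * C) / c)\<^sup>2 \<le> real L" using L0 by (simp add: L_def)
  then have "(2 * C) / c \<le> sqrt (real L)" by (rule real_le_rsqrt)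
  then have L: "2 * C \<le> c * sqrt (real L)" using c by (simp add: field_simps)
  have L3: "L \<ge> 3" by (simp add: L_def)
  have "C / real L * (a (Suc n) / real (Suc n)) \<le> gap n" for n
  proof -
    define N where "N = Suc n"
    have "2 * C * a N \<le> c * sqrt (real L) * a N"
      using L a[of N] by (intro mult_right_mono) (auto simp: N_def)
    also have "\<dots> \<le> c * a (L * N)"
      using growth[OF L3, of N] c by (simp add: N_def mult.assoc)
    also have "\<dots> \<le> mean_top (L * N)" using L3 by (intro lower) (simp add: N_def)
    finally have "C * a N \<le> mean_top (L * N) - mean_top N"
      using upper[of N] by (simp add: N_def)
    also have "L * N = N + (L - 1) * N" using L3 by (cases L) auto
    also have "mean_top (N + (L - 1) * N) - mean_top N \<le> real ((L - 1) * N) * gap N"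
      by (rule gap_ge)
    also have "\<dots> \<le> real (L * N) * gap n"
      by (intro mult_mono gap_antimono gap_nonneg of_nat_mono mult_le_mono) (auto simp: N_def)
    finally have "C * a N \<le> gap n * real (L * N)" by (simp add: mult.commute)
    moreover have "real (L * N) > 0" using L3 unfolding N_def of_nat_0_less_iff by simp
    ultimately have "C * a N / real (L * N) \<le> gap n" by (simp only: pos_divide_le_eq)
    then show ?thesis unfolding N_def[symmetric] times_divide_times_eq of_nat_mult .
  qed
  then show ?thesis using C L3 by (intro exI[of _ "C / real L"]) auto
qed

text \<open>The truncation level \<open>t\<close> makes the error at most half of the lower bound k
  u on the gap, where u = a(n + 1) / (n + 1). What remains is that \<open>persist n 0\<close> is at
  least k u / (2 t), a multiple of u^(1 + \<gamma>).\<close>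

lemma persist_lower:
  assumes k: "k > 0" "\<And>n. k * (a (Suc n) / real (Suc n)) \<le> gap n"
    and a: "\<And>n. n \<ge> 1 \<Longrightarrow> a n > 0" "\<And>n. n \<ge> 1 \<Longrightarrow> a n \<le> real n"
    and b: "\<beta> > 1" and int: "integrable \<nu> (\<lambda>r. max 0 (- r) powr \<beta>)"
  shows "\<exists>c>0. \<forall>n. c * (a (Suc n) / real (Suc n)) powr (1 + 2 / \<beta>) \<le> persist n 0"
proof -
  \<comment> \<open>Square integrability makes the exponent 2 available when \<open>\<beta>\<close>
    is smaller; with this choice 1 + \<open>\<gamma>\<close> never exceeds 1 + 2 /
    \<open>\<beta>\<close>.\<close>
  define \<beta>' where "\<beta>' = max 2 \<beta>"
  have b': "\<beta>' > 1" by (simp add: \<beta>'_def)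
  have int': "integrable \<nu> (\<lambda>r. max 0 (- r) powr \<beta>')"
  proof (cases "\<beta> \<ge> 2")
    case True
    with int show ?thesis by (simp add: \<beta>'_def)
  next
    case False
    have "integrable \<nu> (\<lambda>r. (max 0 (- r))\<^sup>2)"
      by (rule Bochner_Integration.integrable_bound[OF square_integrable]) (auto simp: max_def)
    moreover have "max 0 (- r) powr \<beta>' = (max 0 (- r))\<^sup>2" for r :: real
      using False by (auto simp: \<beta>'_def max_def powr_numeral)
    ultimately show ?thesis by simp
  qed
  define \<gamma> where "\<gamma> = 1 / (\<beta>' - 1)"
  have g: "\<gamma> > 0" using b' by (simp add: \<gamma>_def)
  have g_le: "1 + \<gamma> \<le> 1 + 2 / \<beta>"
  proof (cases "\<beta> \<ge> 2")
    case True
    then show ?thesis by (simp add: \<gamma>_def \<beta>'_def field_simps)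
  next
    case False
    then show ?thesis using b by (simp add: \<gamma>_def \<beta>'_def field_simps)
  qed
  \<comment> \<open>The added 1 makes positivity of \<open>D\<close> immediate.\<close>
  define D where "D = expectation (\<lambda>r. max 0 (- r) powr \<beta>') + 1"
  have D: "D > 0"
  proof -
    have "0 \<le> expectation (\<lambda>r. max 0 (- r) powr \<beta>')" by (intro integral_nonneg_AE) auto
    then show ?thesis unfolding D_def by linarith
  qed
  define c where "c = k / 2 * (k / (2 * D)) powr \<gamma>"
  have c: "c > 0" using k D by (simp add: c_def)
  have "c * (a (Suc n) / real (Suc n)) powr (1 + 2 / \<beta>) \<le> persist n 0" for n
  proof -
    define u where "u = a (Suc n) / real (Suc n)"
    have u: "u > 0" "u \<le> 1" using a[of "Suc n"] by (simp_all add: u_def)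
    \<comment> \<open>The solution of t^(1 - \<beta>') D = k u / 2.\<close>
    define t where "t = (2 * D / (k * u)) powr \<gamma>"
    have t: "t > 0" using k D u by (simp add: t_def)
    have "\<gamma> * (1 - \<beta>') = - 1"
      unfolding \<gamma>_def using b' by (simp add: divide_eq_eq)
    then have "t powr (1 - \<beta>') = (2 * D / (k * u)) powr (- 1)"
      unfolding t_def powr_powr by simp
    also have "\<dots> = k * u / (2 * D)" using D k u by (simp add: powr_minus_divide)
    finally have t1: "t powr (1 - \<beta>') * D = k * u / 2" using D by simp
    have "k * u \<le> gap n" using k(2)[of n] by (simp add: u_def)
    also have "\<dots> \<le> t * persist n 0 + t powr (1 - \<beta>') * expectation (\<lambda>r. max 0 (- r) powr \<beta>')"
      by (rule gap_le_persist[OF b' int' t])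
    also have "\<dots> \<le> t * persist n 0 + t powr (1 - \<beta>') * D"
      by (intro add_left_mono mult_left_mono) (auto simp: D_def)
    finally have "k * u / 2 \<le> t * persist n 0" using t1 by simp
    then have p: "k * u / 2 / t \<le> persist n 0" using t by (simp add: field_simps)
    have "1 / t = (k * u / (2 * D)) powr \<gamma>"
      unfolding t_def using k u D by (simp add: powr_divide)
    also have "\<dots> = (k / (2 * D)) powr \<gamma> * u powr \<gamma>"
      using k u D by (simp add: powr_mult[symmetric])
    finally have "k * u / 2 * (1 / t) = k * u / 2 * ((k / (2 * D)) powr \<gamma> * u powr \<gamma>)" by (simp only:)
    then have "k * u / 2 / t = c * (u * u powr \<gamma>)"
      by (simp add: c_def)
    also have "u * u powr \<gamma> = u powr (1 + \<gamma>)" using u by (simp add: powr_add)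
    finally have "c * u powr (1 + \<gamma>) \<le> persist n 0" using p by simp
    \<comment> \<open>\<open>u\<close> is at most 1, so the larger exponent gives the smaller
      power.\<close>
    moreover have "c * u powr (1 + 2 / \<beta>) \<le> c * u powr (1 + \<gamma>)"
      using u g_le c by (intro mult_left_mono powr_mono') auto
    ultimately show ?thesis unfolding u_def[symmetric] by linarith
  qed
  then show ?thesis using c by blast
qed

lemma persistence_bounds:
  assumes lower: "\<And>n. n \<ge> 1 \<Longrightarrow> c1 * a n \<le> W.mean_sqrt_pairs n" and c1: "c1 > 0"
    and upper: "\<And>n. n \<ge> 1 \<Longrightarrow> W.mean_sqrt_pairs n \<le> c2 * a n" and c2: "c2 > 0"
    and a: "\<And>n. n \<ge> 1 \<Longrightarrow> a n > 0" "\<And>n. n \<ge> 1 \<Longrightarrow> a n \<le> real n"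
    and growth: "\<And>L n. L \<ge> 3 \<Longrightarrow> n \<ge> 1 \<Longrightarrow> sqrt (real L) * a n \<le> a (L * n)"
    and b: "\<beta> > 1" and int: "integrable \<nu> (\<lambda>r. max 0 (- r) powr \<beta>)"
  shows "\<exists>c>0. \<forall>n. persist n m \<le> c * (a (Suc n) / real (Suc n))"
    and "m \<ge> 0 \<or> measure \<nu> {..m} > 0 \<Longrightarrow>
      \<exists>c>0. \<forall>n. c * (a (Suc n) / real (Suc n)) powr (1 + 2 / \<beta>) \<le> persist n m"
proof -
  obtain \<kappa> where kap: "\<kappa> > 0" "\<And>n (s :: nat \<Rightarrow> 'g). \<kappa> * sqrt (pairs n s) \<le> X.expectation (top0 n s)"
    using expectation_top0_ge by blast
  have s0: "\<sigma>2 > 0" using nondegenerate by (simp add: \<sigma>2_def)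
  have up: "mean_top n \<le> (sqrt \<sigma>2 * c2) * a n" if "n \<ge> 1" for n
  proof -
    have "mean_top n \<le> W.Y.expectation (\<lambda>y. sqrt \<sigma>2 * sqrt (pairs n (sites y)))"
      unfolding mean_top_def
      by (intro integral_mono integrable_mean_top integrable_mult_right W.integrable_sqrt_pairs
          expectation_top0_le)
    also have "\<dots> \<le> sqrt \<sigma>2 * (c2 * a n)"
      using mult_left_mono[OF upper[OF that], of "sqrt \<sigma>2"] s0 by simp
    finally show ?thesis by (simp add: mult.assoc)
  qed
  have low: "(\<kappa> * c1) * a n \<le> mean_top n" if "n \<ge> 1" for n
  proof -
    have "\<kappa> * (c1 * a n) \<le> W.Y.expectation (\<lambda>y. \<kappa> * sqrt (pairs n (sites y)))"
      using mult_left_mono[OF lower[OF that], of \<kappa>] kap by simp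
    also have "\<dots> \<le> mean_top n"
      unfolding mean_top_def
      by (intro integral_mono integrable_mean_top integrable_mult_right W.integrable_sqrt_pairs kap)
    finally show ?thesis by (simp add: mult.assoc)
  qed
  have pos: "sqrt \<sigma>2 * c2 > 0" "\<kappa> * c1 > 0" using s0 c1 c2 kap by auto
  show "\<exists>c>0. \<forall>n. persist n m \<le> c * (a (Suc n) / real (Suc n))"
    by (rule persist_upper[OF up pos(1) a(1)])
  obtain k where k: "k > 0" "\<And>n. k * (a (Suc n) / real (Suc n)) \<le> gap n"
    using gap_lower[OF up pos(1) low pos(2) a(1) growth] by blast
  obtain c where c: "c > 0" "\<And>n. c * (a (Suc n) / real (Suc n)) powr (1 + 2 / \<beta>) \<le> persist n 0"
    using persist_lower[OF k a b int] by blast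
  assume m: "m \<ge> 0 \<or> measure \<nu> {..m} > 0"
  show "\<exists>c>0. \<forall>n. c * (a (Suc n) / real (Suc n)) powr (1 + 2 / \<beta>) \<le> persist n m"
  proof (cases "m \<ge> 0")
    case True
    then show ?thesis using c order_trans[OF c(2) persist_mono] by blast
  next
    case False
    define p where "p = measure \<nu> {..m}"
    have p: "p > 0" using m False by (simp add: p_def)
    have "p * c * (a (Suc n) / real (Suc n)) powr (1 + 2 / \<beta>) \<le> persist n m" for n
    proof -
      have "p * (c * (a (Suc n) / real (Suc n)) powr (1 + 2 / \<beta>)) \<le> p * persist n 0"
        using c p by (intro mult_left_mono) auto
      \<comment> \<open>Starting from level 0, a first value at most \<open>m\<close> leads exactly
        to the level \<open>m\<close>.\<close>
      also have "\<dots> \<le> persist (Suc n) (max m (m + 0))" unfolding p_def by (rule persist_Suc_ge)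
      also have "\<dots> \<le> persist n m" using persist_antimono[of n "Suc n" m] by simp
      finally show ?thesis by (simp add: mult.assoc)
    qed
    then show ?thesis using p c by (intro exI[of _ "p * c"]) auto
  qed
qed

end

section \<open>Trigonometric sums\<close>

text \<open>1 - z^n is 1 - z times the geometric sum, whose real part is at least n / 2 when all
  powers are within 1/2 of 1.\<close>

lemma norm_one_minus_le_of_powers:
  fixes z :: complex
  assumes "n > 0" and close: "\<And>j. j \<le> n \<Longrightarrow> cmod (1 - z ^ j) \<le> 1 / 2"
  shows "cmod (1 - z) \<le> 1 / real n"
proof -
  have "1 / 2 \<le> Re (z ^ j)" if "j \<le> n" for j
    using complex_Re_le_cmod[of "1 - z ^ j"] close[OF that] by simp
  then have "(\<Sum>j<n. 1 / 2) \<le> (\<Sum>j<n. Re (z ^ j))" by (intro sum_mono) auto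
  then have "real n / 2 \<le> Re (\<Sum>j<n. z ^ j)" by simp
  also have "\<dots> \<le> cmod (\<Sum>j<n. z ^ j)" by (rule complex_Re_le_cmod)
  finally have "cmod (1 - z) * (real n / 2) \<le> cmod (1 - z) * cmod (\<Sum>j<n. z ^ j)"
    by (intro mult_left_mono) auto
  also have "\<dots> = cmod (1 - z ^ n)" by (simp add: one_diff_power_eq norm_mult)
  also have "\<dots> \<le> 1 / 2" by (rule close) simp
  finally show ?thesis using assms(1) by (simp add: field_simps)
qed

text \<open>At z = \<open>phi u\<close> its real part is the mean of |exp(i u . S_1) + ... + exp(i u
  . S_n)|^2. Only the real part has this meaning: powers are not conjugated below the
  diagonal.\<close>

definition toeplitz_sum :: "nat \<Rightarrow> complex \<Rightarrow> complex" where
  "toeplitz_sum n z = (\<Sum>i<n. \<Sum>j<n. z ^ (if i \<le> j then j - i else i - j))"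

lemma toeplitz_sum_eq:
  "(1 - z)\<^sup>2 * toeplitz_sum n z = of_nat n * (1 - z\<^sup>2) - 2 * z * (1 - z ^ n)"
proof (induction n)
  case (Suc n)
  have "(\<Sum>i<n. z ^ (n - i)) = (\<Sum>i<n. z ^ Suc (n - Suc i))"
    by (intro sum.cong) (auto simp: Suc_diff_Suc simp del: power_Suc)
  also have "\<dots> = (\<Sum>i<n. z ^ Suc i)" by (rule sum.nat_diff_reindex)
  finally have g: "(\<Sum>i<n. z ^ (n - i)) = z * (\<Sum>i<n. z ^ i)" by (simp add: sum_distrib_left)
  have "(\<Sum>i<n. z ^ (if i \<le> n then n - i else i - n)) = (\<Sum>i<n. z ^ (n - i))"
    "(\<Sum>j<n. z ^ (if n \<le> j then j - n else n - j)) = (\<Sum>i<n. z ^ (n - i))"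
    by (intro sum.cong; simp)+
  then have "toeplitz_sum (Suc n) z = toeplitz_sum n z + 2 * z * (\<Sum>i<n. z ^ i) + 1"
    unfolding toeplitz_sum_def by (simp add: sum.distrib g)
  then have "(1 - z)\<^sup>2 * toeplitz_sum (Suc n) z =
      (1 - z)\<^sup>2 * toeplitz_sum n z + 2 * z * (1 - z) * ((1 - z) * (\<Sum>i<n. z ^ i)) + (1 - z)\<^sup>2"
    by (simp add: power2_eq_square algebra_simps)
  also have "(1 - z) * (\<Sum>i<n. z ^ i) = 1 - z ^ n" by (simp add: one_diff_power_eq)
  finally show ?case
    unfolding Suc by (simp add: power2_eq_square algebra_simps)
qed (simp add: toeplitz_sum_def)

text \<open>The closed form splits into n (1 + z) / (1 - z), whose real part is n times the Poisson
  kernel (1 - |z|^2) / |1 - z|^2, and a remainder of modulus at most 4 / |1 - z|^2.\<close>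

lemma Re_toeplitz_sum_ge:
  assumes z: "cmod z \<le> 1" "z \<noteq> 1"
  shows "(real n * (1 - (cmod z)\<^sup>2) - 4) / (cmod (1 - z))\<^sup>2 \<le> Re (toeplitz_sum n z)"
proof -
  have nz: "1 - z \<noteq> 0" using z by auto
  have p: "cmod (z ^ n) \<le> 1" using z by (simp add: norm_power power_le_one)
  have "toeplitz_sum n z = (of_nat n * (1 - z\<^sup>2) - 2 * z * (1 - z ^ n)) / (1 - z)\<^sup>2"
    using toeplitz_sum_eq[of z n] nz by (simp add: nonzero_eq_divide_eq mult.commute)
  also have "\<dots> = of_nat n * ((1 + z) / (1 - z)) - 2 * z * (1 - z ^ n) / (1 - z)\<^sup>2"
  proof -
    have "1 - z\<^sup>2 = (1 + z) * (1 - z)" by (simp add: power2_eq_square algebra_simps)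
    with nz show ?thesis by (simp add: diff_divide_distrib power2_eq_square)
  qed
  finally have eq: "toeplitz_sum n z = of_nat n * ((1 + z) / (1 - z)) - 2 * z * (1 - z ^ n) / (1 - z)\<^sup>2" .
  have "(1 + z) / (1 - z) = (1 + z) * cnj (1 - z) / of_real ((cmod (1 - z))\<^sup>2)"
    by (simp add: complex_div_cnj[of "1 + z"])
  then have "Re ((1 + z) / (1 - z)) = Re ((1 + z) * cnj (1 - z)) / (cmod (1 - z))\<^sup>2"
    by (simp only: Re_divide_of_real)
  also have "Re ((1 + z) * cnj (1 - z)) = 1 - (cmod z)\<^sup>2"
    unfolding cmod_power2 by (simp add: power2_eq_square algebra_simps)
  finally have re: "Re ((1 + z) / (1 - z)) = (1 - (cmod z)\<^sup>2) / (cmod (1 - z))\<^sup>2" .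
  have "Re (2 * z * (1 - z ^ n) / (1 - z)\<^sup>2) \<le> cmod (2 * z * (1 - z ^ n) / (1 - z)\<^sup>2)"
    by (rule complex_Re_le_cmod)
  also have "\<dots> = 2 * (cmod z * cmod (1 - z ^ n)) / (cmod (1 - z))\<^sup>2"
    by (simp add: norm_mult norm_divide norm_power)
  also have "\<dots> \<le> 2 * (1 * 2) / (cmod (1 - z))\<^sup>2"
    using z p norm_triangle_ineq4[of 1 "z ^ n"]
    by (intro divide_right_mono mult_left_mono mult_mono) auto
  finally have "Re (2 * z * (1 - z ^ n) / (1 - z)\<^sup>2) \<le> 4 / (cmod (1 - z))\<^sup>2" by simp
  moreover have "Re (toeplitz_sum n z) =
      real n * (1 - (cmod z)\<^sup>2) / (cmod (1 - z))\<^sup>2 - Re (2 * z * (1 - z ^ n) / (1 - z)\<^sup>2)"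
  proof -
    have n: "Re (of_nat n * w) = real n * Re w" for w :: complex by simp
    show ?thesis unfolding eq minus_complex.sel n re by simp
  qed
  ultimately show ?thesis unfolding diff_divide_distrib[of _ 4] by linarith
qed

lemma norm_sum_cis_square:
  "(cmod (\<Sum>i\<in>I. cis (t i)))\<^sup>2 = (\<Sum>i\<in>I. \<Sum>j\<in>I. cos (t i - t j))"
proof -
  have "(cmod (\<Sum>i\<in>I. cis (t i)))\<^sup>2 = (\<Sum>i\<in>I. cos (t i))\<^sup>2 + (\<Sum>i\<in>I. sin (t i))\<^sup>2"
    by (simp add: cmod_power2)
  then show ?thesis
    by (simp add: power2_eq_square sum_product cos_diff sum.distrib)
qed

lemma cis_sum: "finite A \<Longrightarrow> cis (\<Sum>a\<in>A. f a) = (\<Prod>a\<in>A. cis (f a))"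
  by (induction A rule: finite_induct) (auto simp: cis_mult[symmetric])

text \<open>The ratio \<open>w\<close> of the geometric sum is a Q-th root of unity, different from
  1 because \<open>Q\<close> does not divide \<open>x\<close>.\<close>

lemma sum_roots_of_unity_eq_0:
  fixes x :: int
  assumes "x \<noteq> 0" "\<bar>x\<bar> < int Q"
  shows "(\<Sum>a<Q. cis (2 * pi * real a / real Q * real_of_int x)) = 0"
proof -
  define w where "w = cis (2 * pi / real Q * real_of_int x)"
  have Q: "Q > 0" using assms by auto
  have pw: "cis (2 * pi * real a / real Q * real_of_int x) = w ^ a" for a
    unfolding w_def Complex.DeMoivre by (rule arg_cong[of _ _ cis]) simp
  have "w ^ Q = cis (2 * pi * real_of_int x)"
    unfolding w_def Complex.DeMoivre by (rule arg_cong[of _ _ cis]) (use Q in simp)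
  then have wQ: "w ^ Q = 1" by (simp add: cis_multiple_2pi)
  have "w \<noteq> 1"
  proof
    assume "w = 1"
    then have "cos (2 * pi / real Q * real_of_int x) = 1" by (simp add: w_def cis.ctr complex_eq_iff)
    then obtain k :: int where "2 * pi / real Q * real_of_int x = real_of_int k * 2 * pi"
      using cos_one_2pi_int by auto
    then have "real_of_int x = real_of_int (k * int Q)" using Q by (simp add: field_simps)
    then have "x = k * int Q" by linarith
    then have "\<bar>k\<bar> * int Q < 1 * int Q" using assms(2) by (simp add: abs_mult)
    then have "k = 0" using Q by simp
    with \<open>x = k * int Q\<close> assms(1) show False by simp
  qed
  then show ?thesis
    unfolding pw using one_diff_power_eq[of w Q] wQ by simp
qed

section \<open>Characteristic function of the steps\<close>

lemma lattice_embed_diff: "lattice_embed (x - y) = lattice_embed x - lattice_embed y"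
  by (simp add: lattice_embed_def vec_eq_iff)

lemma lattice_embed_0 [simp]: "lattice_embed 0 = 0"
  by (simp add: lattice_embed_def vec_eq_iff)

lemma lattice_embed_sum: "lattice_embed (\<Sum>k\<in>A. f k) = (\<Sum>k\<in>A. lattice_embed (f k))"
  by (simp add: lattice_embed_def vec_eq_iff)

locale lattice_walk = group_walk \<rho> for \<rho> :: "(int ^ 'd) measure"
begin

definition phi :: "real ^ 'd \<Rightarrow> complex" where
  "phi u = (\<integral>x. cis (u \<bullet> lattice_embed x) \<partial>\<rho>)"

text \<open>The two quantities of the Poisson kernel bound; the first also yields the decay of the
  powers of |phi|. Both conditions are local at 0, so the other points where |phi| = 1 for a
  periodic walk do not interfere.\<close>

definition phi_regular :: "real \<Rightarrow> real \<Rightarrow> real \<Rightarrow> real \<Rightarrow> bool" where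
  "phi_regular \<alpha> \<delta> c C \<longleftrightarrow> 0 < \<delta> \<and> \<delta> \<le> 1 \<and> 0 < c \<and> 0 < C \<and> (\<forall>u. norm u \<le> \<delta> \<longrightarrow>
    c * norm u powr \<alpha> \<le> 1 - (cmod (phi u))\<^sup>2 \<and> cmod (1 - phi u) \<le> C * norm u powr \<alpha>)"

lemma phi_regularD:
  assumes "phi_regular \<alpha> \<delta> c C"
  shows "0 < \<delta>" "\<delta> \<le> 1" "0 < c" "0 < C"
    "norm u \<le> \<delta> \<Longrightarrow> c * norm u powr \<alpha> \<le> 1 - (cmod (phi u))\<^sup>2"
    "norm u \<le> \<delta> \<Longrightarrow> cmod (1 - phi u) \<le> C * norm u powr \<alpha>"
  using assms by (auto simp: phi_regular_def)

section \<open>Trigonometric means along the walk\<close>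

lemma measurable_fun_pos [measurable]:
  "(\<lambda>y. f (pos n y)) \<in> borel_measurable steps" for f :: "int ^ 'd \<Rightarrow> 'b::topological_space"
  by (rule measurable_compose[OF measurable_pos]) simp

lemma measurable_fun_sites [measurable]:
  "(\<lambda>y. f (sites y i) (sites y j)) \<in> borel_measurable steps"
  for f :: "int ^ 'd \<Rightarrow> int ^ 'd \<Rightarrow> 'b::topological_space"
proof (rule measurable_compose_countable[where f = "\<lambda>g y. f g (sites y j)" and g = "\<lambda>y. sites y i"])
  show "(\<lambda>y. f g (sites y j)) \<in> borel_measurable steps" for g
    by (rule measurable_compose[OF measurable_sites]) simp
qed (rule measurable_sites)

lemma norm_phi_le: "cmod (phi u) \<le> 1"
proof -
  have "cmod (phi u) \<le> (\<integral>x. cmod (cis (u \<bullet> lattice_embed x)) \<partial>\<rho>)"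
    unfolding phi_def by (rule integral_norm_bound)
  then show ?thesis by simp
qed

lemma indep_steps: "Y.indep_vars (\<lambda>_. \<rho>) (\<lambda>k y. y k) UNIV"
proof (subst Y.indep_vars_iff_distr_eq_PiM)
  have "distr steps \<rho> (\<lambda>y. y k) = \<rho>" for k
    by (intro distr_PiM_component) (auto intro: prob_space_axioms)
  then show "distr steps (Pi\<^sub>M UNIV (\<lambda>_. \<rho>)) (\<lambda>y. \<lambda>k\<in>UNIV. y k) =
      Pi\<^sub>M UNIV (\<lambda>k. distr steps \<rho> (\<lambda>y. y k))"
    by (simp add: restrict_UNIV distr_id)
qed auto

lemma integrable_cis_pos: "integrable steps (\<lambda>y. cis (u \<bullet> lattice_embed (pos n y)))"
  by (rule Y.integrable_const_bound[where B = 1]) auto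

lemma expectation_cis_pos: "(\<integral>y. cis (u \<bullet> lattice_embed (pos n y)) \<partial>steps) = phi u ^ n"
proof -
  have "Y.indep_vars (\<lambda>_. \<rho>) (\<lambda>k y. y k) {..<n}"
    using Y.indep_vars_subset[OF indep_steps] by auto
  then have ind: "Y.indep_vars (\<lambda>_. borel) (\<lambda>k y. cis (u \<bullet> lattice_embed (y k))) {..<n}"
    by (rule Y.indep_vars_compose2[where Y = "\<lambda>k x. cis (u \<bullet> lattice_embed x)"]) simp
  have m: "(\<lambda>y. y k) \<in> measurable steps \<rho>" for k by simp
  have "(\<integral>y. cis (u \<bullet> lattice_embed (pos n y)) \<partial>steps) =
      (\<integral>y. (\<Prod>k<n. cis (u \<bullet> lattice_embed (y k))) \<partial>steps)"
    by (simp add: pos_def lattice_embed_sum inner_sum_right cis_sum)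
  also have "\<dots> = (\<Prod>k<n. \<integral>y. cis (u \<bullet> lattice_embed (y k)) \<partial>steps)"
  proof (rule Y.indep_vars_lebesgue_integral[OF _ ind])
    fix k
    show "integrable steps (\<lambda>y. cis (u \<bullet> lattice_embed (y k)))"
    proof (rule Y.integrable_const_bound[where B = 1])
      show "(\<lambda>y. cis (u \<bullet> lattice_embed (y k))) \<in> borel_measurable steps"
        by (rule measurable_compose[OF measurable_step]) simp
    qed auto
  qed simp
  also have "(\<lambda>k. \<integral>y. cis (u \<bullet> lattice_embed (y k)) \<partial>steps) = (\<lambda>k. phi u)"
  proof
    fix k
    have "phi u = (\<integral>x. cis (u \<bullet> lattice_embed x) \<partial>distr steps \<rho> (\<lambda>y. y k))"
      unfolding phi_def
      by (subst distr_PiM_component[of UNIV "\<lambda>_. \<rho>"]) (auto intro: prob_space_axioms)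
    also have "\<dots> = (\<integral>y. cis (u \<bullet> lattice_embed (y k)) \<partial>steps)"
      by (rule integral_distr[OF m]) simp
    finally show "(\<integral>y. cis (u \<bullet> lattice_embed (y k)) \<partial>steps) = phi u" by simp
  qed
  finally show ?thesis by simp
qed

lemma integrable_cos_pos: "integrable steps (\<lambda>y. cos (u \<bullet> lattice_embed (pos n y)))"
  by (rule Y.integrable_const_bound[where B = 1]) auto

lemma expectation_cos_pos: "Y.expectation (\<lambda>y. cos (u \<bullet> lattice_embed (pos n y))) = Re (phi u ^ n)"
  using integral_Re[OF integrable_cis_pos[of u n]] by (simp add: expectation_cis_pos)

text \<open>The difference of two sites is, up to sign, a shifted walk at time |i - j|, and the
  cosine is even.\<close>

lemma expectation_cos_sites:
  "Y.expectation (\<lambda>y. cos (u \<bullet> lattice_embed (sites y i) - u \<bullet> lattice_embed (sites y j))) =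
    Re (phi u ^ (if i \<le> j then j - i else i - j))"
proof -
  have *: "Y.expectation (\<lambda>y. cos (u \<bullet> lattice_embed (sites y j) - u \<bullet> lattice_embed (sites y i))) =
      Re (phi u ^ (j - i))" if "i \<le> j" for i j
  proof -
    have "sites y j - sites y i = pos (j - i) (\<lambda>k. y (Suc i + k))" for y :: "nat \<Rightarrow> int ^ 'd"
      using pos_add[of "Suc i" "j - i" y] that by (simp add: sites_def)
    then have "Y.expectation (\<lambda>y. cos (u \<bullet> lattice_embed (sites y j) - u \<bullet> lattice_embed (sites y i))) =
        Y.expectation (\<lambda>y. cos (u \<bullet> lattice_embed (pos (j - i) (\<lambda>k. y (Suc i + k)))))"
      by (simp only: inner_diff_right[symmetric] lattice_embed_diff[symmetric])
    also have "\<dots> = Y.expectation (\<lambda>y. cos (u \<bullet> lattice_embed (pos (j - i) y)))"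
      by (rule expectation_shift) (rule measurable_fun_pos)
    finally show ?thesis by (simp add: expectation_cos_pos)
  qed
  show ?thesis
  proof (cases "i \<le> j")
    case True
    have "cos (u \<bullet> lattice_embed (sites y i) - u \<bullet> lattice_embed (sites y j)) =
        cos (u \<bullet> lattice_embed (sites y j) - u \<bullet> lattice_embed (sites y i))" for y
      by (subst cos_minus[symmetric]) simp
    with *[OF True] True show ?thesis by simp
  next
    case False
    with *[of j i] show ?thesis by simp
  qed
qed

lemma expectation_trig_poly:
  "Y.expectation (\<lambda>y. (cmod (\<Sum>i<n. cis (u \<bullet> lattice_embed (sites y i))))\<^sup>2) = Re (toeplitz_sum n (phi u))"
  "integrable steps (\<lambda>y. (cmod (\<Sum>i<n. cis (u \<bullet> lattice_embed (sites y i))))\<^sup>2)"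
proof -
  have i: "integrable steps (\<lambda>y. cos (u \<bullet> lattice_embed (sites y i) - u \<bullet> lattice_embed (sites y j)))" for i j
    by (rule Y.integrable_const_bound[where B = 1])
       (auto intro!: measurable_fun_sites[of "\<lambda>a b. cos (u \<bullet> lattice_embed a - u \<bullet> lattice_embed b)"])
  show "Y.expectation (\<lambda>y. (cmod (\<Sum>i<n. cis (u \<bullet> lattice_embed (sites y i))))\<^sup>2) = Re (toeplitz_sum n (phi u))"
    unfolding norm_sum_cis_square toeplitz_sum_def
    by (simp only: i Bochner_Integration.integral_sum Bochner_Integration.integrable_sum
        expectation_cos_sites Re_sum)
  show "integrable steps (\<lambda>y. (cmod (\<Sum>i<n. cis (u \<bullet> lattice_embed (sites y i))))\<^sup>2)"
    unfolding norm_sum_cis_square by (intro Bochner_Integration.integrable_sum i)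
qed

definition grid :: "nat \<Rightarrow> ('d \<Rightarrow> nat) set" where
  "grid N = (UNIV \<rightarrow>\<^sub>E {..<N})"

definition freq :: "real \<Rightarrow> ('d \<Rightarrow> nat) \<Rightarrow> real ^ 'd" where
  "freq h j = (\<chi> i. h * real (j i))"

lemma finite_grid [simp]: "finite (grid N)"
  by (simp add: grid_def finite_PiE)

lemma card_grid: "card (grid N) = N ^ CARD('d)"
  by (simp add: grid_def card_PiE)

lemma sum_grid_prod:
  "(\<Sum>j\<in>grid N. \<Prod>i\<in>UNIV. f i (j i)) = (\<Prod>i\<in>UNIV. \<Sum>a<N. f i a :: 'b::comm_semiring_1)"
  unfolding grid_def by (subst prod_sum_PiE) auto

subsection \<open>Return probabilities from above\<close>

text \<open>A discrete Fejer kernel: it dominates the indicator of the origin, and only involves the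
  characteristic function near the origin, whatever the period of the walk.\<close>

lemma ret_le_fejer:
  "real N ^ (2 * CARD('d)) * ret k \<le> (\<Sum>j\<in>grid N. \<Sum>l\<in>grid N. cmod (phi (freq h j - freq h l)) ^ k)"
proof -
  let ?K = "\<lambda>x. (cmod (\<Sum>j\<in>grid N. cis (freq h j \<bullet> lattice_embed x)))\<^sup>2"
  have K: "?K x = (\<Sum>j\<in>grid N. \<Sum>l\<in>grid N. cos ((freq h j - freq h l) \<bullet> lattice_embed x))" for x :: "int ^ 'd"
    by (simp add: norm_sum_cis_square inner_diff_left)
  have iK: "integrable steps (\<lambda>y. ?K (pos k y))"
    unfolding K by (intro Bochner_Integration.integrable_sum integrable_cos_pos)
  have "real N ^ (2 * CARD('d)) * ret k = Y.expectation (\<lambda>y. real N ^ (2 * CARD('d)) * indicator {y. pos k y = 0} y)"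
    using pos_eq_sets[of k 0] by (simp add: ret_def)
  also have "\<dots> \<le> Y.expectation (\<lambda>y. ?K (pos k y))"
  proof (rule integral_mono[OF _ iK])
    show "integrable steps (\<lambda>y. real N ^ (2 * CARD('d)) * indicator {y. pos k y = 0} y)"
      using pos_eq_sets[of k 0] by (intro integrable_mult_right) (simp add: Y.emeasure_eq_measure)
    fix y :: "nat \<Rightarrow> int ^ 'd"
    \<comment> \<open>At the origin all N^d terms of the trigonometric sum equal 1; elsewhere a
      square is nonnegative.\<close>
    show "real N ^ (2 * CARD('d)) * indicator {y. pos k y = 0} y \<le> ?K (pos k y)"
      by (auto simp: indicator_def card_grid power_mult power_mult_distrib[symmetric] mult.commute[of 2]
          norm_power)
  qed
  also have "\<dots> = (\<Sum>j\<in>grid N. \<Sum>l\<in>grid N. Re (phi (freq h j - freq h l) ^ k))"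
    unfolding K
    by (simp only: integrable_cos_pos Bochner_Integration.integral_sum Bochner_Integration.integrable_sum
        expectation_cos_pos)
  also have "\<dots> \<le> (\<Sum>j\<in>grid N. \<Sum>l\<in>grid N. cmod (phi (freq h j - freq h l)) ^ k)"
    by (intro sum_mono) (metis complex_Re_le_cmod norm_power)
  finally show ?thesis .
qed

text \<open>With N of order k^(1/\<alpha>) and mesh h = \<delta> / (N d), all differences of grid
  frequencies stay in the ball where \<open>phi\<close> is controlled, while k h^\<alpha> is bounded
  below. The k-th powers then decay geometrically in each coordinate difference, the double sum is
  of order N^d, and division by N^(2 d) leaves k^(-d/\<alpha>).\<close>

lemma ret_upper:
  assumes reg: "phi_regular \<alpha> \<delta> c C" and a: "\<alpha> \<ge> 1"
  shows "\<exists>B>0. \<forall>k\<ge>1. ret k \<le> B * real k powr (- (real CARD('d) / \<alpha>))"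
proof -
  note pos = phi_regularD(1,3)[OF reg] and phi = phi_regularD(5)[OF reg]
  define d where "d = real CARD('d)"
  have d: "d \<ge> 1" unfolding d_def by (simp add: Suc_le_eq)
  define c2 where "c2 = (\<delta> / (2 * d)) powr \<alpha>"
  have c2: "c2 > 0" using pos d by (simp add: c2_def)
  \<comment> \<open>The 2 is there because the square of |phi| is what is bounded, the d because one
    norm is compared with a sum over d coordinates.\<close>
  define c3 where "c3 = c * c2 / (2 * d)"
  have c3: "c3 > 0" using pos c2 d by (simp add: c3_def)
  define q where "q = exp (- c3)"
  have q: "0 < q" "q < 1" using c3 by (simp_all add: q_def)
  define K where "K = 2 / (1 - q)"
  have K: "K > 0" using q by (simp add: K_def)
  have "ret k \<le> K ^ CARD('d) * real k powr (- (d / \<alpha>))" if k: "k \<ge> 1" for k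
  proof -
    define N where "N = nat \<lceil>real k powr (1 / \<alpha>)\<rceil>"
    have k1: "real k powr (1 / \<alpha>) \<ge> 1" using k a by (intro ge_one_powr_ge_zero) auto
    have N: "real k powr (1 / \<alpha>) \<le> real N" "real N \<le> 2 * real k powr (1 / \<alpha>)"
      using k1 unfolding N_def by linarith+
    have N0: "N > 0" using N k1 by (cases N) auto
    define h where "h = \<delta> / (real N * d)"
    have h: "h > 0" using pos d N0 by (simp add: h_def)
    have kh: "c2 \<le> real k * h powr \<alpha>"
    proof -
      have "\<delta> / (2 * d) \<le> real k powr (1 / \<alpha>) * h"
        using N(2) N0 d pos by (simp add: h_def field_simps)
      then have "c2 \<le> (real k powr (1 / \<alpha>) * h) powr \<alpha>"
        unfolding c2_def using pos d a by (intro powr_mono2) auto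
      also have "\<dots> = real k * h powr \<alpha>"
        using k h a by (simp add: powr_mult powr_powr)
      finally show ?thesis .
    qed
    have bound: "cmod (phi (freq h j - freq h l)) ^ k \<le>
        (\<Prod>i\<in>UNIV. q ^ (if j i \<le> l i then l i - j i else j i - l i))"
      if j: "j \<in> grid N" and l: "l \<in> grid N" for j l
    proof -
      define v where "v = freq h j - freq h l"
      define m where "m i = (if j i \<le> l i then l i - j i else j i - l i)" for i
      have vi: "\<bar>v $ i\<bar> = h * real (m i)" for i
        using h by (auto simp: v_def freq_def m_def right_diff_distrib[symmetric] abs_mult)
      have mN: "m i \<le> N" for i
        using j l by (auto simp: m_def grid_def PiE_def Pi_def dest!: spec[of _ i])
      have "norm v \<le> (\<Sum>i\<in>UNIV. \<bar>v $ i\<bar>)" by (rule norm_le_l1_cart)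
      also have "\<dots> \<le> (\<Sum>i\<in>(UNIV::'d set). h * real N)"
        unfolding vi using h mN by (intro sum_mono mult_left_mono) auto
      also have "\<dots> = \<delta>" using N0 d by (simp add: h_def d_def)
      finally have nv: "norm v \<le> \<delta>" .
      have "(\<Sum>i\<in>UNIV. h powr \<alpha> * real (m i)) \<le> (\<Sum>i\<in>(UNIV::'d set). norm v powr \<alpha>)"
      proof (rule sum_mono)
        fix i
        \<comment> \<open>\<open>m i\<close> is a natural number and \<alpha> \<ge> 1, so a power
          may be replaced by a linear term; this is what makes the exponential split over
          coordinates.\<close>
        have "real (m i) \<le> real (m i) powr \<alpha>"
        proof (cases "m i = 0")
          case False
          then show ?thesis using powr_mono[of 1 \<alpha> "real (m i)"] a by simp
        qed simp
        then have "h powr \<alpha> * real (m i) \<le> h powr \<alpha> * real (m i) powr \<alpha>"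
          by (intro mult_left_mono) auto
        also have "\<dots> = \<bar>v $ i\<bar> powr \<alpha>" using h by (simp add: vi powr_mult)
        also have "\<dots> \<le> norm v powr \<alpha>"
          using a by (intro powr_mono2 component_le_norm_cart) auto
        finally show "h powr \<alpha> * real (m i) \<le> norm v powr \<alpha>" .
      qed
      then have vsum: "h powr \<alpha> * (\<Sum>i\<in>UNIV. real (m i)) \<le> d * norm v powr \<alpha>"
        by (simp add: sum_distrib_left d_def)
      have "c3 * (\<Sum>i\<in>UNIV. real (m i)) = c / (2 * d) * (c2 * (\<Sum>i\<in>UNIV. real (m i)))"
        by (simp add: c3_def)
      also have "\<dots> \<le> c / (2 * d) * (real k * h powr \<alpha> * (\<Sum>i\<in>UNIV. real (m i)))"
        using pos d kh by (intro mult_left_mono mult_right_mono) (auto intro: sum_nonneg)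
      also have "\<dots> \<le> c / (2 * d) * (real k * (d * norm v powr \<alpha>))"
        unfolding mult.assoc[of "real k"] using pos d vsum by (intro mult_left_mono) auto
      also have "\<dots> = c * norm v powr \<alpha> * real k / 2" using d by simp
      finally have ex: "2 * (c3 * (\<Sum>i\<in>UNIV. real (m i))) \<le> c * norm v powr \<alpha> * real k" by simp
      have "(cmod (phi v) ^ k)\<^sup>2 = ((cmod (phi v))\<^sup>2) ^ k" by (simp add: power_mult[symmetric] mult.commute)
      also have "\<dots> \<le> exp (- (c * norm v powr \<alpha>)) ^ k"
        using phi[OF nv] exp_ge_add_one_self[of "- (c * norm v powr \<alpha>)"]
        by (intro power_mono) auto
      also have "\<dots> = exp (- (c * norm v powr \<alpha> * real k))"
        by (simp add: exp_of_nat_mult[symmetric] mult.commute)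
      also have "\<dots> \<le> exp (- (2 * (c3 * (\<Sum>i\<in>UNIV. real (m i)))))" using ex by simp
      also have "\<dots> = (exp (- (c3 * (\<Sum>i\<in>UNIV. real (m i)))))\<^sup>2"
        by (simp add: exp_double[symmetric])
      finally have "cmod (phi v) ^ k \<le> exp (- (c3 * (\<Sum>i\<in>UNIV. real (m i))))"
        by (rule power2_le_imp_le) simp
      also have "\<dots> = (\<Prod>i\<in>UNIV. q ^ m i)"
        by (simp add: q_def exp_of_nat_mult[symmetric] exp_sum[symmetric] sum_distrib_left
            sum_negf[symmetric] mult.commute)
      finally show ?thesis by (simp add: v_def m_def)
    qed
    have geo: "(\<Sum>b<N. q ^ (if a \<le> b then b - a else a - b)) \<le> K" if "a < N" for a
    proof -
      have "(\<Sum>b<N. q ^ (if a \<le> b then b - a else a - b)) \<le> 2 * (\<Sum>k\<le>N. q ^ k)"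
        using q that by (intro sum_dist_le) auto
      also have "(\<Sum>k\<le>N. q ^ k) \<le> (\<Sum>k. q ^ k)"
        using q by (intro sum_le_suminf summable_geometric) auto
      also have "\<dots> = 1 / (1 - q)" using q by (intro suminf_geometric) auto
      finally show ?thesis by (simp add: K_def)
    qed
    have "real N ^ (2 * CARD('d)) * ret k \<le> (\<Sum>j\<in>grid N. \<Sum>l\<in>grid N. cmod (phi (freq h j - freq h l)) ^ k)"
      by (rule ret_le_fejer)
    also have "\<dots> \<le> (\<Sum>j\<in>grid N. \<Sum>l\<in>grid N. \<Prod>i\<in>UNIV. q ^ (if j i \<le> l i then l i - j i else j i - l i))"
      by (intro sum_mono bound)
    also have "\<dots> = (\<Sum>j\<in>grid N. \<Prod>i\<in>UNIV. \<Sum>b<N. q ^ (if j i \<le> b then b - j i else j i - b))"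
      by (intro sum.cong refl sum_grid_prod)
    also have "\<dots> \<le> (\<Sum>j\<in>grid N. \<Prod>i\<in>(UNIV::'d set). K)"
      using q by (intro sum_mono prod_mono conjI geo sum_nonneg) (auto simp: grid_def)
    also have "\<dots> = real N ^ CARD('d) * K ^ CARD('d)" by (simp add: card_grid)
    finally have "real N ^ CARD('d) * (real N ^ CARD('d) * ret k) \<le> real N ^ CARD('d) * K ^ CARD('d)"
      by (simp add: power_mult power2_eq_square mult.assoc power_mult_distrib mult.commute[of 2])
    then have le: "real N ^ CARD('d) * ret k \<le> K ^ CARD('d)" using N0 by simp
    have "real k powr (d / \<alpha>) = (real k powr (1 / \<alpha>)) powr d" by (simp add: powr_powr)
    also have "\<dots> = (real k powr (1 / \<alpha>)) ^ CARD('d)"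
      using k unfolding d_def by (subst powr_realpow) auto
    also have "\<dots> \<le> real N ^ CARD('d)" using N k1 by (intro power_mono) auto
    finally have "real k powr (d / \<alpha>) * ret k \<le> K ^ CARD('d)"
      using le mult_right_mono[of _ _ "ret k"] ret_nonneg[of k] order_trans by blast
    then show ?thesis using k by (simp add: powr_minus field_simps)
  qed
  then show ?thesis using K unfolding d_def by (intro exI[of _ "K ^ CARD('d)"]) auto
qed

end

text \<open>The case m > n is included, with an empty sum and a nonpositive logarithm; this spares a
  comparison of the end points where the lemma is applied.\<close>

lemma ln_le_sum_inverse:
  assumes "0 < m"
  shows "ln (real (Suc n) / real m) \<le> (\<Sum>a=m..n. 1 / real a)"
proof (cases "m \<le> n")
  case False
  then have "real (Suc n) / real m \<le> 1" using assms by simp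
  then have "ln (real (Suc n) / real m) \<le> 0" by (subst ln_le_zero_iff) (use assms in auto)
  with False show ?thesis by simp
next
  case True
  have "ln (real (Suc k) / real m) \<le> (\<Sum>a=m..k. 1 / real a)" if "m \<le> k" for k
    using that
  proof (induction k rule: dec_induct)
    case base
    have "ln (1 + 1 / real m) \<le> 1 / real m" using assms by (intro ln_add_one_self_le_self) auto
    moreover have "real (Suc m) / real m = 1 + 1 / real m" using assms by (simp add: field_simps)
    ultimately show ?case by simp
  next
    case (step k)
    have le: "ln (1 + 1 / real (Suc k)) \<le> 1 / real (Suc k)" by (intro ln_add_one_self_le_self) auto
    have "real (Suc (Suc k)) = real (Suc k) * (1 + 1 / real (Suc k))"
      by (simp add: field_simps)
    then have "real (Suc (Suc k)) / real m = (real (Suc k) / real m) * (1 + 1 / real (Suc k))"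
      by (simp only: times_divide_eq_left)
    moreover have "ln ((real (Suc k) / real m) * (1 + 1 / real (Suc k))) =
        ln (real (Suc k) / real m) + ln (1 + 1 / real (Suc k))"
      using assms by (intro ln_mult_pos) (auto intro: add_pos_nonneg)
    ultimately have "ln (real (Suc (Suc k)) / real m) \<le> ln (real (Suc k) / real m) + 1 / real (Suc k)"
      using le by (metis add_left_mono)
    also have "\<dots> \<le> (\<Sum>a=m..k. 1 / real a) + 1 / real (Suc k)" using step by simp
    also have "\<dots> = (\<Sum>a=m..Suc k. 1 / real a)" using step by simp
    finally show ?case .
  qed
  with True show ?thesis by blast
qed

context lattice_walk begin

subsection \<open>Self-intersections from below\<close>

text \<open>Orthogonality of the characters of the torus (Z / Q)^d: the sum factorizes over
  coordinates, and a nonzero coordinate smaller than \<open>Q\<close> annihilates its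
  factor.\<close>

lemma sum_grid_cos:
  assumes "\<And>c. \<bar>x $ c\<bar> < int Q"
  shows "(\<Sum>j\<in>grid Q. cos (freq (2 * pi / real Q) j \<bullet> lattice_embed x)) = real (Q ^ CARD('d)) * of_bool (x = 0)"
proof -
  let ?h = "2 * pi / real Q"
  have "(\<Sum>j\<in>grid Q. cis (freq ?h j \<bullet> lattice_embed x)) =
      (\<Sum>j\<in>grid Q. \<Prod>i\<in>UNIV. cis (2 * pi * real (j i) / real Q * real_of_int (x $ i)))"
    by (simp add: inner_vec_def freq_def lattice_embed_def cis_sum mult_ac)
  also have "\<dots> = (\<Prod>i\<in>UNIV. \<Sum>a<Q. cis (2 * pi * real a / real Q * real_of_int (x $ i)))"
    by (rule sum_grid_prod)
  also have "\<dots> = of_nat (Q ^ CARD('d)) * of_bool (x = 0)"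
  proof (cases "x = 0")
    case False
    then obtain i where "x $ i \<noteq> 0" by (auto simp: vec_eq_iff)
    then have "(\<Sum>a<Q. cis (2 * pi * real a / real Q * real_of_int (x $ i))) = 0"
      using assms by (intro sum_roots_of_unity_eq_0)
    then have "(\<Prod>i\<in>UNIV. \<Sum>a<Q. cis (2 * pi * real a / real Q * real_of_int (x $ i))) = 0"
      by (intro prod_zero) (auto intro: bexI[of _ i])
    with False show ?thesis by simp
  qed simp
  finally have "Re (\<Sum>j\<in>grid Q. cis (freq ?h j \<bullet> lattice_embed x)) =
      Re (of_nat (Q ^ CARD('d)) * of_bool (x = 0))" by simp
  then show ?thesis by (cases "x = 0") (simp_all del: of_nat_power)
qed

text \<open>A crude bound for all coordinate differences between visited sites; as long as it is
  below \<open>Q\<close>, the walk does not wrap around the torus.\<close>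

definition spread :: "nat \<Rightarrow> (nat \<Rightarrow> int ^ 'd) \<Rightarrow> real" where
  "spread n y = (\<Sum>a<n. \<Sum>b<n. \<Sum>c\<in>UNIV. \<bar>real_of_int ((sites y a - sites y b) $ c)\<bar>)"

lemma measurable_spread [measurable]: "spread n \<in> borel_measurable steps"
  unfolding spread_def
  by (intro borel_measurable_sum measurable_fun_sites[of "\<lambda>u v. \<bar>real_of_int ((u - v) $ _)\<bar>"])

lemma le_spread:
  assumes "a < n" "b < n"
  shows "\<bar>real_of_int ((sites y a - sites y b) $ c)\<bar> \<le> spread n y"
proof -
  let ?f = "\<lambda>a b c. \<bar>real_of_int ((sites y a - sites y b) $ c)\<bar>"
  have "?f a b c \<le> (\<Sum>c\<in>UNIV. ?f a b c)" by (rule member_le_sum) auto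
  also have "\<dots> \<le> (\<Sum>b<n. \<Sum>c\<in>UNIV. ?f a b c)"
    using assms by (intro member_le_sum[of b _ "\<lambda>b. \<Sum>c\<in>UNIV. ?f a b c"] sum_nonneg) auto
  also have "\<dots> \<le> spread n y"
    unfolding spread_def
    using assms by (intro member_le_sum[of a _ "\<lambda>a. \<Sum>b<n. \<Sum>c\<in>UNIV. ?f a b c"] sum_nonneg) auto
  finally show ?thesis .
qed

text \<open>\<open>spread n\<close> is finite everywhere, so continuity from above applies, whatever
  the tails of the steps.\<close>

lemma prob_spread_small:
  assumes "\<epsilon> > 0"
  shows "\<exists>Q0. \<forall>Q\<ge>Q0. Y.prob {y. real Q \<le> spread n y} \<le> \<epsilon>"
proof -
  let ?W = "\<lambda>Q. {y. real Q \<le> spread n y}"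
  have W: "?W Q \<in> sets steps" for Q
  proof -
    have "Measurable.pred steps (\<lambda>y. real Q \<le> spread n y)" by measurable
    then show ?thesis by (simp add: pred_def)
  qed
  have "(\<lambda>Q. Y.prob (?W Q)) \<longlonglongrightarrow> Y.prob (\<Inter>Q. ?W Q)"
    by (rule Y.finite_Lim_measure_decseq) (use W in \<open>auto simp: decseq_def\<close>)
  moreover have "(\<Inter>Q. ?W Q) = {}"
  proof -
    have "\<exists>Q. \<not> real Q \<le> spread n y" for y
      using reals_Archimedean2[of "spread n y"] by (auto simp: not_le)
    then show ?thesis by blast
  qed
  ultimately have "(\<lambda>Q. Y.prob (?W Q)) \<longlonglongrightarrow> 0" by simp
  then have "\<forall>\<^sub>F Q in sequentially. Y.prob (?W Q) < \<epsilon>" using assms by (rule order_tendstoD)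
  then show ?thesis unfolding eventually_sequentially using less_imp_le by meson
qed

text \<open>Parseval's identity on a torus so large that the walk does not wrap around it. All terms
  are nonnegative, so frequencies away from the origin may be dropped.\<close>

lemma expectation_pairs_ge_grid:
  "\<exists>Q0. \<forall>Q\<ge>Q0. \<forall>T\<subseteq>grid Q.
     (\<Sum>j\<in>T. Re (toeplitz_sum n (phi (freq (2 * pi / real Q) j)))) / real Q ^ CARD('d) \<le>
       mean_pairs n + 1"
proof -
  \<comment> \<open>Where the walk may wrap around, each squared sum is at most n^2; this
    probability reduces the contribution of that event to the final + 1.\<close>
  obtain Q0 where Q0: "\<And>Q. Q \<ge> Q0 \<Longrightarrow> Y.prob {y. real Q \<le> spread n y} \<le> 1 / ((real n)\<^sup>2 + 1)"
    using prob_spread_small[of "1 / ((real n)\<^sup>2 + 1)" n] by (auto simp: add_nonneg_pos)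
  show ?thesis
  proof (intro exI[of _ "Suc Q0"] allI impI)
    fix Q T assume Q: "Suc Q0 \<le> Q" and T: "T \<subseteq> grid Q"
    let ?h = "2 * pi / real Q"
    define D where "D j y = (cmod (\<Sum>i<n. cis (freq ?h j \<bullet> lattice_embed (sites y i))))\<^sup>2" for j and y :: "nat \<Rightarrow> int ^ 'd"
    have Qp: "real Q ^ CARD('d) > 0" using Q by simp
    have bound: "(\<Sum>j\<in>T. D j y) \<le> real Q ^ CARD('d) * (pairs n (sites y) + (real n)\<^sup>2 * indicator {y. real Q \<le> spread n y} y)" for y
    proof -
      have "(\<Sum>j\<in>T. D j y) \<le> (\<Sum>j\<in>grid Q. D j y)"
        using T by (intro sum_mono2) (auto simp: D_def)
      also have "\<dots> \<le> real Q ^ CARD('d) * (pairs n (sites y) + (real n)\<^sup>2 * indicator {y. real Q \<le> spread n y} y)"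
      proof (cases "real Q \<le> spread n y")
        case True
        have "D j y \<le> (real n)\<^sup>2" for j
        proof -
          have "cmod (\<Sum>i<n. cis (freq ?h j \<bullet> lattice_embed (sites y i))) \<le> (\<Sum>i<n. 1)"
            by (rule order_trans[OF norm_sum]) simp
          then show ?thesis unfolding D_def by (intro power_mono) auto
        qed
        then have "(\<Sum>j\<in>grid Q. D j y) \<le> (\<Sum>j\<in>grid Q. (real n)\<^sup>2)" by (intro sum_mono)
        also have "\<dots> = real Q ^ CARD('d) * (0 + (real n)\<^sup>2)" by (simp add: card_grid)
        also have "\<dots> \<le> real Q ^ CARD('d) * (pairs n (sites y) + (real n)\<^sup>2)"
          by (intro mult_left_mono add_right_mono pairs_nonneg) simp
        finally show ?thesis using True by simp
      next
        case False
        have small: "\<bar>(sites y a - sites y b) $ c\<bar> < int Q" if "a < n" "b < n" for a b c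
        proof -
          have "real_of_int \<bar>(sites y a - sites y b) $ c\<bar> < real_of_int (int Q)"
            using le_spread[OF that, of y c] False by simp
          then show ?thesis by (simp only: of_int_less_iff)
        qed
        have "(\<Sum>j\<in>grid Q. D j y) =
            (\<Sum>j\<in>grid Q. \<Sum>a<n. \<Sum>b<n. cos (freq ?h j \<bullet> lattice_embed (sites y a - sites y b)))"
          unfolding D_def norm_sum_cis_square by (simp add: lattice_embed_diff inner_diff_right)
        also have "\<dots> = (\<Sum>a<n. \<Sum>b<n. \<Sum>j\<in>grid Q. cos (freq ?h j \<bullet> lattice_embed (sites y a - sites y b)))"
          by (subst sum.swap, rule sum.cong[OF refl], rule sum.swap)
        also have "\<dots> = (\<Sum>a<n. \<Sum>b<n. real (Q ^ CARD('d)) * of_bool (sites y a - sites y b = 0))"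
          by (intro sum.cong refl sum_grid_cos small) auto
        also have "\<dots> = real Q ^ CARD('d) * pairs n (sites y)"
          unfolding pairs_def by (simp only: sum_distrib_left of_nat_power eq_iff_diff_eq_0[symmetric])
        finally show ?thesis using False by simp
      qed
      finally show ?thesis .
    qed
    have W: "{y. real Q \<le> spread n y} \<in> sets steps"
    proof -
      have "Measurable.pred steps (\<lambda>y. real Q \<le> spread n y)" by measurable
      then show ?thesis by (simp add: pred_def)
    qed
    have iD: "integrable steps (D j)" for j
      unfolding D_def by (rule expectation_trig_poly(2))
    have iW: "integrable steps (indicator {y. real Q \<le> spread n y} :: _ \<Rightarrow> real)"
      using W by (simp add: Y.emeasure_eq_measure)
    have "(\<Sum>j\<in>T. Re (toeplitz_sum n (phi (freq ?h j)))) = (\<Sum>j\<in>T. Y.expectation (D j))"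
      unfolding D_def expectation_trig_poly(1) ..
    also have "\<dots> = Y.expectation (\<lambda>y. \<Sum>j\<in>T. D j y)"
      by (rule Bochner_Integration.integral_sum[symmetric, OF iD])
    also have "\<dots> \<le> Y.expectation (\<lambda>y. real Q ^ CARD('d) * (pairs n (sites y) + (real n)\<^sup>2 * indicator {y. real Q \<le> spread n y} y))"
    proof (rule integral_mono[OF _ _ bound])
      show "integrable steps (\<lambda>y. \<Sum>j\<in>T. D j y)"
        by (rule Bochner_Integration.integrable_sum[OF iD])
      show "integrable steps (\<lambda>y. real Q ^ CARD('d) * (pairs n (sites y) + (real n)\<^sup>2 * indicator {y. real Q \<le> spread n y} y))"
        by (intro integrable_mult_right Bochner_Integration.integrable_add integrable_pairs iW)
    qed
    also have "\<dots> = real Q ^ CARD('d) * (mean_pairs n + (real n)\<^sup>2 * Y.prob {y. real Q \<le> spread n y})"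
      using iW by (simp add: integrable_pairs)
    also have "\<dots> \<le> real Q ^ CARD('d) * (mean_pairs n + 1)"
    proof (intro mult_left_mono add_left_mono)
      have "(real n)\<^sup>2 * Y.prob {y. real Q \<le> spread n y} \<le> (real n)\<^sup>2 * (1 / ((real n)\<^sup>2 + 1))"
        using Q0[of Q] Q by (intro mult_left_mono) auto
      also have "\<dots> \<le> 1" by (simp add: divide_simps add_nonneg_pos)
      finally show "(real n)\<^sup>2 * Y.prob {y. real Q \<le> spread n y} \<le> 1" .
    qed auto
    finally show "(\<Sum>j\<in>T. Re (toeplitz_sum n (phi (freq ?h j)))) / real Q ^ CARD('d) \<le>
        mean_pairs n + 1"
      using Qp by (simp add: field_simps)
  qed
qed

text \<open>The condition on \<open>n\<close> makes the 4 in the Poisson kernel bound at most half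
  of the main term; what is left is c n w / 2 over (C w)^2, with w = |u|^\<alpha>.\<close>

lemma toeplitz_phi_ge:
  assumes lo: "c * norm u powr \<alpha> \<le> 1 - (cmod (phi u))\<^sup>2" and up: "cmod (1 - phi u) \<le> C * norm u powr \<alpha>"
    and pos: "c > 0" "C > 0" "u \<noteq> 0" and n: "8 \<le> c * real n * norm u powr \<alpha>"
  shows "c / (2 * C\<^sup>2) * real n * norm u powr (- \<alpha>) \<le> Re (toeplitz_sum n (phi u))"
proof -
  define w where "w = norm u powr \<alpha>"
  have w: "w > 0" using pos by (simp add: w_def)
  have z: "phi u \<noteq> 1"
  proof
    assume "phi u = 1"
    with lo have "c * w \<le> 0" by (simp add: w_def)
    with w pos show False by (simp add: mult_le_0_iff)
  qed
  then have d: "cmod (1 - phi u) > 0" by simp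
  have "c / (2 * C\<^sup>2) * real n * norm u powr (- \<alpha>) = (c * real n * w / 2) / (C * w)\<^sup>2"
    using w pos by (simp add: powr_minus w_def[symmetric] power2_eq_square field_simps)
  also have "\<dots> \<le> (c * real n * w / 2) / (cmod (1 - phi u))\<^sup>2"
    using up d w pos by (intro divide_left_mono power_mono mult_pos_pos zero_less_power) (auto simp: w_def)
  also have "\<dots> \<le> (real n * (1 - (cmod (phi u))\<^sup>2) - 4) / (cmod (1 - phi u))\<^sup>2"
  proof (rule divide_right_mono)
    have "real n * (c * w) \<le> real n * (1 - (cmod (phi u))\<^sup>2)"
      using lo by (intro mult_left_mono) (auto simp: w_def)
    then show "c * real n * w / 2 \<le> real n * (1 - (cmod (phi u))\<^sup>2) - 4"
    proof -
      have "c * real n * w = real n * (c * w)" by simp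
      moreover have "8 \<le> c * real n * w" using n by (simp add: w_def)
      ultimately show ?thesis using \<open>real n * (c * w) \<le> _\<close> by linarith
    qed
  qed simp
  also have "\<dots> \<le> Re (toeplitz_sum n (phi u))"
    by (rule Re_toeplitz_sum_ge[OF norm_phi_le z])
  finally show ?thesis .
qed

text \<open>One face, in the positive orthant, of the sup-norm sphere of radius \<open>a\<close>: at
  least a^(d-1) indices of norm comparable to \<open>a\<close>. The coordinate \<open>i0\<close>
  keeps different radii disjoint.\<close>

definition slice :: "'d \<Rightarrow> nat \<Rightarrow> ('d \<Rightarrow> nat) set" where
  "slice i0 a = PiE UNIV (\<lambda>i. if i = i0 then {a} else {..a})"

lemma card_slice: "a ^ (CARD('d) - 1) \<le> card (slice i0 a)"
proof -
  have "card (slice i0 a) = (\<Prod>i\<in>UNIV. card (if i = i0 then {a} else {..a}))"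
    unfolding slice_def by (rule card_PiE) simp
  also have "\<dots> = (\<Prod>i\<in>UNIV - {i0}. Suc a)"
    by (subst prod.remove[of UNIV i0]) (auto intro!: prod.cong)
  also have "\<dots> = Suc a ^ (CARD('d) - 1)" by (simp add: card_Diff_singleton)
  finally show ?thesis by (simp add: power_mono)
qed

lemma finite_slice [simp]: "finite (slice i0 a)"
  unfolding slice_def by (intro finite_PiE) auto

lemma slice_subset_grid: "a < N \<Longrightarrow> slice i0 a \<subseteq> grid N"
  by (force simp: slice_def grid_def PiE_def Pi_def split: if_splits)

lemma slice_nth: "j \<in> slice i0 a \<Longrightarrow> j i0 = a" "j \<in> slice i0 a \<Longrightarrow> j i \<le> a"
  by (auto simp: slice_def PiE_def Pi_def split: if_splits dest!: spec[of _ i0] spec[of _ i])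

lemma norm_freq_slice:
  assumes "j \<in> slice i0 a" "h \<ge> 0"
  shows "h * real a \<le> norm (freq h j)" "norm (freq h j) \<le> h * (real CARD('d) * real a)"
proof -
  have "\<bar>freq h j $ i0\<bar> \<le> norm (freq h j)" by (rule component_le_norm_cart)
  then show "h * real a \<le> norm (freq h j)"
    using assms by (simp add: freq_def slice_nth(1) abs_mult)
  have "norm (freq h j) \<le> (\<Sum>i\<in>UNIV. \<bar>freq h j $ i\<bar>)" by (rule norm_le_l1_cart)
  also have "\<dots> \<le> (\<Sum>i\<in>(UNIV :: 'd set). h * real a)"
    using assms by (intro sum_mono) (auto simp: freq_def abs_mult slice_nth(2) intro!: mult_left_mono)
  finally show "norm (freq h j) \<le> h * (real CARD('d) * real a)" by (simp add: mult_ac)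
qed

text \<open>A radial Riemann sum for n times the integral of |u|^(-\<alpha>): the slice of radius a
  has at least a^(d-1) points, each contributing at least of order n (a / Q)^(-\<alpha>), and the
  torus has Q^d. \<open>J1\<close> keeps frequencies large enough for the main term to dominate,
  \<open>J2\<close> small enough for \<open>phi\<close> to be controlled.\<close>

lemma expectation_pairs_ge_sum:
  assumes reg: "phi_regular \<alpha> \<delta> c C" and a: "0 < \<alpha>"
  shows "\<exists>c'>0. \<forall>n. \<exists>Q0. \<forall>Q\<ge>Q0. \<forall>J1 J2. 0 < J1 \<longrightarrow> J2 < Q \<longrightarrow>
    8 \<le> c * real n * (2 * pi * real J1 / real Q) powr \<alpha> \<longrightarrow>
    2 * pi * real CARD('d) * real J2 / real Q \<le> \<delta> \<longrightarrow>
    c' * real n * (\<Sum>a=J1..J2. real a powr (real CARD('d) - 1 - \<alpha>) * real Q powr (\<alpha> - real CARD('d))) \<le>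
      mean_pairs n + 1"
proof -
  note lo = phi_regularD(5)[OF reg] and up = phi_regularD(6)[OF reg]
    and pos = phi_regularD(1,3,4)[OF reg] a
  define d where "d = real CARD('d)"
  have d: "d \<ge> 1" unfolding d_def by (simp add: Suc_le_eq)
  define c1 where "c1 = c / (2 * C\<^sup>2)"
  have c1: "c1 > 0" using pos by (simp add: c1_def)
  define c' where "c' = c1 * (2 * pi * d) powr (- \<alpha>)"
  have c': "c' > 0" using c1 d by (simp add: c'_def)
  have "\<exists>Q0. \<forall>Q\<ge>Q0. \<forall>J1 J2. 0 < J1 \<longrightarrow> J2 < Q \<longrightarrow>
    8 \<le> c * real n * (2 * pi * real J1 / real Q) powr \<alpha> \<longrightarrow>
    2 * pi * d * real J2 / real Q \<le> \<delta> \<longrightarrow>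
    c' * real n * (\<Sum>a=J1..J2. real a powr (d - 1 - \<alpha>) * real Q powr (\<alpha> - d)) \<le>
      mean_pairs n + 1" for n
  proof -
    obtain Q0 where Q0: "\<And>Q T. Q \<ge> Q0 \<Longrightarrow> T \<subseteq> grid Q \<Longrightarrow>
        (\<Sum>j\<in>T. Re (toeplitz_sum n (phi (freq (2 * pi / real Q) j)))) / real Q ^ CARD('d) \<le>
        mean_pairs n + 1"
      using expectation_pairs_ge_grid[of n] by blast
    show ?thesis
    proof (intro exI[of _ Q0] allI impI)
      fix Q J1 J2 :: nat
      assume Q: "Q0 \<le> Q" and J: "0 < J1" "J2 < Q"
        and J1: "8 \<le> c * real n * (2 * pi * real J1 / real Q) powr \<alpha>"
        and J2: "2 * pi * d * real J2 / real Q \<le> \<delta>"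
      define h where "h = 2 * pi / real Q"
      have Qp: "Q > 0" using J by simp
      have h: "h > 0" using Qp by (simp add: h_def)
      \<comment> \<open>An arbitrary coordinate direction.\<close>
      define i0 :: 'd where "i0 = undefined"
      define F where "F j = Re (toeplitz_sum n (phi (freq h j)))" for j
      have F: "c1 * real n * (h * (d * real a)) powr (- \<alpha>) \<le> F j" if a: "a \<in> {J1..J2}" and j: "j \<in> slice i0 a" for a j
      proof -
        note nf = norm_freq_slice[OF j less_imp_le[OF h], folded d_def]
        have a0: "a > 0" using a J by auto
        then have ha: "0 < h * real a" using h by simp
        with nf have nz: "freq h j \<noteq> 0" by auto
        have "h * (d * real a) \<le> h * (d * real J2)" using a h d by (intro mult_left_mono) auto
        also have "\<dots> \<le> \<delta>" using J2 by (simp add: h_def mult_ac)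
        finally have nd: "norm (freq h j) \<le> \<delta>" using nf(2) by simp
        have "(2 * pi * real J1 / real Q) powr \<alpha> \<le> norm (freq h j) powr \<alpha>"
        proof (rule powr_mono2)
          have "2 * pi * real J1 / real Q = h * real J1" by (simp add: h_def)
          also have "\<dots> \<le> h * real a" using a h by (intro mult_left_mono) auto
          finally show "2 * pi * real J1 / real Q \<le> norm (freq h j)" using nf(1) by simp
        qed (use pos in auto)
        then have "c * real n * (2 * pi * real J1 / real Q) powr \<alpha> \<le> c * real n * norm (freq h j) powr \<alpha>"
          using pos by (intro mult_left_mono) auto
        with J1 have n8: "8 \<le> c * real n * norm (freq h j) powr \<alpha>" by simp
        have "c1 * real n * (h * (d * real a)) powr (- \<alpha>) \<le> c1 * real n * norm (freq h j) powr (- \<alpha>)"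
          using nf(2) nz pos c1 by (intro mult_left_mono powr_mono2') auto
        also have "\<dots> \<le> F j"
          unfolding c1_def F_def by (rule toeplitz_phi_ge[OF lo[OF nd] up[OF nd] pos(2,3) nz n8])
        finally show ?thesis .
      qed
      let ?T = "\<Union>a\<in>{J1..J2}. slice i0 a"
      have T: "?T \<subseteq> grid Q" using J by (intro UN_least slice_subset_grid) auto
      have "c' * real n * (\<Sum>a=J1..J2. real a powr (d - 1 - \<alpha>) * real Q powr (\<alpha> - d)) =
          (\<Sum>a=J1..J2. c' * real n * (real a powr (d - 1 - \<alpha>) * real Q powr (\<alpha> - d)))"
        by (simp add: sum_distrib_left)
      also have "\<dots> \<le> (\<Sum>a=J1..J2. (\<Sum>j\<in>slice i0 a. F j) / real Q ^ CARD('d))"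
      proof (rule sum_mono)
        fix a assume a: "a \<in> {J1..J2}"
        then have a0: "real a > 0" using J by auto
        have "real a powr (d - 1) = real a ^ (CARD('d) - 1)"
          using a0 unfolding d_def by (subst powr_realpow[symmetric]) (auto simp: of_nat_diff Suc_le_eq)
        also have "\<dots> \<le> real (card (slice i0 a))"
          using card_slice[of a i0] by (metis of_nat_le_iff of_nat_power)
        finally have card: "real a powr (d - 1) \<le> real (card (slice i0 a))" .
        have "real Q powr d = real Q ^ CARD('d)" using Qp unfolding d_def by (simp add: powr_realpow)
        have "c' * real n * (real a powr (d - 1 - \<alpha>) * real Q powr (\<alpha> - d)) =
            real a powr (d - 1) * (c1 * real n * (h * (d * real a)) powr (- \<alpha>)) / real Q powr d"
        proof -
          have "h * (d * real a) = (2 * pi * d) * real a / real Q" by (simp add: h_def)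
          then have "(h * (d * real a)) powr (- \<alpha>) = (2 * pi * d) powr (- \<alpha>) * real a powr (- \<alpha>) / real Q powr (- \<alpha>)"
            using d a0 Qp by (simp add: powr_mult powr_divide)
          then have e: "(h * (d * real a)) powr (- \<alpha>) = (2 * pi * d) powr (- \<alpha>) * real a powr (- \<alpha>) * real Q powr \<alpha>"
            by (simp add: powr_minus_divide)
          have "real a powr (d - 1 - \<alpha>) = real a powr (d - 1) * real a powr (- \<alpha>)"
            by (simp add: powr_add[symmetric])
          moreover have "real Q powr (\<alpha> - d) = real Q powr \<alpha> / real Q powr d"
            using Qp by (simp add: powr_diff)
          ultimately show ?thesis unfolding e c'_def by simp
        qed
        also have "\<dots> \<le> real (card (slice i0 a)) * (c1 * real n * (h * (d * real a)) powr (- \<alpha>)) / real Q powr d"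
          using card c1 by (intro divide_right_mono mult_right_mono) auto
        also have "\<dots> = (\<Sum>j\<in>slice i0 a. c1 * real n * (h * (d * real a)) powr (- \<alpha>)) / real Q powr d"
          by simp
        also have "\<dots> \<le> (\<Sum>j\<in>slice i0 a. F j) / real Q powr d"
          by (intro divide_right_mono sum_mono F a) auto
        finally show "c' * real n * (real a powr (d - 1 - \<alpha>) * real Q powr (\<alpha> - d)) \<le>
            (\<Sum>j\<in>slice i0 a. F j) / real Q ^ CARD('d)"
          using \<open>real Q powr d = real Q ^ CARD('d)\<close> by simp
      qed
      also have "\<dots> = (\<Sum>j\<in>?T. F j) / real Q ^ CARD('d)"
        unfolding sum_divide_distrib[symmetric]
        by (subst sum.UNION_disjoint) (auto dest: slice_nth(1))
      also have "\<dots> \<le> mean_pairs n + 1"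
        unfolding F_def h_def by (rule Q0[OF Q T])
      finally show "c' * real n * (\<Sum>a=J1..J2. real a powr (d - 1 - \<alpha>) * real Q powr (\<alpha> - d)) \<le>
          mean_pairs n + 1" .
    qed
  qed
  with c' show ?thesis unfolding d_def by blast
qed

lemma expectation_pairs_ge_self: "real n \<le> mean_pairs n"
  using Y.integral_ge_const[OF integrable_pairs, of "real n" n] by (auto simp: pairs_ge_self)

text \<open>A choice of admissible parameters: \<rho> is the smallest usable frequency,
  \<open>Q\<close> is of order J1 / \<rho>, and \<open>J2\<close> is the last index whose frequency
  stays below \<delta>. The additive 1 disappears into the factor 2, since the mean of V_n is at
  least n \<ge> 1.\<close>

lemma expectation_pairs_ge_block:
  assumes reg: "phi_regular \<alpha> \<delta> c C" and a: "0 < \<alpha>"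
  shows "\<exists>c'>0. \<forall>n\<ge>1. \<exists>J1 J2 Q. 0 < J1 \<and> 0 < Q \<and>
    pi / (8 / (c * real n)) powr (1 / \<alpha>) \<le> real Q / real J1 \<and>
    \<delta> * real Q / (2 * pi * real CARD('d)) \<le> real (Suc J2) \<and>
    c' * real n * (\<Sum>a=J1..J2. real a powr (real CARD('d) - 1 - \<alpha>) * real Q powr (\<alpha> - real CARD('d))) \<le>
      2 * mean_pairs n"
proof -
  note pos = phi_regularD(1-4)[OF reg] a
  define d where "d = real CARD('d)"
  have d: "d \<ge> 1" unfolding d_def by (simp add: Suc_le_eq)
  obtain c' where c': "c' > 0" and main: "\<And>n. \<exists>Q0. \<forall>Q\<ge>Q0. \<forall>J1 J2. 0 < J1 \<longrightarrow> J2 < Q \<longrightarrow>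
    8 \<le> c * real n * (2 * pi * real J1 / real Q) powr \<alpha> \<longrightarrow>
    2 * pi * d * real J2 / real Q \<le> \<delta> \<longrightarrow>
    c' * real n * (\<Sum>a=J1..J2. real a powr (d - 1 - \<alpha>) * real Q powr (\<alpha> - d)) \<le>
      mean_pairs n + 1"
    using expectation_pairs_ge_sum[OF reg a, folded d_def] by blast
  show ?thesis unfolding d_def[symmetric]
  proof (intro exI[of _ c'] conjI allI impI c')
    fix n :: nat assume n: "n \<ge> 1"
    obtain Q0 where Q0: "\<And>Q J1 J2. Q0 \<le> Q \<Longrightarrow> 0 < J1 \<Longrightarrow> J2 < Q \<Longrightarrow>
      8 \<le> c * real n * (2 * pi * real J1 / real Q) powr \<alpha> \<Longrightarrow>
      2 * pi * d * real J2 / real Q \<le> \<delta> \<Longrightarrow>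
      c' * real n * (\<Sum>a=J1..J2. real a powr (d - 1 - \<alpha>) * real Q powr (\<alpha> - d)) \<le>
        mean_pairs n + 1"
      using main[of n] by blast
    define \<rho> where "\<rho> = (8 / (c * real n)) powr (1 / \<alpha>)"
    have r: "\<rho> > 0" using pos n by (simp add: \<rho>_def)
    have r\<alpha>: "c * real n * \<rho> powr \<alpha> = 8" using pos n by (simp add: \<rho>_def powr_powr)
    \<comment> \<open>\<open>Q\<close> is proportional to \<open>J1\<close>, so a large
      \<open>J1\<close> forces \<open>Q\<close> beyond \<open>Q0\<close>; rounding down still leaves
      at least half of 2 pi J1 / \<rho>.\<close>
    obtain J1 :: nat where J1: "(real Q0 + 1) * \<rho> / pi + \<rho> / pi + 1 \<le> real J1"
      using real_arch_simple by blast
    have "0 < (real Q0 + 1) * \<rho> / pi" "0 < \<rho> / pi" using r by auto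
    then have J1': "real J1 \<ge> 1" "\<rho> / pi \<le> real J1" "(real Q0 + 1) * \<rho> / pi \<le> real J1"
      using J1 by linarith+
    define Q where "Q = nat \<lfloor>2 * pi * real J1 / \<rho>\<rfloor>"
    have x1: "1 \<le> pi * real J1 / \<rho>" using J1'(2) r by (simp add: field_simps)
    have x2: "real Q0 + 1 \<le> pi * real J1 / \<rho>" using J1'(3) r by (simp add: field_simps)
    have "real Q \<le> 2 * pi * real J1 / \<rho>" "2 * pi * real J1 / \<rho> < real Q + 1"
      using x1 unfolding Q_def by linarith+
    then have Q: "real Q \<le> 2 * pi * real J1 / \<rho>" "pi * real J1 / \<rho> \<le> real Q" "real Q0 \<le> real Q" "1 \<le> real Q"
      using x1 x2 by linarith+
    define J2 where "J2 = nat \<lfloor>\<delta> * real Q / (2 * pi * d)\<rfloor>"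
    have J2: "real J2 \<le> \<delta> * real Q / (2 * pi * d)" "\<delta> * real Q / (2 * pi * d) \<le> real (Suc J2)"
      using pos d unfolding J2_def by (auto simp: of_nat_floor) linarith
    have pd: "1 * 1 < (2 * pi) * d" using d pi_gt3 by (intro mult_less_le_imp_less) auto
    have "real J2 * (2 * pi * d) \<le> \<delta> * real Q" using J2(1) pd by (simp add: field_simps)
    have "real J2 < real Q"
    proof -
      have "\<delta> * real Q / (2 * pi * d) \<le> 1 * real Q / (2 * pi * d)"
        using pos d by (intro divide_right_mono mult_right_mono) auto
      also have "\<dots> < real Q" using pd Q by (simp add: field_simps)
      finally show ?thesis using J2(1) by simp
    qed
    then have J2Q: "J2 < Q" by simp
    have "\<rho> \<le> 2 * pi * real J1 / real Q" using Q r by (simp add: field_simps)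
    then have "\<rho> powr \<alpha> \<le> (2 * pi * real J1 / real Q) powr \<alpha>" using r pos by (intro powr_mono2) auto
    then have h8: "8 \<le> c * real n * (2 * pi * real J1 / real Q) powr \<alpha>"
      using r\<alpha> pos n mult_left_mono[of "\<rho> powr \<alpha>" _ "c * real n"] by simp
    have hd: "2 * pi * d * real J2 / real Q \<le> \<delta>"
      using \<open>real J2 * (2 * pi * d) \<le> \<delta> * real Q\<close> Q by (simp add: field_simps)
    have "c' * real n * (\<Sum>a=J1..J2. real a powr (d - 1 - \<alpha>) * real Q powr (\<alpha> - d)) \<le>
        mean_pairs n + 1"
      using Q(3) J1'(1) by (intro Q0 J2Q h8 hd) auto
    also have "\<dots> \<le> 2 * mean_pairs n"
      using expectation_pairs_ge_self[of n] n by simp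
    finally have fin: "c' * real n * (\<Sum>a=J1..J2. real a powr (d - 1 - \<alpha>) * real Q powr (\<alpha> - d)) \<le>
        2 * mean_pairs n" .
    have "pi / \<rho> \<le> real Q / real J1" using Q(2) J1' r by (simp add: field_simps)
    then show "\<exists>J1 J2 Q. 0 < J1 \<and> 0 < Q \<and>
      pi / (8 / (c * real n)) powr (1 / \<alpha>) \<le> real Q / real J1 \<and>
      \<delta> * real Q / (2 * pi * d) \<le> real (Suc J2) \<and>
      c' * real n * (\<Sum>a=J1..J2. real a powr (d - 1 - \<alpha>) * real Q powr (\<alpha> - d)) \<le>
        2 * mean_pairs n"
      using fin J2(2) J1'(1) Q(4) by (intro exI[of _ J1] exI[of _ J2] exI[of _ Q]) (auto simp: \<rho>_def)
  qed
qed

section \<open>Lower bounds on the Green function\<close>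

text \<open>For \<alpha> = d the radial weights are 1 / a, and their sum is at least the logarithm
  of (J2 + 1) / J1, a ratio not below a multiple of n^(1/\<alpha>). The bound passes to
  \<open>green n\<close> because the mean of V_n is at most 2 n \<open>green n\<close>.\<close>

lemma green_ge_log:
  assumes reg: "phi_regular \<alpha> \<delta> c C" and \<alpha>: "\<alpha> = real CARD('d)"
  shows "\<exists>k>0. \<forall>n\<ge>1. k * ln (real n) \<le> green n"
proof -
  note pos = phi_regularD(1-4)[OF reg]
  define d where "d = real CARD('d)"
  have d: "d \<ge> 1" unfolding d_def by (simp add: Suc_le_eq)
  have a: "0 < \<alpha>" using d \<alpha> by (simp add: d_def)
  obtain c' where c': "c' > 0" and main: "\<And>n. n \<ge> 1 \<Longrightarrow> \<exists>J1 J2 Q. 0 < J1 \<and> 0 < Q \<and>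
    pi / (8 / (c * real n)) powr (1 / \<alpha>) \<le> real Q / real J1 \<and>
    \<delta> * real Q / (2 * pi * d) \<le> real (Suc J2) \<and>
    c' * real n * (\<Sum>a=J1..J2. real a powr (d - 1 - \<alpha>) * real Q powr (\<alpha> - d)) \<le>
      2 * mean_pairs n"
    using expectation_pairs_ge_block[OF reg a, folded d_def] by blast
  \<comment> \<open>The additive constant in the logarithm, absorbed at the end by
    \<open>green n \<ge> 1\<close>.\<close>
  define K where "K = \<bar>ln (\<delta> / (2 * d)) + ln (c / 8) / \<alpha>\<bar>"
  define k where "k = c' / \<alpha> / (4 + c' * K)"
  have den: "4 + c' * K > 0" using c' by (simp add: K_def add_pos_nonneg)
  have k: "k > 0" using c' a den by (simp add: k_def)
  have "k * ln (real n) \<le> green n" if n: "n \<ge> 1" for n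
  proof -
    define \<rho> where "\<rho> = (8 / (c * real n)) powr (1 / \<alpha>)"
    have r: "\<rho> > 0" using pos n by (simp add: \<rho>_def)
    obtain J1 J2 Q where J: "0 < J1" "0 < Q" and q: "pi / \<rho> \<le> real Q / real J1"
      and j2: "\<delta> * real Q / (2 * pi * d) \<le> real (Suc J2)"
      and sum: "c' * real n * (\<Sum>a=J1..J2. real a powr (d - 1 - \<alpha>) * real Q powr (\<alpha> - d)) \<le>
        2 * mean_pairs n"
      using main[OF n] unfolding \<rho>_def by blast
    have "\<delta> / (2 * d * \<rho>) = \<delta> / (2 * pi * d) * (pi / \<rho>)" by simp
    also have "\<dots> \<le> \<delta> / (2 * pi * d) * (real Q / real J1)"
      using q pos d by (intro mult_left_mono) auto
    also have "\<dots> \<le> real (Suc J2) / real J1"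
      using divide_right_mono[OF j2, of "real J1"] by simp
    finally have ratio: "\<delta> / (2 * d * \<rho>) \<le> real (Suc J2) / real J1" .
    have ln\<rho>: "ln \<rho> = - (ln (c / 8) + ln (real n)) / \<alpha>"
      using pos n by (simp add: \<rho>_def ln_powr ln_div ln_mult field_simps)
    have "ln (\<delta> / (2 * d * \<rho>)) = ln (\<delta> / (2 * d)) - ln \<rho>"
      using pos d r by (simp add: ln_div ln_mult)
    also have "\<dots> = (ln (\<delta> / (2 * d)) + ln (c / 8) / \<alpha>) + ln (real n) / \<alpha>"
      unfolding ln\<rho> by (simp add: add_divide_distrib diff_divide_distrib)
    finally have "ln (real n) / \<alpha> - K \<le> ln (\<delta> / (2 * d * \<rho>))" unfolding K_def by linarith
    also have "\<dots> \<le> ln (real (Suc J2) / real J1)"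
      using ratio pos d r by (intro ln_mono) auto
    also have "\<dots> \<le> (\<Sum>a=J1..J2. 1 / real a)" by (rule ln_le_sum_inverse[OF J(1)])
    also have "\<dots> = (\<Sum>a=J1..J2. real a powr (d - 1 - \<alpha>) * real Q powr (\<alpha> - d))"
      using J by (intro sum.cong) (auto simp: \<alpha> d_def powr_minus_divide)
    finally have "c' * real n * (ln (real n) / \<alpha> - K) \<le>
        c' * real n * (\<Sum>a=J1..J2. real a powr (d - 1 - \<alpha>) * real Q powr (\<alpha> - d))"
      using c' by (intro mult_left_mono) auto
    also have "\<dots> \<le> 2 * (2 * real n * green n)"
      using sum expectation_pairs_le[of n] by linarith
    finally have "real n * (c' * (ln (real n) / \<alpha> - K)) \<le> real n * (4 * green n)"
      by (simp add: mult_ac)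
    then have "c' * (ln (real n) / \<alpha> - K) \<le> 4 * green n" using n by simp
    moreover have "c' * K * 1 \<le> c' * K * green n"
      using c' green_ge_1[of n] by (intro mult_left_mono) (auto simp: K_def)
    ultimately have "c' / \<alpha> * ln (real n) \<le> (4 + c' * K) * green n"
      by (simp add: right_diff_distrib distrib_right)
    then have "c' / \<alpha> * ln (real n) / (4 + c' * K) \<le> green n"
      using den by (simp only: pos_divide_le_eq mult.commute[of "green n"])
    then show ?thesis by (simp add: k_def)
  qed
  with k show ?thesis by blast
qed

text \<open>The block of indices from J1 to 2 J1 is enough: it contributes at least of order (Q /
  J1)^(\<alpha> - 1), that is a multiple of n^(1 - 1/\<alpha>).\<close>

lemma green_ge_powr:
  assumes reg: "phi_regular \<alpha> \<delta> c C" and \<alpha>: "1 < \<alpha>" and d1: "CARD('d) = 1"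
  shows "\<exists>k>0. \<forall>n\<ge>1. k * real n powr (1 - 1 / \<alpha>) \<le> green n"
proof -
  note pos = phi_regularD(1-4)[OF reg]
  have a: "0 < \<alpha>" using \<alpha> by simp
  obtain c' where c': "c' > 0" and main: "\<And>n. n \<ge> 1 \<Longrightarrow> \<exists>J1 J2 Q. 0 < J1 \<and> 0 < Q \<and>
    pi / (8 / (c * real n)) powr (1 / \<alpha>) \<le> real Q / real J1 \<and>
    \<delta> * real Q / (2 * pi) \<le> real (Suc J2) \<and>
    c' * real n * (\<Sum>a=J1..J2. real a powr (- \<alpha>) * real Q powr (\<alpha> - 1)) \<le>
      2 * mean_pairs n"
    using expectation_pairs_ge_block[OF reg a] by (auto simp: d1)
  \<comment> \<open>Beyond \<open>n0\<close> one has \<rho> \<le> \<delta> / 4, so the block fits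
    below \<open>J2\<close>; smaller \<open>n\<close> are covered by \<open>green n \<ge> 1\<close>
    through \<open>k2\<close>.\<close>
  define n0 where "n0 = max 1 (8 / c * (4 / \<delta>) powr \<alpha>)"
  define k1 where "k1 = c' / 4 * 2 powr (- \<alpha>) * (pi * (c / 8) powr (1 / \<alpha>)) powr (\<alpha> - 1)"
  define k2 where "k2 = n0 powr (- (1 - 1 / \<alpha>))"
  have k: "k1 > 0" "k2 > 0" using c' pos by (auto simp: k1_def k2_def n0_def)
  have e: "0 < 1 - 1 / \<alpha>" using \<alpha> by simp
  have "min k1 k2 * real n powr (1 - 1 / \<alpha>) \<le> green n" if n: "n \<ge> 1" for n
  proof (cases "real n \<le> n0")
    case True
    have "min k1 k2 * real n powr (1 - 1 / \<alpha>) \<le> k2 * n0 powr (1 - 1 / \<alpha>)"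
      using k True e by (intro mult_mono powr_mono2) auto
    also have "\<dots> = 1" by (simp add: k2_def n0_def powr_add[symmetric])
    also have "\<dots> \<le> green n" by (rule green_ge_1)
    finally show ?thesis .
  next
    case False
    define \<rho> where "\<rho> = (8 / (c * real n)) powr (1 / \<alpha>)"
    have r: "\<rho> > 0" using pos n by (simp add: \<rho>_def)
    obtain J1 J2 Q where J: "0 < J1" "0 < Q" and q: "pi / \<rho> \<le> real Q / real J1"
      and j2: "\<delta> * real Q / (2 * pi) \<le> real (Suc J2)"
      and sum: "c' * real n * (\<Sum>a=J1..J2. real a powr (- \<alpha>) * real Q powr (\<alpha> - 1)) \<le>
        2 * mean_pairs n"
      using main[OF n] unfolding \<rho>_def by blast
    have "8 / c * (4 / \<delta>) powr \<alpha> \<le> real n" using False by (simp add: n0_def)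
    then have "8 / (c * real n) \<le> (\<delta> / 4) powr \<alpha>"
      using pos n by (simp add: powr_divide field_simps)
    then have "\<rho> \<le> ((\<delta> / 4) powr \<alpha>) powr (1 / \<alpha>)"
      unfolding \<rho>_def using pos a by (intro powr_mono2) auto
    then have r4: "\<rho> \<le> \<delta> / 4" using pos a by (simp add: powr_powr)
    have "2 * real J1 \<le> \<delta> / (2 * \<rho>) * real J1"
      using r4 r by (intro mult_right_mono) (auto simp: field_simps)
    also have "\<dots> \<le> \<delta> * real Q / (2 * pi)"
    proof -
      have "real J1 / \<rho> \<le> real Q / pi" using q J r by (simp add: field_simps)
      then have "\<delta> / 2 * (real J1 / \<rho>) \<le> \<delta> / 2 * (real Q / pi)" using pos by (intro mult_left_mono) auto
      then show ?thesis by simp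
    qed
    finally have "2 * J1 \<le> Suc J2" using j2 by linarith
    then have sub: "{J1..<2 * J1} \<subseteq> {J1..J2}" by auto
    have "real J1 * ((2 * real J1) powr (- \<alpha>) * real Q powr (\<alpha> - 1)) =
        (\<Sum>a=J1..<2 * J1. (2 * real J1) powr (- \<alpha>) * real Q powr (\<alpha> - 1))" by simp
    also have "\<dots> \<le> (\<Sum>a=J1..<2 * J1. real a powr (- \<alpha>) * real Q powr (\<alpha> - 1))"
      using J a by (intro sum_mono mult_right_mono powr_mono2') auto
    also have "\<dots> \<le> (\<Sum>a=J1..J2. real a powr (- \<alpha>) * real Q powr (\<alpha> - 1))"
      using sub by (intro sum_mono2) auto
    finally have s1: "real J1 * ((2 * real J1) powr (- \<alpha>) * real Q powr (\<alpha> - 1)) \<le>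
      (\<Sum>a=J1..J2. real a powr (- \<alpha>) * real Q powr (\<alpha> - 1))" .
    have eq: "real J1 * ((2 * real J1) powr (- \<alpha>) * real Q powr (\<alpha> - 1)) =
        2 powr (- \<alpha>) * (real Q / real J1) powr (\<alpha> - 1)"
    proof -
      have "real J1 powr (\<alpha> - 1) = real J1 powr \<alpha> / real J1" using J by (simp add: powr_diff)
      then show ?thesis using J by (simp add: powr_mult powr_divide powr_minus_divide)
    qed
    have "pi / \<rho> = (pi * (c / 8) powr (1 / \<alpha>)) * real n powr (1 / \<alpha>)"
      using pos n by (simp add: \<rho>_def powr_divide powr_mult)
    then have "(pi / \<rho>) powr (\<alpha> - 1) = (pi * (c / 8) powr (1 / \<alpha>)) powr (\<alpha> - 1) * (real n powr (1 / \<alpha>)) powr (\<alpha> - 1)"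
      using pos by (simp add: powr_mult)
    also have "(real n powr (1 / \<alpha>)) powr (\<alpha> - 1) = real n powr (1 - 1 / \<alpha>)"
      unfolding powr_powr using a by (simp add: diff_divide_distrib)
    finally have pr: "(pi / \<rho>) powr (\<alpha> - 1) =
        (pi * (c / 8) powr (1 / \<alpha>)) powr (\<alpha> - 1) * real n powr (1 - 1 / \<alpha>)" .
    have "4 * real n * (k1 * real n powr (1 - 1 / \<alpha>)) = c' * real n * (2 powr (- \<alpha>) * (pi / \<rho>) powr (\<alpha> - 1))"
      unfolding pr k1_def by simp
    also have "\<dots> \<le> c' * real n * (2 powr (- \<alpha>) * (real Q / real J1) powr (\<alpha> - 1))"
      using c' q r \<alpha> by (intro mult_left_mono powr_mono2) auto
    also have "\<dots> \<le> c' * real n * (\<Sum>a=J1..J2. real a powr (- \<alpha>) * real Q powr (\<alpha> - 1))"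
      using s1 c' unfolding eq by (intro mult_left_mono) auto
    also have "\<dots> \<le> 4 * real n * green n"
      using sum expectation_pairs_le[of n] by linarith
    finally have "k1 * real n powr (1 - 1 / \<alpha>) \<le> green n" using n by simp
    moreover have "min k1 k2 * real n powr (1 - 1 / \<alpha>) \<le> k1 * real n powr (1 - 1 / \<alpha>)"
      by (intro mult_right_mono) auto
    ultimately show ?thesis by simp
  qed
  with k show ?thesis by (intro exI[of _ "min k1 k2"]) auto
qed

end

section \<open>The characteristic function near the origin\<close>

lemma measurable_cis [measurable]: "cis \<in> borel_measurable borel"
  unfolding cis_conv_exp by measurable

lemma norm_cis_diff_le: "cmod (cis a - cis b) \<le> 2 * min 1 \<bar>a - b\<bar>"
proof -
  have "cis a - cis b = cis b * (iexp (a - b) - 1)"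
    unfolding cis_conv_exp[symmetric] by (simp add: right_diff_distrib cis_mult)
  then have "cmod (cis a - cis b) = cmod (iexp (a - b) - 1)" by (simp add: norm_mult)
  also have "\<dots> \<le> \<bar>a - b\<bar>" using iexp_approx1[of "a - b" 0] by simp
  finally have "cmod (cis a - cis b) \<le> \<bar>a - b\<bar>" .
  moreover have "cmod (cis a - cis b) \<le> 2" using norm_triangle_ineq4[of "cis a" "cis b"] by simp
  moreover have "\<bar>a - b\<bar> \<le> 2 * \<bar>a - b\<bar>" by simp
  ultimately show ?thesis by (cases "1 \<le> \<bar>a - b\<bar>") (auto simp only: min_def if_True if_False mult_1_right intro: order_trans)
qed

text \<open>Equality in the triangle inequality: 1 - Re (cnj \<zeta> f) is nonnegative with mean 0,
  and where it vanishes f equals \<zeta>.\<close>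

lemma (in prob_space) AE_eq_expectation_of_unimodular:
  fixes f :: "'a \<Rightarrow> complex"
  assumes [measurable]: "f \<in> borel_measurable M" and f: "\<And>x. cmod (f x) = 1"
    and E: "cmod (expectation f) = 1"
  shows "AE x in M. f x = expectation f"
proof -
  define \<zeta> where "\<zeta> = expectation f"
  have int: "integrable M f" by (rule integrable_const_bound[where B = 1]) (auto simp: f)
  have "expectation (\<lambda>x. Re (cnj \<zeta> * f x)) = Re (cnj \<zeta> * \<zeta>)"
    using int by (simp add: \<zeta>_def)
  also have "cnj \<zeta> * \<zeta> = 1"
    using E by (simp add: \<zeta>_def complex_norm_square[symmetric] mult.commute[of "cnj _"])
  finally have E0: "expectation (\<lambda>x. 1 - Re (cnj \<zeta> * f x)) = 0"
    using int by (simp add: prob_space)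
  have nn: "0 \<le> 1 - Re (cnj \<zeta> * f x)" for x
    using complex_Re_le_cmod[of "cnj \<zeta> * f x"] E f by (simp add: norm_mult \<zeta>_def)
  have int': "integrable M (\<lambda>x. 1 - Re (cnj \<zeta> * f x))"
    using int by (intro Bochner_Integration.integrable_diff integrable_Re integrable_mult_right) auto
  have "AE x in M. 1 - Re (cnj \<zeta> * f x) = 0"
    by (rule iffD1[OF integral_nonneg_eq_0_iff_AE[OF int' AE_I2[OF nn]] E0])
  then show ?thesis
  proof eventually_elim
    case (elim x)
    have "(cmod (f x - \<zeta>))\<^sup>2 = (cmod (f x))\<^sup>2 + (cmod \<zeta>)\<^sup>2 - 2 * Re (cnj \<zeta> * f x)"
      unfolding cmod_power2 by (simp add: power2_eq_square algebra_simps)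
    then have "(cmod (f x - \<zeta>))\<^sup>2 = 0" using elim E f[of x] by (simp add: \<zeta>_def)
    then show ?case by (simp add: \<zeta>_def)
  qed
qed

lemma (in prob_space) AE_ex: "AE x in M. P x \<Longrightarrow> \<exists>x. P x"
proof (rule ccontr)
  assume "AE x in M. P x" "\<nexists>x. P x"
  then have "AE x in M. False" by simp
  then show False by simp
qed

text \<open>The truncation at 1 allows dominated convergence for every measurable
  \<open>g\<close>.\<close>

lemma (in prob_space) expectation_min_small:
  assumes [measurable]: "g \<in> borel_measurable M" and e: "\<epsilon> > 0"
  shows "\<exists>s>0. expectation (\<lambda>x. min 1 (s * \<bar>g x\<bar>)) \<le> (\<epsilon> :: real)"
proof -
  have "(\<lambda>k. expectation (\<lambda>x. min 1 (inverse (real (Suc k)) * \<bar>g x\<bar>))) \<longlonglongrightarrow> expectation (\<lambda>x. 0)"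
  proof (rule integral_dominated_convergence[where w = "\<lambda>x. 1"])
    show "AE x in M. (\<lambda>k. min 1 (inverse (real (Suc k)) * \<bar>g x\<bar>)) \<longlonglongrightarrow> 0"
    proof (intro AE_I2)
      fix x
      have "(\<lambda>k. min 1 (inverse (real (Suc k)) * \<bar>g x\<bar>)) \<longlonglongrightarrow> min 1 (0 * \<bar>g x\<bar>)"
        by (intro tendsto_intros LIMSEQ_inverse_real_of_nat)
      then show "(\<lambda>k. min 1 (inverse (real (Suc k)) * \<bar>g x\<bar>)) \<longlonglongrightarrow> 0" by simp
    qed
  qed (auto simp: min_def)
  then have "(\<lambda>k. expectation (\<lambda>x. min 1 (inverse (real (Suc k)) * \<bar>g x\<bar>))) \<longlonglongrightarrow> 0" by simp
  then have "\<forall>\<^sub>F k in sequentially. expectation (\<lambda>x. min 1 (inverse (real (Suc k)) * \<bar>g x\<bar>)) < \<epsilon>"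
    using e by (rule order_tendstoD)
  then obtain k where k: "expectation (\<lambda>x. min 1 (inverse (real (Suc k)) * \<bar>g x\<bar>)) < \<epsilon>"
    using eventually_happens'[OF sequentially_bot] by blast
  then show ?thesis by (intro exI[of _ "inverse (real (Suc k))"]) auto
qed

text \<open>If the modulus is 1 at v, stability with A = B = 1 gives |\<psi>(u)|^2 = |\<psi>(b u)|
  for b = 2^(1/\<alpha>) > 1, so the modulus is 1 at all v / b^k. Then v . x is almost surely
  constant modulo 2 pi b^k for every k, hence constant, against nondegeneracy.\<close>

lemma stable_char_less_1:
  fixes \<mu> :: "'a::euclidean_space measure"
  assumes st: "stable_law \<alpha> \<mu>" and a: "\<alpha> > 0" and v: "v \<noteq> 0"
  shows "cmod (\<integral>x. cis (v \<bullet> x) \<partial>\<mu>) < 1"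
proof (rule ccontr)
  interpret prob_space \<mu> using st by (simp add: stable_law_def)
  have sets [measurable_cong]: "sets \<mu> = sets borel" using st by (simp add: stable_law_def)
  have space: "space \<mu> = UNIV" using sets_eq_imp_space_eq[OF sets] by simp
  interpret P: pair_prob_space \<mu> \<mu> ..
  define \<psi> where "\<psi> u = (\<integral>x. cis (u \<bullet> x) \<partial>\<mu>)" for u
  have le: "cmod (\<psi> u) \<le> 1" for u
    unfolding \<psi>_def by (rule order_trans[OF integral_norm_bound]) (simp add: prob_space)
  assume "\<not> cmod (\<integral>x. cis (v \<bullet> x) \<partial>\<mu>) < 1"
  then have one: "cmod (\<psi> v) = 1" using le[of v] by (simp add: \<psi>_def)
  define b where "b = 2 powr (1 / \<alpha>)"
  have b: "b > 1" using a by (simp add: b_def)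
  obtain D where D: "distr (\<mu> \<Otimes>\<^sub>M \<mu>) borel (\<lambda>(x, y). 1 *\<^sub>R x + 1 *\<^sub>R y) = distr \<mu> borel (\<lambda>x. b *\<^sub>R x + D)"
    using st[unfolded stable_law_def] unfolding b_def
    by (metis one_add_one powr_one_eq_one zero_less_one)
  have mult: "(cmod (\<psi> u))\<^sup>2 = cmod (\<psi> (b *\<^sub>R u))" for u
  proof -
    have m: "(\<lambda>x. cis (u \<bullet> x)) \<in> borel_measurable borel" by measurable
    have "(\<integral>z. cis (u \<bullet> z) \<partial>distr (\<mu> \<Otimes>\<^sub>M \<mu>) borel (\<lambda>(x, y). 1 *\<^sub>R x + 1 *\<^sub>R y)) =
        (\<integral>p. cis (u \<bullet> fst p) * cis (u \<bullet> snd p) \<partial>(\<mu> \<Otimes>\<^sub>M \<mu>))"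
      by (subst integral_distr) (auto simp: cis_mult inner_add_right case_prod_beta)
    also have "\<dots> = (\<integral>x. \<integral>y. cis (u \<bullet> x) * cis (u \<bullet> y) \<partial>\<mu> \<partial>\<mu>)"
    proof -
      have "integrable (\<mu> \<Otimes>\<^sub>M \<mu>) (\<lambda>p. cis (u \<bullet> fst p) * cis (u \<bullet> snd p))"
        by (rule P.integrable_const_bound[where B = 1]) (auto simp: norm_mult)
      from P.integral_fst'[OF this] show ?thesis by simp
    qed
    also have "\<dots> = \<psi> u * \<psi> u" by (simp add: \<psi>_def)
    finally have "\<psi> u * \<psi> u = (\<integral>z. cis (u \<bullet> z) \<partial>distr \<mu> borel (\<lambda>x. b *\<^sub>R x + D))"
      unfolding D by simp
    also have "\<dots> = (\<integral>x. cis (u \<bullet> D) * cis ((b *\<^sub>R u) \<bullet> x) \<partial>\<mu>)"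
      by (subst integral_distr) (auto simp: cis_mult inner_add_right add.commute)
    also have "\<dots> = cis (u \<bullet> D) * \<psi> (b *\<^sub>R u)" by (simp add: \<psi>_def)
    finally have "cmod (\<psi> u * \<psi> u) = cmod (\<psi> (b *\<^sub>R u))" by (simp add: norm_mult)
    then show ?thesis by (simp add: norm_mult power2_eq_square)
  qed
  define w where "w k = (1 / b ^ k) *\<^sub>R v" for k
  have wone: "cmod (\<psi> (w k)) = 1" for k
  proof (induction k)
    case (Suc k)
    have "b *\<^sub>R w (Suc k) = w k" using b by (simp add: w_def)
    then have "(cmod (\<psi> (w (Suc k))))\<^sup>2 = 1" using mult[of "w (Suc k)"] Suc by simp
    then show ?case by (metis norm_ge_zero power2_eq_1_iff le_minus_one_simps(3))
  qed (simp add: w_def one)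
  have "AE x in \<mu>. cis (w k \<bullet> x) = \<psi> (w k)" for k
    unfolding \<psi>_def
    by (rule AE_eq_expectation_of_unimodular) (use wone[of k] in \<open>auto simp: \<psi>_def\<close>)
  then have ae: "AE x in \<mu>. \<forall>k. cis (w k \<bullet> x) = \<psi> (w k)" by (simp add: AE_all_countable)
  then obtain x0 where x0: "\<And>k. cis (w k \<bullet> x0) = \<psi> (w k)" using AE_ex by blast
  from ae have "AE x in \<mu>. v \<bullet> x = v \<bullet> x0"
  proof eventually_elim
    case (elim x)
    define t where "t = v \<bullet> (x - x0)"
    have c: "cos (t / b ^ k) = 1" for k
    proof -
      have "\<psi> (w k) \<noteq> 0" using wone[of k] by auto
      then have "cis (w k \<bullet> x - w k \<bullet> x0) = 1"
        using elim[rule_format, of k] x0[of k] by (simp add: cis_divide[symmetric])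
      moreover have "w k \<bullet> x - w k \<bullet> x0 = t / b ^ k"
        by (simp add: w_def t_def inner_diff_right diff_divide_distrib)
      ultimately show ?thesis by (simp add: complex_eq_iff)
    qed
    have "t = 0"
    proof (rule ccontr)
      assume t: "t \<noteq> 0"
      obtain k where k: "\<bar>t\<bar> < b ^ k" using real_arch_pow[OF b] by blast
      obtain m :: int where m: "t / b ^ k = real_of_int m * 2 * pi"
        using c[of k] cos_one_2pi_int by auto
      have "\<bar>t / b ^ k\<bar> < 1" using k b by simp
      then have "\<bar>real_of_int m\<bar> * (2 * pi) < 1" unfolding m by (simp add: abs_mult)
      moreover have "m \<noteq> 0" using m t b by auto
      then have "1 * (2 * pi) \<le> \<bar>real_of_int m\<bar> * (2 * pi)" by (intro mult_right_mono) auto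
      ultimately show False using pi_gt3 by simp
    qed
    then show ?case by (simp add: t_def inner_diff_right)
  qed
  then have "measure \<mu> {x \<in> space \<mu>. v \<bullet> x = v \<bullet> x0} = 1"
    by (subst prob_Collect_eq_1) auto
  then have "measure \<mu> {x. v \<bullet> x = v \<bullet> x0} = 1" by (simp add: space)
  moreover have "nondegenerate_law \<mu>" using st by (simp add: stable_law_def)
  ultimately show False using v unfolding nondegenerate_law_def by blast
qed

section \<open>Tightness and characteristic functions of the rescaled walk\<close>

locale attracted_walk = lattice_walk \<rho> for \<rho> :: "(int ^ 'd) measure" +
  fixes \<alpha> :: real and \<mu> :: "(real ^ 'd) measure"
  assumes alpha_pos: "\<alpha> > 0" and stable: "stable_law \<alpha> \<mu>"
    and conv: "\<And>F :: real ^ 'd \<Rightarrow> real. continuous_on UNIV F \<Longrightarrow> bounded (range F) \<Longrightarrow>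
      (\<lambda>n. Y.expectation (\<lambda>y. F (real n powr (- 1 / \<alpha>) *\<^sub>R lattice_embed (pos n y)))) \<longlonglongrightarrow> (\<integral>x. F x \<partial>\<mu>)"
begin

definition scaled :: "nat \<Rightarrow> (nat \<Rightarrow> int ^ 'd) \<Rightarrow> real ^ 'd" where
  "scaled n y = real n powr (- 1 / \<alpha>) *\<^sub>R lattice_embed (pos n y)"

abbreviation tail :: "real \<Rightarrow> nat \<Rightarrow> real" where
  "tail s n \<equiv> Y.expectation (\<lambda>y. min 1 (s * norm (scaled n y)))"

abbreviation char_scaled :: "nat \<Rightarrow> real ^ 'd \<Rightarrow> complex" where
  "char_scaled n w \<equiv> \<integral>y. cis (w \<bullet> scaled n y) \<partial>steps"

lemma measurable_scaled [measurable]: "scaled n \<in> borel_measurable steps"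
  unfolding scaled_def by (rule measurable_fun_pos)

lemma prob_space_limit: "prob_space \<mu>" and sets_limit: "sets \<mu> = sets borel"
  using stable by (simp_all add: stable_law_def)

text \<open>For large \<open>n\<close>, convergence in distribution compares with the limit law; the
  finitely many other \<open>n\<close> get scales of their own, and the smallest scale works for
  all.\<close>

lemma tight:
  assumes e: "\<epsilon> > 0"
  shows "\<exists>s>0. \<forall>n. tail s n \<le> \<epsilon>"
proof -
  interpret L: prob_space \<mu> by (rule prob_space_limit)
  have "norm \<in> borel_measurable \<mu>"
    unfolding measurable_cong_sets[OF sets_limit refl] by measurable
  then obtain s1 where s1: "s1 > 0" "L.expectation (\<lambda>x. min 1 (s1 * norm x)) \<le> \<epsilon> / 2"
    using L.expectation_min_small[of norm "\<epsilon> / 2"] e by auto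
  have "(\<lambda>n. tail s1 n) \<longlonglongrightarrow> L.expectation (\<lambda>x. min 1 (s1 * norm x))"
    unfolding scaled_def
  proof (rule conv[of "\<lambda>x. min 1 (s1 * norm x)"])
    show "bounded (range (\<lambda>x :: real ^ 'd. min 1 (s1 * norm x)))"
      by (rule boundedI[of _ 1]) (use s1 in \<open>auto simp: min_def abs_le_iff intro: order_trans[of _ 0]\<close>)
  qed (intro continuous_intros)
  then have "\<forall>\<^sub>F n in sequentially. tail s1 n < \<epsilon>"
    by (rule order_tendstoD) (use s1 e in simp)
  then obtain n0 where n0: "\<And>n. n \<ge> n0 \<Longrightarrow> tail s1 n < \<epsilon>"
    by (auto simp: eventually_sequentially)
  have "\<exists>s>0. tail s n \<le> \<epsilon>" for n
    using Y.expectation_min_small[of "\<lambda>y. norm (scaled n y)" \<epsilon>] e by simp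
  then obtain s2 where s2: "\<And>n. s2 n > 0" "\<And>n. tail (s2 n) n \<le> \<epsilon>"
    by metis
  define s where "s = Min (insert s1 (s2 ` {..<n0}))"
  have s: "s > 0" "s \<le> s1" "\<And>n. n < n0 \<Longrightarrow> s \<le> s2 n"
    unfolding s_def using s1 s2 by (auto intro!: Min_le)
  have mono: "tail s n \<le> tail r n"
    if "s \<le> r" for r n
  proof (rule integral_mono)
    have i: "integrable steps (\<lambda>y. min 1 (t * norm (scaled n y)))" if "t > 0" for t
      by (rule Y.integrable_const_bound[where B = 1]) (use that in \<open>auto simp: abs_le_iff min_def\<close>)
    show "integrable steps (\<lambda>y. min 1 (s * norm (scaled n y)))" by (rule i[OF s(1)])
    show "integrable steps (\<lambda>y. min 1 (r * norm (scaled n y)))" using s(1) that by (intro i) simp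
    show "min 1 (s * norm (scaled n y)) \<le> min 1 (r * norm (scaled n y))" for y
      using that by (intro min.mono mult_right_mono) auto
  qed
  have "tail s n \<le> \<epsilon>" for n
  proof (cases "n < n0")
    case True
    show ?thesis using mono[OF s(3)[OF True], of n] s2(2)[of n] by simp
  next
    case False
    then show ?thesis using mono[OF s(2), of n] n0[of n] by simp
  qed
  with s show ?thesis by blast
qed

lemma integrable_cis_scaled: "integrable steps (\<lambda>y. cis (w \<bullet> scaled n y))"
  by (rule Y.integrable_const_bound[where B = 1]) auto

text \<open>Equicontinuity of the characteristic functions, uniform in \<open>n\<close> once
  \<open>s\<close> is taken from \<open>tight\<close>.\<close>

lemma cis_scaled_diff_le:
  assumes "norm (w - v) \<le> s" "s > 0"
  shows "cmod (char_scaled n w - char_scaled n v) \<le>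
    2 * tail s n"
proof -
  have "cmod (char_scaled n w - char_scaled n v) =
      cmod (\<integral>y. cis (w \<bullet> scaled n y) - cis (v \<bullet> scaled n y) \<partial>steps)"
    by (simp add: integrable_cis_scaled)
  also have "\<dots> \<le> Y.expectation (\<lambda>y. cmod (cis (w \<bullet> scaled n y) - cis (v \<bullet> scaled n y)))"
    by (rule integral_norm_bound)
  also have "\<dots> \<le> Y.expectation (\<lambda>y. 2 * min 1 (s * norm (scaled n y)))"
  proof (rule integral_mono)
    show "integrable steps (\<lambda>y. cmod (cis (w \<bullet> scaled n y) - cis (v \<bullet> scaled n y)))"
      by (intro integrable_norm Bochner_Integration.integrable_diff integrable_cis_scaled)
    show "integrable steps (\<lambda>y. 2 * min 1 (s * norm (scaled n y)))"
      by (intro integrable_mult_right Y.integrable_const_bound[where B = 1])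
         (use assms in \<open>auto simp: abs_le_iff min_def\<close>)
    fix y
    have "\<bar>w \<bullet> scaled n y - v \<bullet> scaled n y\<bar> \<le> norm (w - v) * norm (scaled n y)"
      unfolding inner_diff_left[symmetric] by (rule Cauchy_Schwarz_ineq2)
    also have "\<dots> \<le> s * norm (scaled n y)" using assms by (intro mult_right_mono) auto
    finally have "min 1 \<bar>w \<bullet> scaled n y - v \<bullet> scaled n y\<bar> \<le> min 1 (s * norm (scaled n y))"
      by (rule min.mono[OF order_refl])
    then have "2 * min 1 \<bar>w \<bullet> scaled n y - v \<bullet> scaled n y\<bar> \<le> 2 * min 1 (s * norm (scaled n y))"
      by (rule mult_left_mono) simp
    with norm_cis_diff_le show "cmod (cis (w \<bullet> scaled n y) - cis (v \<bullet> scaled n y)) \<le> 2 * min 1 (s * norm (scaled n y))"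
      by (rule order_trans)
  qed
  finally show ?thesis by simp
qed

lemma cis_scaled_eq:
  assumes "n \<ge> 1"
  shows "(\<integral>y. cis ((real n powr (1 / \<alpha>) *\<^sub>R u) \<bullet> scaled n y) \<partial>steps) = phi u ^ n"
proof -
  have "real n powr - (1 / \<alpha>) * real n powr (1 / \<alpha>) = 1"
    using assms by (simp add: powr_add[symmetric])
  then have "(real n powr (1 / \<alpha>) *\<^sub>R u) \<bullet> scaled n y = u \<bullet> lattice_embed (pos n y)" for y
    by (simp add: scaled_def)
  then show ?thesis by (simp add: expectation_cis_pos)
qed

lemma phi_0: "phi 0 = 1"
  by (simp add: phi_def)

text \<open>By tightness all powers \<open>phi u ^ j\<close> with \<open>j\<close> up to order \<open>\<parallel>u\<parallel> powr (- \<alpha>)\<close> stay close to 1;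
  this forces \<open>phi u\<close> itself to be as close to 1 as claimed, without any moment of the steps.\<close>

lemma phi_near_upper: "\<exists>\<delta>>0. \<exists>C>0. \<forall>u. norm u \<le> \<delta> \<longrightarrow> cmod (1 - phi u) \<le> C * norm u powr \<alpha>"
proof -
  obtain s where s: "s > 0" "\<And>n. tail s n \<le> 1 / 4"
    using tight[of "1 / 4"] by auto
  have "cmod (1 - phi u) \<le> 2 * s powr (- \<alpha>) * norm u powr \<alpha>" if u: "norm u \<le> s" for u
  proof (cases "u = 0")
    case True
    then show ?thesis by (simp add: phi_0)
  next
    case False
    \<comment> \<open>For j up to \<open>X\<close> the rescaled frequency j^(1/\<alpha>) u has norm
      at most \<open>s\<close>, where tightness keeps \<open>phi u ^ j\<close> within 1/2 of
      1.\<close>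
    define X where "X = (s / norm u) powr \<alpha>"
    have X: "X \<ge> 1" unfolding X_def using False u alpha_pos s by (intro ge_one_powr_ge_zero) auto
    define n where "n = nat \<lfloor>X\<rfloor>"
    have n1: "real n \<le> X" "X < real n + 1" "n \<ge> 1" using X unfolding n_def by linarith+
    then have n: "real n \<le> X" "X \<le> 2 * real n" "n > 0" by auto
    have "cmod (1 - phi u) \<le> 1 / real n"
    proof (rule norm_one_minus_le_of_powers[OF n(3)])
      fix j assume j: "j \<le> n"
      show "cmod (1 - phi u ^ j) \<le> 1 / 2"
      proof (cases "j = 0")
        case False
        let ?w = "real j powr (1 / \<alpha>) *\<^sub>R u"
        have "real j powr (1 / \<alpha>) \<le> X powr (1 / \<alpha>)"
          using j n alpha_pos by (intro powr_mono2) auto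
        also have "\<dots> = s / norm u" using s alpha_pos by (simp add: X_def powr_powr)
        finally have "norm (?w - 0) \<le> s" using \<open>u \<noteq> 0\<close> by (simp add: field_simps)
        from cis_scaled_diff_le[OF this s(1), of j] s(2)[of j]
        show ?thesis using cis_scaled_eq[of j u] False by (simp add: norm_minus_commute)
      qed simp
    qed
    also have "\<dots> \<le> 2 / X" using n X by (simp add: field_simps)
    also have "\<dots> = 2 * s powr (- \<alpha>) * norm u powr \<alpha>"
      using s by (simp add: X_def powr_divide powr_minus_divide)
    finally show ?thesis .
  qed
  with s show ?thesis by (intro exI[of _ s] conjI exI[of _ "2 * s powr (- \<alpha>)"]) auto
qed

text \<open>At a small frequency \<open>u\<close>, look at the walk at time \<open>n = \<lfloor>\<parallel>u\<parallel> powr (- \<alpha>)\<rfloor>\<close>: then \<open>phi u ^ n\<close> is the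
  characteristic function of the rescaled walk near the unit sphere, where the limit law has
  modulus less than 1.\<close>

lemma phi_near_lower: "\<exists>\<delta>>0. \<exists>c>0. \<forall>u. norm u \<le> \<delta> \<longrightarrow> c * norm u powr \<alpha> \<le> 1 - (cmod (phi u))\<^sup>2"
proof (rule ccontr)
  interpret L: prob_space \<mu> by (rule prob_space_limit)
  assume neg: "\<not> ?thesis"
  have "\<exists>u. norm u \<le> inverse (real (Suc k)) \<and> 1 - (cmod (phi u))\<^sup>2 < inverse (real (Suc k)) * norm u powr \<alpha>" for k
  proof (rule ccontr)
    assume "\<not> ?thesis"
    then have "\<forall>u. norm u \<le> inverse (real (Suc k)) \<longrightarrow>
        inverse (real (Suc k)) * norm u powr \<alpha> \<le> 1 - (cmod (phi u))\<^sup>2"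
      by (meson not_le)
    moreover have "inverse (real (Suc k)) > 0" by simp
    ultimately show False using neg by blast
  qed
  then obtain u where u: "\<And>k. norm (u k) \<le> inverse (real (Suc k))"
    "\<And>k. 1 - (cmod (phi (u k)))\<^sup>2 < inverse (real (Suc k)) * norm (u k) powr \<alpha>"
    by metis
  \<comment> \<open>At u = 0 both sides vanish, which the strict inequality excludes.\<close>
  have u0: "u k \<noteq> 0" for k
    using u(2)[of k] by (auto simp: phi_0)
  have u1: "norm (u k) \<le> 1" for k
    by (rule order_trans[OF u(1)]) (simp add: inverse_eq_divide)
  have ulim: "(\<lambda>k. norm (u k)) \<longlonglongrightarrow> 0"
  proof (rule tendsto_sandwich[OF _ _ tendsto_const LIMSEQ_inverse_real_of_nat])
    show "\<forall>\<^sub>F k in sequentially. norm (u k) \<le> inverse (real (Suc k))"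
      by (intro always_eventually allI u(1))
  qed simp
  define X where "X k = norm (u k) powr (- \<alpha>)" for k
  have X: "X k \<ge> 1" for k
  proof -
    have "norm (u k) powr \<alpha> \<le> 1" using u1 alpha_pos by (intro powr_le1) auto
    then show ?thesis using u0[of k] by (simp add: X_def powr_minus one_le_inverse_iff)
  qed
  have Xu: "X k * norm (u k) powr \<alpha> = 1" for k
    using u0[of k] by (simp add: X_def powr_add[symmetric])
  define n where "n k = nat \<lfloor>X k\<rfloor>" for k
  have n: "real (n k) \<le> X k" "X k < real (n k) + 1" "n k \<ge> 1" for k
    using X[of k] unfolding n_def by linarith+
  define w where "w k = real (n k) powr (1 / \<alpha>) *\<^sub>R u k" for k
  \<comment> \<open>\<open>q k\<close> tends to 1, as rounding in \<open>n k\<close> costs at most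
    |u k|^\<alpha>; hence |w k| tends to 1 and the limit points of \<open>w\<close> lie on the unit
    sphere.\<close>
  define q where "q k = real (n k) * norm (u k) powr \<alpha>" for k
  have nw: "norm (w k) = q k powr (1 / \<alpha>)" for k
    using alpha_pos by (simp add: w_def q_def powr_mult powr_powr)
  have q1: "q k \<le> 1" for k
    using mult_right_mono[OF n(1)[of k], of "norm (u k) powr \<alpha>"] Xu[of k] by (simp add: q_def)
  have q2: "1 - norm (u k) powr \<alpha> \<le> q k" for k
  proof -
    have "X k * norm (u k) powr \<alpha> \<le> (real (n k) + 1) * norm (u k) powr \<alpha>"
      using n(2)[of k] by (intro mult_right_mono) auto
    then show ?thesis using Xu[of k] by (simp add: q_def distrib_right)
  qed
  have up: "(\<lambda>k. norm (u k) powr \<alpha>) \<longlonglongrightarrow> 0"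
    using tendsto_powr2[OF ulim tendsto_const, of \<alpha>] alpha_pos by simp
  have "(\<lambda>k. 1 - norm (u k) powr \<alpha>) \<longlonglongrightarrow> 1 - 0" by (intro tendsto_diff tendsto_const up)
  then have "q \<longlonglongrightarrow> 1"
    by (intro tendsto_sandwich[OF _ _ _ tendsto_const, of _ q]) (auto intro!: always_eventually q1 q2)
  then have "(\<lambda>k. q k powr (1 / \<alpha>)) \<longlonglongrightarrow> 1 powr (1 / \<alpha>)"
    by (intro tendsto_powr tendsto_const) auto
  then have nwlim: "(\<lambda>k. norm (w k)) \<longlonglongrightarrow> 1" by (simp add: nw)
  have "w k \<in> cball 0 1" for k
    using q1[of k] alpha_pos by (auto simp: nw q_def intro!: powr_le1)
  then obtain v r where r: "strict_mono r" and wv: "(w \<circ> r) \<longlonglongrightarrow> v"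
    using compact_imp_seq_compact[OF compact_cball[of "0 :: real ^ 'd" 1]]
    unfolding seq_compact_def by meson
  have "(\<lambda>k. norm ((w \<circ> r) k)) \<longlonglongrightarrow> norm v" by (intro tendsto_norm wv)
  moreover have "(\<lambda>k. norm ((w \<circ> r) k)) \<longlonglongrightarrow> 1"
    using LIMSEQ_subseq_LIMSEQ[OF nwlim r] by (simp add: o_def)
  ultimately have nv: "norm v = 1" by (rule LIMSEQ_unique)
  define \<psi> where "\<psi> = (\<integral>x. cis (v \<bullet> x) \<partial>\<mu>)"
  have psi: "cmod \<psi> < 1"
    unfolding \<psi>_def by (rule stable_char_less_1[OF stable alpha_pos]) (use nv in auto)
  have int_mu: "integrable \<mu> (\<lambda>x. cis (v \<bullet> x))"
  proof (rule L.integrable_const_bound[where B = 1])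
    have "(\<lambda>x. cis (v \<bullet> x)) \<in> borel_measurable borel" by measurable
    then show "(\<lambda>x. cis (v \<bullet> x)) \<in> borel_measurable \<mu>"
      by (simp add: measurable_cong_sets[OF sets_limit refl])
  qed auto
  have "(\<lambda>m. char_scaled m v) \<longlonglongrightarrow> \<psi>"
  proof (rule tendsto_complex_iff[THEN iffD2], intro conjI)
    have "(\<lambda>m. Y.expectation (\<lambda>y. cos (v \<bullet> scaled m y))) \<longlonglongrightarrow> L.expectation (\<lambda>x. cos (v \<bullet> x))"
      unfolding scaled_def
      by (rule conv[of "\<lambda>x. cos (v \<bullet> x)"]) (auto intro!: continuous_intros boundedI[of _ 1])
    then show "(\<lambda>m. Re (char_scaled m v)) \<longlonglongrightarrow> Re \<psi>"
      by (simp add: \<psi>_def integral_Re[symmetric] int_mu integrable_cis_scaled)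
    have "(\<lambda>m. Y.expectation (\<lambda>y. sin (v \<bullet> scaled m y))) \<longlonglongrightarrow> L.expectation (\<lambda>x. sin (v \<bullet> x))"
      unfolding scaled_def
      by (rule conv[of "\<lambda>x. sin (v \<bullet> x)"]) (auto intro!: continuous_intros boundedI[of _ 1])
    then show "(\<lambda>m. Im (char_scaled m v)) \<longlonglongrightarrow> Im \<psi>"
      by (simp add: \<psi>_def integral_Im[symmetric] int_mu integrable_cis_scaled)
  qed
  moreover have "filterlim (\<lambda>k. n (r k)) sequentially sequentially"
  proof -
    have "filterlim (\<lambda>k. inverse (norm (u (r k)) powr \<alpha>)) at_top sequentially"
    proof (rule filterlim_inverse_at_top)
      show "(\<lambda>k. norm (u (r k)) powr \<alpha>) \<longlonglongrightarrow> 0"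
        using LIMSEQ_subseq_LIMSEQ[OF up r] by (simp add: o_def)
      show "\<forall>\<^sub>F k in sequentially. 0 < norm (u (r k)) powr \<alpha>" using u0 by simp
    qed
    then have "filterlim (\<lambda>k. X (r k)) at_top sequentially" by (simp add: X_def powr_minus)
    then show ?thesis
      unfolding n_def
      by (intro filterlim_compose[OF filterlim_nat_sequentially]
          filterlim_compose[OF filterlim_floor_sequentially])
  qed
  ultimately have "(\<lambda>k. char_scaled (n (r k)) v) \<longlonglongrightarrow> \<psi>"
    by (rule filterlim_compose)
  \<comment> \<open>Time and frequency vary together, so convergence at the fixed \<open>v\<close>
    is not enough; tightness allows \<open>w (r k)\<close> to be replaced by \<open>v\<close>
    uniformly in time.\<close>
  moreover have "(\<lambda>k. char_scaled (n (r k)) (w (r k)) -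
      char_scaled (n (r k)) v) \<longlonglongrightarrow> 0"
  proof (rule LIMSEQ_I)
    fix \<epsilon> :: real assume e: "\<epsilon> > 0"
    obtain s where s: "s > 0" "\<And>n. tail s n \<le> \<epsilon> / 4"
      using tight[of "\<epsilon> / 4"] e by auto
    obtain k0 where k0: "\<And>k. k \<ge> k0 \<Longrightarrow> norm (w (r k) - v) < s"
      using LIMSEQ_D[OF wv s(1)] by auto
    show "\<exists>k0. \<forall>k\<ge>k0. cmod (char_scaled (n (r k)) (w (r k)) -
      char_scaled (n (r k)) v - 0) < \<epsilon>"
    proof (intro exI[of _ k0] allI impI)
      fix k assume "k0 \<le> k"
      then have "norm (w (r k) - v) \<le> s" using k0 by (simp add: less_imp_le)
      from cis_scaled_diff_le[OF this s(1), of "n (r k)"] s(2)[of "n (r k)"] e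
      show "cmod (char_scaled (n (r k)) (w (r k)) -
        char_scaled (n (r k)) v - 0) < \<epsilon>" by simp
    qed
  qed
  ultimately have "(\<lambda>k. char_scaled (n (r k)) (w (r k))) \<longlonglongrightarrow> 0 + \<psi>"
    using tendsto_add[of _ 0 _ _ \<psi>] by fastforce
  then have "(\<lambda>k. phi (u (r k)) ^ n (r k)) \<longlonglongrightarrow> \<psi>"
    unfolding w_def cis_scaled_eq[OF n(3)] by simp
  then have lim: "(\<lambda>k. (cmod (phi (u (r k)) ^ n (r k)))\<^sup>2) \<longlonglongrightarrow> (cmod \<psi>)\<^sup>2"
    by (intro tendsto_power tendsto_norm)
  \<comment> \<open>The time multiplied by the deficit 1 - |phi|^2 is at most
    \<open>inverse (real (Suc (r k)))\<close>. By Bernoulli's inequality the squared modulus of the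
    power tends to 1, against \<open>psi\<close>.\<close>
  have ge: "1 - inverse (real (Suc (r k))) \<le> (cmod (phi (u (r k)) ^ n (r k)))\<^sup>2" for k
  proof -
    let ?x = "(cmod (phi (u (r k))))\<^sup>2 - 1"
    have "real (n (r k)) * (1 - (cmod (phi (u (r k))))\<^sup>2) \<le>
        real (n (r k)) * (inverse (real (Suc (r k))) * norm (u (r k)) powr \<alpha>)"
      using u(2)[of "r k"] by (intro mult_left_mono) auto
    also have "\<dots> = inverse (real (Suc (r k))) * q (r k)" by (simp add: q_def)
    also have "\<dots> \<le> inverse (real (Suc (r k))) * 1" by (intro mult_left_mono q1) auto
    finally have "1 - inverse (real (Suc (r k))) \<le> 1 + real (n (r k)) * ?x"
      by (simp add: right_diff_distrib)
    also have "\<dots> \<le> (1 + ?x) ^ n (r k)" by (rule Bernoulli_inequality) simp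
    also have "\<dots> = (cmod (phi (u (r k)) ^ n (r k)))\<^sup>2"
      by (simp add: norm_power power_mult[symmetric] mult.commute)
    finally show ?thesis .
  qed
  have "(\<lambda>k. 1 - inverse (real (Suc (r k)))) \<longlonglongrightarrow> 1 - 0"
    using LIMSEQ_subseq_LIMSEQ[OF LIMSEQ_inverse_real_of_nat r]
    by (intro tendsto_diff tendsto_const) (simp add: o_def)
  then have "1 - 0 \<le> (cmod \<psi>)\<^sup>2"
    by (rule LIMSEQ_le[OF _ lim]) (use ge in auto)
  moreover have "(cmod \<psi>)\<^sup>2 < 1" using psi by (simp add: power_less_one_iff abs_square_less_1)
  ultimately show False by simp
qed

lemma phi_near_bounds: "\<exists>\<delta> c C. phi_regular \<alpha> \<delta> c C"
proof -
  obtain \<delta>1 C where 1: "\<delta>1 > 0" "C > 0" "\<And>u. norm u \<le> \<delta>1 \<Longrightarrow> cmod (1 - phi u) \<le> C * norm u powr \<alpha>"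
    using phi_near_upper by blast
  obtain \<delta>2 c where 2: "\<delta>2 > 0" "c > 0" "\<And>u. norm u \<le> \<delta>2 \<Longrightarrow> c * norm u powr \<alpha> \<le> 1 - (cmod (phi u))\<^sup>2"
    using phi_near_lower by blast
  show ?thesis
    unfolding phi_regular_def
    by (rule exI[of _ "min 1 (min \<delta>1 \<delta>2)"], rule exI[of _ c], rule exI[of _ C]) (use 1 2 in auto)
qed

end

section \<open>Size of the self-intersections\<close>

lemma sum_powr_le:
  assumes \<theta>: "0 < \<theta>" "\<theta> \<le> 1"
  shows "(\<Sum>k=1..n. real k powr (\<theta> - 1)) \<le> real n powr \<theta> / \<theta>"
proof (induction n)
  case (Suc n)
  have "\<theta> * real (Suc n) powr (\<theta> - 1) \<le> real (Suc n) powr \<theta> - real n powr \<theta>"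
  proof (cases "n = 0")
    case True
    then show ?thesis using \<theta> by simp
  next
    case False
    have "\<exists>z. real n < z \<and> z < real (Suc n) \<and>
        real (Suc n) powr \<theta> - real n powr \<theta> = (real (Suc n) - real n) * (\<theta> * z powr (\<theta> - 1))"
      using False by (intro MVT2) (auto intro!: derivative_eq_intros simp: powr_diff)
    then obtain z where z: "real n < z" "z < real (Suc n)"
      "real (Suc n) powr \<theta> - real n powr \<theta> = \<theta> * z powr (\<theta> - 1)" by auto
    have "real (Suc n) powr (\<theta> - 1) \<le> z powr (\<theta> - 1)"
      using z False \<theta> by (intro powr_mono2') auto
    then show ?thesis using z(3) \<theta> by simp
  qed
  then have "real (Suc n) powr (\<theta> - 1) \<le> real (Suc n) powr \<theta> / \<theta> - real n powr \<theta> / \<theta>"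
    using \<theta> by (simp add: field_simps)
  with Suc show ?case by simp
qed simp

lemma sum_inverse_le_ln:
  assumes "n \<ge> 1"
  shows "(\<Sum>k=1..n. 1 / real k) \<le> 1 + ln (real n)"
  using euler_mascheroni_sequence_decreasing[of 1 n] assms
  by (simp add: harm_def inverse_eq_divide)

lemma ln_le_two_sqrt:
  assumes "x \<ge> (1::real)"
  shows "ln x \<le> 2 * sqrt x"
proof -
  have "ln x = 2 * ln (sqrt x)" using assms by (simp add: ln_sqrt)
  also have "ln (sqrt x) \<le> sqrt x - 1" using assms by (intro ln_le_minus_one) auto
  finally show ?thesis by simp
qed

text \<open>Split at k = sqrt n: below it there are about sqrt n terms, each at most 1, and above it
  ln k is at least half of ln n.\<close>

lemma sum_inverse_ln_bound:
  fixes g :: "nat \<Rightarrow> real"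
  assumes g1: "\<And>k. 1 \<le> g k" and gl: "\<And>k. k \<ge> 1 \<Longrightarrow> \<kappa> * ln (real k) \<le> g k" and \<kappa>: "\<kappa> > 0" and n: "n \<ge> 2"
  shows "(\<Sum>k<n. 1 / g k) \<le> (4 + 2 / \<kappa>) * (real n / ln (real n))"
proof -
  have ln0: "ln (real n) > 0" using n by simp
  have "(\<Sum>k<n. 1 / g k) \<le> (\<Sum>k<n. of_bool (k\<^sup>2 \<le> n) + 2 / (\<kappa> * ln (real n)))"
  proof (rule sum_mono)
    fix k
    show "1 / g k \<le> of_bool (k\<^sup>2 \<le> n) + 2 / (\<kappa> * ln (real n))"
    proof (cases "k\<^sup>2 \<le> n")
      case True
      have "1 / g k \<le> 1" using g1[of k] by simp
      moreover have "0 \<le> 2 / (\<kappa> * ln (real n))" using \<kappa> ln0 by simp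
      ultimately show ?thesis unfolding eqTrueI[OF True] of_bool_eq by linarith
    next
      case False
      then have k: "k \<ge> 1" by (cases k) auto
      have "real n \<le> real (k\<^sup>2)" using False by simp
      then have "ln (real n) \<le> ln ((real k)\<^sup>2)" using n by (intro ln_mono) auto
      also have "\<dots> = 2 * ln (real k)" using k by (simp add: ln_realpow)
      finally have "\<kappa> * ln (real n) / 2 \<le> \<kappa> * ln (real k)" using \<kappa> by simp
      also have "\<dots> \<le> g k" by (rule gl[OF k])
      finally have "1 / g k \<le> 1 / (\<kappa> * ln (real n) / 2)"
        using \<kappa> ln0 by (intro divide_left_mono) (auto intro!: mult_pos_pos less_le_trans[OF zero_less_one g1])
      then show ?thesis using False by simp
    qed
  qed
  also have "\<dots> = real (card {k\<in>{..<n}. k\<^sup>2 \<le> n}) + real n * (2 / (\<kappa> * ln (real n)))"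
    by (simp add: sum.distrib of_bool_def sum.If_cases Int_def)
  also have "real (card {k\<in>{..<n}. k\<^sup>2 \<le> n}) \<le> sqrt (real n) + 1"
  proof -
    have "{k\<in>{..<n}. k\<^sup>2 \<le> n} \<subseteq> {..nat \<lfloor>sqrt (real n)\<rfloor>}"
    proof
      fix k assume "k \<in> {k\<in>{..<n}. k\<^sup>2 \<le> n}"
      then have "real (k\<^sup>2) \<le> real n" by (simp only: of_nat_le_iff mem_Collect_eq)
      then have "real k \<le> sqrt (real n)" by (intro real_le_rsqrt) simp
      then show "k \<in> {..nat \<lfloor>sqrt (real n)\<rfloor>}" by (simp add: le_nat_floor)
    qed
    then have "card {k\<in>{..<n}. k\<^sup>2 \<le> n} \<le> card {..nat \<lfloor>sqrt (real n)\<rfloor>}" by (intro card_mono) auto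
    then have "card {k\<in>{..<n}. k\<^sup>2 \<le> n} \<le> nat \<lfloor>sqrt (real n)\<rfloor> + 1" by simp
    moreover have "real (nat \<lfloor>sqrt (real n)\<rfloor>) \<le> sqrt (real n)" by (simp add: of_nat_floor)
    ultimately show ?thesis by linarith
  qed
  also have "sqrt (real n) + 1 \<le> 4 * (real n / ln (real n))"
  proof -
    have "ln (real n) * (sqrt (real n) + 1) \<le> (2 * sqrt (real n)) * (2 * sqrt (real n))"
      using ln_le_two_sqrt[of "real n"] ln0 n by (intro mult_mono) auto
    also have "\<dots> = 4 * real n" by simp
    finally show ?thesis using ln0 by (simp add: field_simps)
  qed
  finally have "(\<Sum>k<n. 1 / g k) \<le> 4 * (real n / ln (real n)) + real n * (2 / (\<kappa> * ln (real n)))"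
    by simp
  also have "real n * (2 / (\<kappa> * ln (real n))) = 2 / \<kappa> * (real n / ln (real n))" by simp
  finally show ?thesis unfolding distrib_right .
qed

context attracted_walk
begin

text \<open>Here \<open>green n\<close> is of order n^\<theta> with \<theta> = 1 - 1/\<alpha>, and
  the mean range is at most a multiple of n^(1/\<alpha>); both bounds on the mean of sqrt V_n then
  have order n^((1 + \<theta>)/2).\<close>

lemma sqrt_pairs_bounds_powr:
  assumes d: "CARD('d) = 1" and \<alpha>: "1 < \<alpha>"
  shows "\<exists>c1>0. \<exists>c2>0. \<forall>n\<ge>1. c1 * real n powr (1 - 1 / (2 * \<alpha>)) \<le> mean_sqrt_pairs n \<and>
    mean_sqrt_pairs n \<le> c2 * real n powr (1 - 1 / (2 * \<alpha>))"
proof -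
  obtain \<delta> c C where reg: "phi_regular \<alpha> \<delta> c C" using phi_near_bounds by blast
  define \<theta> where "\<theta> = 1 - 1 / \<alpha>"
  have \<theta>: "0 < \<theta>" "\<theta> \<le> 1" using \<alpha> by (auto simp: \<theta>_def)
  obtain B where B: "B > 0" "\<And>k. k \<ge> 1 \<Longrightarrow> ret k \<le> B * real k powr (\<theta> - 1)"
    using ret_upper[OF reg] \<alpha> by (auto simp: d \<theta>_def)
  obtain k where k: "k > 0" "\<And>n. n \<ge> 1 \<Longrightarrow> k * real n powr \<theta> \<le> green n"
    using green_ge_powr[OF reg \<alpha> d] unfolding \<theta>_def by blast
  define c2 where "c2 = sqrt (2 * (1 + B / \<theta>))"
  define r where "r = 1 + \<alpha> / k"
  have pos: "c2 > 0" "r > 0" using B \<theta> k \<alpha> by (auto simp: c2_def r_def intro!: add_pos_pos)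
  have upper: "mean_sqrt_pairs n \<le> c2 * real n powr (1 - 1 / (2 * \<alpha>))" if n: "n \<ge> 1" for n
  proof -
    have "{..n} = insert 0 {1..n}" by auto
    then have "green n = 1 + (\<Sum>k=1..n. ret k)" by (simp add: green_def ret_0)
    also have "\<dots> \<le> real n powr \<theta> + (\<Sum>k=1..n. B * real k powr (\<theta> - 1))"
      using n \<theta> B by (intro add_mono sum_mono ge_one_powr_ge_zero) auto
    also have "\<dots> \<le> real n powr \<theta> + B * (real n powr \<theta> / \<theta>)"
      unfolding sum_distrib_left[symmetric] using B \<theta> by (intro add_left_mono mult_left_mono sum_powr_le) auto
    also have "\<dots> = (1 + B / \<theta>) * real n powr \<theta>" by (simp add: distrib_right)
    finally have "2 * real n * green n \<le> 2 * real n * ((1 + B / \<theta>) * real n powr \<theta>)"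
      by (intro mult_left_mono) auto
    also have "\<dots> = 2 * (1 + B / \<theta>) * (real n powr 1 * real n powr \<theta>)" using n by simp
    also have "real n powr 1 * real n powr \<theta> = real n powr (2 * (1 - 1 / (2 * \<alpha>)))"
    proof -
      have "1 + \<theta> = 2 * (1 - 1 / (2 * \<alpha>))" by (simp add: \<theta>_def right_diff_distrib)
      then show ?thesis unfolding powr_add[symmetric] by simp
    qed
    finally have "sqrt (2 * real n * green n) \<le> sqrt (2 * (1 + B / \<theta>) * real n powr (2 * (1 - 1 / (2 * \<alpha>))))"
      by simp
    also have "real n powr (2 * (1 - 1 / (2 * \<alpha>))) = (real n powr (1 - 1 / (2 * \<alpha>)))\<^sup>2"
      by (simp add: power2_eq_square powr_add[symmetric])
    also have "sqrt (2 * (1 + B / \<theta>) * (real n powr (1 - 1 / (2 * \<alpha>)))\<^sup>2) = c2 * real n powr (1 - 1 / (2 * \<alpha>))"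
      by (simp add: c2_def real_sqrt_mult)
    finally show ?thesis using expectation_sqrt_pairs_le[of n] by simp
  qed
  have lower: "1 / sqrt r * real n powr (1 - 1 / (2 * \<alpha>)) \<le> mean_sqrt_pairs n" if n: "n \<ge> 1" for n
  proof -
    have ps: "(\<Sum>j=1..n. real j powr (1 / \<alpha> - 1)) \<le> real n powr (1 / \<alpha>) / (1 / \<alpha>)"
      using \<alpha> by (intro sum_powr_le) auto
    have "(\<Sum>j<n. 1 / green j) \<le> (\<Sum>j\<in>insert 0 {1..n}. 1 / green j)"
      using green_ge_1 by (intro sum_mono2) (auto intro: order_trans[OF zero_le_one])
    also have "\<dots> = 1 / green 0 + (\<Sum>j=1..n. 1 / green j)" by simp
    also have "\<dots> \<le> real n powr (1 / \<alpha>) + (\<Sum>j=1..n. 1 / k * real j powr (1 / \<alpha> - 1))"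
    proof (intro add_mono sum_mono)
      have "1 / green 0 \<le> 1" using green_ge_1[of 0] by simp
      also have "1 \<le> real n powr (1 / \<alpha>)" using n \<alpha> by (intro ge_one_powr_ge_zero) auto
      finally show "1 / green 0 \<le> real n powr (1 / \<alpha>)" .
      fix j assume "j \<in> {1..n}"
      then have j: "j \<ge> 1" by simp
      have "1 / green j \<le> 1 / (k * real j powr \<theta>)"
        using k j by (intro divide_left_mono mult_pos_pos) (auto intro!: less_le_trans[OF zero_less_one green_ge_1])
      also have "\<dots> = 1 / k * real j powr (- \<theta>)" by (simp add: powr_minus_divide)
      finally show "1 / green j \<le> 1 / k * real j powr (1 / \<alpha> - 1)" by (simp add: \<theta>_def)
    qed
    also have "\<dots> \<le> real n powr (1 / \<alpha>) + 1 / k * (real n powr (1 / \<alpha>) / (1 / \<alpha>))"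
      unfolding sum_distrib_left[symmetric] using ps k by (intro add_left_mono mult_left_mono) auto
    also have "\<dots> = r * real n powr (1 / \<alpha>)" by (simp add: r_def distrib_right)
    finally have "real n / sqrt (r * real n powr (1 / \<alpha>)) \<le> mean_sqrt_pairs n"
      using n by (intro expectation_sqrt_pairs_ge) auto
    moreover have "sqrt (real n powr (1 / \<alpha>)) = real n powr (1 / (2 * \<alpha>))"
      by (simp add: powr_half_sqrt[symmetric] powr_powr mult.commute)
    then have "real n / sqrt (r * real n powr (1 / \<alpha>)) = 1 / sqrt r * real n powr (1 - 1 / (2 * \<alpha>))"
      using n by (simp add: real_sqrt_mult powr_diff)
    ultimately show ?thesis by simp
  qed
  show ?thesis
    using upper lower pos by (intro exI[of _ "1 / sqrt r"] conjI exI[of _ c2]) auto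
qed

text \<open>Here \<open>green n\<close> is of order ln n and the mean range at most of order n / ln
  n. The conventional value at n = 1 is accommodated by the maximum in \<open>c2\<close> and the
  minimum in \<open>c1\<close>.\<close>

lemma sqrt_pairs_bounds_log:
  assumes \<alpha>: "\<alpha> = real CARD('d)"
  shows "\<exists>c1>0. \<exists>c2>0. \<forall>n\<ge>1.
    c1 * (if n = 1 then 1 else sqrt (real n * ln (real n))) \<le> mean_sqrt_pairs n \<and>
    mean_sqrt_pairs n \<le> c2 * (if n = 1 then 1 else sqrt (real n * ln (real n)))"
proof -
  obtain \<delta> c C where reg: "phi_regular \<alpha> \<delta> c C" using phi_near_bounds by blast
  have a1: "\<alpha> \<ge> 1" unfolding \<alpha> by (simp add: Suc_le_eq)
  obtain B where B: "B > 0" "\<And>k. k \<ge> 1 \<Longrightarrow> ret k \<le> B * (1 / real k)"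
    using ret_upper[OF reg a1] unfolding \<alpha> by (auto simp: powr_minus_divide)
  obtain k where k: "k > 0" "\<And>n. n \<ge> 1 \<Longrightarrow> k * ln (real n) \<le> green n"
    using green_ge_log[OF reg \<alpha>] by blast
  \<comment> \<open>The quotient by \<open>ln 2\<close> absorbs the additive constant 1 + B, as ln n
    \<ge> ln 2.\<close>
  define b where "b = (1 + B) / ln 2 + B"
  define c2 where "c2 = max (sqrt (2 * green 1)) (sqrt (2 * b))"
  define r where "r = 4 + 2 / k"
  define c1 where "c1 = min 1 (1 / sqrt r)"
  have b: "b > 0" using B by (simp add: b_def add_pos_pos)
  have pos: "c2 > 0" "r > 0" "c1 > 0" using b k by (auto simp: c2_def c1_def r_def less_max_iff_disj add_pos_pos)
  have "c1 * (if n = 1 then 1 else sqrt (real n * ln (real n))) \<le> mean_sqrt_pairs n \<and>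
    mean_sqrt_pairs n \<le> c2 * (if n = 1 then 1 else sqrt (real n * ln (real n)))"
    if n: "n \<ge> 1" for n
  proof (cases "n = 1")
    case True
    have "c1 \<le> 1" by (simp add: c1_def)
    moreover have "sqrt (2 * green 1) \<le> c2" by (simp add: c2_def)
    ultimately show ?thesis
      using expectation_sqrt_pairs_ge_sqrt[of 1] expectation_sqrt_pairs_le[of 1] True by simp
  next
    case False
    with n have n2: "n \<ge> 2" by simp
    have ln2: "ln 2 \<le> ln (real n)" using n2 by (intro ln_mono) auto
    have ln0: "ln (real n) > 0" using n2 by simp
    have "{..n} = insert 0 {1..n}" by auto
    then have "green n = 1 + (\<Sum>k=1..n. ret k)" by (simp add: green_def ret_0)
    also have "\<dots> \<le> 1 + (\<Sum>k=1..n. B * (1 / real k))"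
      using B by (intro add_left_mono sum_mono) auto
    also have "\<dots> \<le> 1 + B * (1 + ln (real n))"
      unfolding sum_distrib_left[symmetric] using B n by (intro add_left_mono mult_left_mono sum_inverse_le_ln) auto
    also have "\<dots> = (1 + B) * 1 + B * ln (real n)" by (simp add: distrib_left)
    also have "\<dots> \<le> (1 + B) * (ln (real n) / ln 2) + B * ln (real n)"
      using B ln2 by (intro add_right_mono mult_left_mono) auto
    also have "\<dots> = b * ln (real n)" by (simp add: b_def distrib_right)
    finally have "2 * real n * green n \<le> 2 * real n * (b * ln (real n))"
      by (intro mult_left_mono) auto
    then have "sqrt (2 * real n * green n) \<le> sqrt (2 * b * (real n * ln (real n)))"
      by (simp add: mult_ac)
    also have "\<dots> = sqrt (2 * b) * sqrt (real n * ln (real n))" by (rule real_sqrt_mult)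
    also have "\<dots> \<le> c2 * sqrt (real n * ln (real n))"
      using ln0 by (intro mult_right_mono) (auto simp: c2_def)
    finally have upper: "mean_sqrt_pairs n \<le> c2 * sqrt (real n * ln (real n))"
      using expectation_sqrt_pairs_le[of n] by simp
    have "(\<Sum>j<n. 1 / green j) \<le> r * (real n / ln (real n))"
      unfolding r_def by (rule sum_inverse_ln_bound[OF green_ge_1 k(2) k(1) n2])
    then have "real n / sqrt (r * (real n / ln (real n))) \<le> mean_sqrt_pairs n"
      using n by (intro expectation_sqrt_pairs_ge) auto
    moreover have "real n / sqrt (r * (real n / ln (real n))) = 1 / sqrt r * sqrt (real n * ln (real n))"
    proof -
      have "real n = sqrt (real n) * sqrt (real n)" by simp
      then show ?thesis
        using n ln0 pos by (simp add: real_sqrt_mult real_sqrt_divide field_simps)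
    qed
    moreover have "c1 * sqrt (real n * ln (real n)) \<le> 1 / sqrt r * sqrt (real n * ln (real n))"
      using ln0 by (intro mult_right_mono) (auto simp: c1_def)
    ultimately show ?thesis using upper False by simp
  qed
  then show ?thesis using pos by blast
qed

end

text \<open>The upper bound comes from the bounded Green function, the lower one from the diagonal
  of V_n.\<close>

lemma (in group_walk) sqrt_pairs_bounds_transient:
  assumes "\<not> (AE y in steps. \<exists>\<^sub>\<infinity>n. pos n y = 0)"
  shows "\<exists>c1>0. \<exists>c2>0. \<forall>n\<ge>1. c1 * sqrt (real n) \<le> mean_sqrt_pairs n \<and>
    mean_sqrt_pairs n \<le> c2 * sqrt (real n)"
proof -
  obtain C where C: "C > 0" "\<And>n. green n \<le> C" using green_bounded_of_transient[OF assms] by blast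
  have "mean_sqrt_pairs n \<le> sqrt (2 * C) * sqrt (real n)" for n
  proof -
    have "2 * real n * green n \<le> 2 * C * real n"
      using mult_left_mono[OF C(2)[of n], of "2 * real n"] by (simp add: mult.commute)
    then have "sqrt (2 * real n * green n) \<le> sqrt (2 * C) * sqrt (real n)"
      by (simp add: real_sqrt_mult[symmetric])
    then show ?thesis using expectation_sqrt_pairs_le[of n] by simp
  qed
  then show ?thesis
    using C expectation_sqrt_pairs_ge_sqrt by (intro exI[of _ 1] conjI exI[of _ "sqrt (2 * C)"]) auto
qed

section \<open>The normalization\<close>

text \<open>Exponents in [1/2, 1] cover both 1 - 1/(2 \<alpha>) for 1 < \<alpha> \<le> 2 and the
  transient case.\<close>

lemma powr_norm_growth:
  assumes e: "1 / 2 \<le> e" "e \<le> 1" and n: "n \<ge> (1::nat)"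
  shows "0 < real n powr e" "real n powr e \<le> real n"
    "L \<ge> 1 \<Longrightarrow> sqrt (real L) * real n powr e \<le> real (L * n) powr e"
proof -
  show "0 < real n powr e" using n by simp
  show "real n powr e \<le> real n" using powr_mono[of e 1 "real n"] e n by simp
  assume L: "L \<ge> 1"
  have "sqrt (real L) = real L powr (1 / 2)" by (simp add: powr_half_sqrt)
  also have "\<dots> \<le> real L powr e" using e L by (intro powr_mono) auto
  finally show "sqrt (real L) * real n powr e \<le> real (L * n) powr e"
    by (simp add: powr_mult mult_right_mono)
qed

text \<open>The bound L \<ge> 3 matters at n = 1, where the conventional value 1 must be dominated
  by ln L.\<close>

lemma log_norm_growth:
  defines "a \<equiv> \<lambda>n::nat. if n = 1 then 1 else sqrt (real n * ln (real n))"
  assumes n: "n \<ge> 1"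
  shows "0 < a n" "a n \<le> real n" "L \<ge> 3 \<Longrightarrow> sqrt (real L) * a n \<le> a (L * n)"
proof -
  show "0 < a n" using n by (simp add: a_def)
  show "a n \<le> real n"
  proof (cases "n = 1")
    case False
    have "real n * ln (real n) \<le> real n * real n"
      using n ln_le_minus_one[of "real n"] by (intro mult_left_mono) auto
    then have "sqrt (real n * ln (real n)) \<le> sqrt (real n * real n)" by (rule real_sqrt_le_mono)
    then show ?thesis using False by (simp add: a_def)
  qed (simp add: a_def)
  assume L: "L \<ge> 3"
  have "real L * (if n = 1 then 1 else real n * ln (real n)) \<le> real (L * n) * ln (real (L * n))"
  proof (cases "n = 1")
    case True
    have "exp 1 \<le> real L" using exp_le L by simp
    then have "1 \<le> ln (real L)" using L by (simp add: ln_ge_iff)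
    then show ?thesis using True mult_left_mono[of 1 "ln (real L)" "real L"] by simp
  next
    case False
    have "real n \<le> real (L * n)" using L n by simp
    then have "ln (real n) \<le> ln (real (L * n))" using n by (intro ln_mono) auto
    then have "real (L * n) * ln (real n) \<le> real (L * n) * ln (real (L * n))" by (intro mult_left_mono) auto
    then show ?thesis using False by simp
  qed
  then have "sqrt (real L * (if n = 1 then 1 else real n * ln (real n))) \<le> sqrt (real (L * n) * ln (real (L * n)))"
    by (rule real_sqrt_le_mono)
  moreover have "L * n \<noteq> 1" using L by simp
  ultimately show "sqrt (real L) * a n \<le> a (L * n)"
    by (auto simp: a_def real_sqrt_mult)
qed

section \<open>Transfer to the canonical space\<close>

lemma measurable_increments:
  "(\<lambda>s k. s (Suc k) - s k) \<in> measurable (Pi\<^sub>M UNIV (\<lambda>_. count_space UNIV))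
    (Pi\<^sub>M UNIV (\<lambda>_. count_space (UNIV :: 'g::{ab_group_add, countable} set)))"
proof (rule measurable_PiM_single')
  fix k :: nat
  have m: "(\<lambda>s. s i) \<in> measurable (Pi\<^sub>M UNIV (\<lambda>_. count_space UNIV)) (count_space (UNIV :: 'g set))" for i :: nat
    by simp
  have "(\<lambda>s. g - s k) \<in> measurable (Pi\<^sub>M UNIV (\<lambda>_. count_space UNIV)) (count_space (UNIV :: 'g set))" for g
    by (rule measurable_compose[OF m, where g = "\<lambda>x. g - x"]) simp
  then show "(\<lambda>s. s (Suc k) - s k) \<in> measurable (Pi\<^sub>M UNIV (\<lambda>_. count_space UNIV)) (count_space (UNIV :: 'g set))"
    by (rule measurable_compose_countable[OF _ m, where f = "\<lambda>g s. g - s k"])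
qed (auto simp: space_PiM)

context random_walk_random_scenery
begin

abbreviation walk_algebra :: "(nat \<Rightarrow> int ^ 'd) measure" where
  "walk_algebra \<equiv> Pi\<^sub>M UNIV (\<lambda>_. count_space UNIV)"

abbreviation scenery_algebra :: "(int ^ 'd \<Rightarrow> real) measure" where
  "scenery_algebra \<equiv> Pi\<^sub>M UNIV (\<lambda>_. borel)"

definition step_law :: "(int ^ 'd) measure" where
  "step_law = distr M (count_space UNIV) (walk_step S 1)"

definition scenery_law :: "real measure" where
  "scenery_law = distr M borel (\<xi> 0)"

definition walk_steps :: "'w \<Rightarrow> nat \<Rightarrow> int ^ 'd" where
  "walk_steps \<omega> k = S (Suc k) \<omega> - S k \<omega>"

lemma random_variable_scenery [measurable]: "\<xi> x \<in> borel_measurable M"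
  using scenery_indep by (auto simp: indep_vars_def)

lemma random_variable_step: "k \<ge> 1 \<Longrightarrow> walk_step S k \<in> measurable M (count_space UNIV)"
  using steps_indep by (auto simp: indep_vars_def)

lemma prob_space_laws: "prob_space step_law" "prob_space scenery_law"
  unfolding step_law_def scenery_law_def
  by (intro prob_space_distr random_variable_step random_variable_scenery; simp)+

text \<open>A vanishing second moment would put the support inside {0}, and the closed subgroup
  generated by it would be neither Z nor R.\<close>

lemma scenery_square_pos: "0 < (\<integral>r. r\<^sup>2 \<partial>scenery_law)"
proof (rule ccontr)
  interpret L: prob_space scenery_law by (rule prob_space_laws)
  assume "\<not> ?thesis"
  moreover have "0 \<le> (\<integral>r. r\<^sup>2 \<partial>scenery_law)" by (intro integral_nonneg_AE) auto
  ultimately have 0: "(\<integral>r. r\<^sup>2 \<partial>scenery_law) = 0" by simp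
  have int: "integrable scenery_law (\<lambda>r. r\<^sup>2)"
    unfolding scenery_law_def using scenery_square_integrable by (subst integrable_distr_eq) auto
  have "AE r in scenery_law. r\<^sup>2 = 0"
    by (rule iffD1[OF integral_nonneg_eq_0_iff_AE[OF int] 0]) simp
  then have ae: "AE r in scenery_law. r = 0" by simp
  have "x = 0" if "x \<in> law_support scenery_law" for x
  proof (rule ccontr)
    assume "x \<noteq> 0"
    moreover have "open (- {0 :: real})" by (simp add: open_Compl)
    ultimately have "measure scenery_law (- {0}) > 0"
      using that unfolding law_support_def by blast
    moreover have "measure scenery_law (- {0}) = 0"
    proof -
      have "emeasure scenery_law (- {0}) = emeasure scenery_law {}"
        using ae by (intro emeasure_eq_AE) (auto simp: scenery_law_def)
      then show ?thesis by (simp add: measure_def)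
    qed
    ultimately show False by simp
  qed
  then have "closed_subgroup_generated (law_support scenery_law) \<subseteq> {0}"
    unfolding closed_subgroup_generated_def
    by (intro Inter_lower) (auto simp: additive_subgroup_def)
  moreover have "(1 :: real) \<in> closed_subgroup_generated (law_support scenery_law)"
  proof -
    have "closed_subgroup_generated (law_support scenery_law) = \<int> \<or>
        closed_subgroup_generated (law_support scenery_law) = UNIV"
      using scenery_support unfolding scenery_law_def by blast
    then show ?thesis by (rule disjE) (simp_all only: Ints_1 UNIV_I)
  qed
  ultimately show False by auto
qed

lemma canonical: "walk_in_scenery scenery_law step_law"
proof (intro walk_in_scenery.intro scenery.intro group_walk.intro prob_space_laws
    scenery_axioms.intro group_walk_axioms.intro scenery_square_pos)
  show "sets scenery_law = sets borel" "sets step_law = sets (count_space UNIV)"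
    by (simp_all add: scenery_law_def step_law_def)
  show "integrable scenery_law (\<lambda>r. r\<^sup>2)"
    unfolding scenery_law_def using scenery_square_integrable by (subst integrable_distr_eq) auto
  show "(\<integral>r. r \<partial>scenery_law) = 0"
    unfolding scenery_law_def using scenery_centered by (subst integral_distr) auto
qed

sublocale C: walk_in_scenery scenery_law step_law
  by (rule canonical)

section \<open>Laws of the increments, of the scenery and of the pair\<close>

lemma distr_walk_steps: "distr M walk_algebra walk_steps = C.W.steps"
proof -
  let ?K = "{1..} :: nat set"
  have law: "distr M (count_space UNIV) (walk_step S i) = step_law" if "i \<in> ?K" for i
    using steps_identical[of i] that by (simp add: step_law_def)
  have "distr M (Pi\<^sub>M ?K (\<lambda>_. count_space UNIV)) (\<lambda>\<omega>. \<lambda>i\<in>?K. walk_step S i \<omega>) =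
      Pi\<^sub>M ?K (\<lambda>i. distr M (count_space UNIV) (walk_step S i))"
    using steps_indep by (subst (asm) indep_vars_iff_distr_eq_PiM') (auto intro: random_variable_step)
  also have "\<dots> = Pi\<^sub>M ?K (\<lambda>_. step_law)" by (intro PiM_cong refl law)
  finally have joint: "distr M (Pi\<^sub>M ?K (\<lambda>_. count_space UNIV)) (\<lambda>\<omega>. \<lambda>i\<in>?K. walk_step S i \<omega>) =
      Pi\<^sub>M ?K (\<lambda>_. step_law)" .
  \<comment> \<open>The increments are numbered from 1 by \<open>walk_step\<close> and from 0 on the
    canonical space.\<close>
  let ?sh = "\<lambda>y. \<lambda>k\<in>UNIV. y (Suc k) :: int ^ 'd"
  have sets: "sets (Pi\<^sub>M I (\<lambda>_. step_law)) = sets (Pi\<^sub>M I (\<lambda>_. count_space UNIV))" for I :: "nat set"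
    by (intro sets_PiM_cong refl) (simp add: step_law_def)
  have m1: "(\<lambda>\<omega>. \<lambda>i\<in>?K. walk_step S i \<omega>) \<in> measurable M (Pi\<^sub>M ?K (\<lambda>_. count_space UNIV))"
    by (intro measurable_restrict random_variable_step) simp
  have m2: "?sh \<in> measurable (Pi\<^sub>M ?K (\<lambda>_. count_space UNIV)) walk_algebra"
    by (intro measurable_restrict measurable_component_singleton) auto
  have eq: "walk_steps = ?sh \<circ> (\<lambda>\<omega>. \<lambda>i\<in>?K. walk_step S i \<omega>)"
    by (simp add: fun_eq_iff walk_steps_def walk_step_def)
  have "distr M walk_algebra walk_steps =
      distr (Pi\<^sub>M ?K (\<lambda>_. step_law)) walk_algebra ?sh"
    unfolding joint[symmetric] distr_distr[OF m2 m1] by (simp only: eq)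
  also have "\<dots> = distr (Pi\<^sub>M ?K (\<lambda>_. step_law)) C.W.steps ?sh"
    by (intro distr_cong refl sets[symmetric])
  also have "\<dots> = C.W.steps"
    by (rule distr_PiM_reindex) (auto intro: prob_space_laws)
  finally show ?thesis .
qed

lemma distr_sceneries: "distr M scenery_algebra (\<lambda>\<omega> x. \<xi> x \<omega>) = C.sceneries"
proof -
  have "distr M scenery_algebra (\<lambda>\<omega>. \<lambda>x\<in>UNIV. \<xi> x \<omega>) = Pi\<^sub>M UNIV (\<lambda>x. distr M borel (\<xi> x))"
    using scenery_indep by (subst (asm) indep_vars_iff_distr_eq_PiM') auto
  also have "\<dots> = C.sceneries"
    unfolding scenery_law_def by (intro PiM_cong refl scenery_identical)
  finally show ?thesis by (simp add: restrict_UNIV)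
qed

lemma measurable_walk: "(\<lambda>\<omega> n. S n \<omega>) \<in> measurable M walk_algebra"
  by (rule measurable_PiM_single') (auto simp: space_PiM walk_measurable)

lemma measurable_scenery: "(\<lambda>\<omega> x. \<xi> x \<omega>) \<in> measurable M scenery_algebra"
  by (rule measurable_PiM_single') (auto simp: space_PiM)

lemma measurable_walk_steps: "walk_steps \<in> measurable M C.W.steps"
proof -
  have "(\<lambda>s k. s (Suc k) - s k) \<circ> (\<lambda>\<omega> n. S n \<omega>) \<in> measurable M walk_algebra"
    by (rule measurable_comp[OF measurable_walk measurable_increments])
  then have "walk_steps \<in> measurable M walk_algebra"
    by (simp add: walk_steps_def[abs_def] o_def)
  moreover have "sets C.W.steps = sets walk_algebra"
    by (intro sets_PiM_cong refl) (simp add: step_law_def)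
  ultimately show ?thesis using measurable_cong_sets by blast
qed

lemma distr_walk_steps': "distr M C.W.steps walk_steps = C.W.steps"
proof -
  have "distr M C.W.steps walk_steps = distr M walk_algebra walk_steps"
    by (intro distr_cong refl sets_PiM_cong) (simp_all add: step_law_def)
  then show ?thesis by (simp add: distr_walk_steps)
qed

lemma measurable_sceneries: "(\<lambda>\<omega> x. \<xi> x \<omega>) \<in> measurable M C.sceneries"
proof -
  have "sets C.sceneries = sets scenery_algebra"
    by (intro sets_PiM_cong refl) (simp add: scenery_law_def)
  then show ?thesis using measurable_scenery measurable_cong_sets by blast
qed

lemma distr_sceneries': "distr M C.sceneries (\<lambda>\<omega> x. \<xi> x \<omega>) = C.sceneries"
proof -
  have "distr M C.sceneries (\<lambda>\<omega> x. \<xi> x \<omega>) = distr M scenery_algebra (\<lambda>\<omega> x. \<xi> x \<omega>)"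
    by (intro distr_cong refl sets_PiM_cong) (simp_all add: scenery_law_def)
  then show ?thesis by (simp add: distr_sceneries)
qed

text \<open>Equality is checked on rectangles. The independence assumption speaks of the walk, so
  events about the increments are first pulled back to events about the walk.\<close>

lemma distr_joint:
  "distr M (C.W.steps \<Otimes>\<^sub>M C.sceneries) (\<lambda>\<omega>. (walk_steps \<omega>, \<lambda>x. \<xi> x \<omega>)) = C.W.steps \<Otimes>\<^sub>M C.sceneries"
proof (rule pair_measure_eqI[symmetric])
  show "sigma_finite_measure C.W.steps" "sigma_finite_measure (C.sceneries :: (int ^ 'd \<Rightarrow> real) measure)"
    by unfold_locales
  fix A B assume A: "A \<in> sets C.W.steps" and B: "B \<in> sets (C.sceneries :: (int ^ 'd \<Rightarrow> real) measure)"
  let ?a = "walk_steps -` A \<inter> space M" and ?b = "(\<lambda>\<omega> x. \<xi> x \<omega>) -` B \<inter> space M"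
  let ?incr = "\<lambda>s k. s (Suc k) - s k :: int ^ 'd"
  have "sets C.W.steps = sets walk_algebra"
    by (intro sets_PiM_cong refl) (simp add: step_law_def)
  then have A': "?incr -` A \<in> sets walk_algebra"
    using measurable_sets[OF measurable_increments, of A] A by (simp add: space_PiM)
  have "?a = (\<lambda>\<omega> n. S n \<omega>) -` (?incr -` A) \<inter> space M"
    by (auto simp: walk_steps_def[abs_def])
  then have a: "?a \<in> sets (vimage_algebra (space M) (\<lambda>\<omega> n. S n \<omega>) walk_algebra)"
    unfolding sets_vimage_algebra using A' by (intro sigma_sets.Basic) blast
  have "sets C.sceneries = sets scenery_algebra"
    by (intro sets_PiM_cong refl) (simp add: scenery_law_def)
  then have b: "?b \<in> sets (vimage_algebra (space M) (\<lambda>\<omega> x. \<xi> x \<omega>) scenery_algebra)"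
    unfolding sets_vimage_algebra using B by (intro sigma_sets.Basic) blast
  have m: "(\<lambda>\<omega>. (walk_steps \<omega>, \<lambda>x. \<xi> x \<omega>)) \<in> measurable M (C.W.steps \<Otimes>\<^sub>M C.sceneries)"
    by (intro measurable_Pair measurable_walk_steps measurable_sceneries)
  have "emeasure C.W.steps A * emeasure C.sceneries B =
      emeasure (distr M C.W.steps walk_steps) A * emeasure (distr M C.sceneries (\<lambda>\<omega> x. \<xi> x \<omega>)) B"
    by (simp add: distr_walk_steps' distr_sceneries')
  also have "\<dots> = emeasure M ?a * emeasure M ?b"
    using A B by (simp add: emeasure_distr measurable_walk_steps measurable_sceneries)
  also have "\<dots> = ennreal (prob ?a * prob ?b)"
    by (simp add: emeasure_eq_measure ennreal_mult)
  also have "prob ?a * prob ?b = prob (?a \<inter> ?b)"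
    using indep_setD[OF walk_scenery_indep a b] by simp
  also have "?a \<inter> ?b = (\<lambda>\<omega>. (walk_steps \<omega>, \<lambda>x. \<xi> x \<omega>)) -` (A \<times> B) \<inter> space M"
    by auto
  also have "ennreal (prob \<dots>) =
      emeasure (distr M (C.W.steps \<Otimes>\<^sub>M C.sceneries) (\<lambda>\<omega>. (walk_steps \<omega>, \<lambda>x. \<xi> x \<omega>))) (A \<times> B)"
    using A B by (simp add: emeasure_distr[OF m] emeasure_eq_measure)
  finally show "emeasure C.W.steps A * emeasure C.sceneries B =
      emeasure (distr M (C.W.steps \<Otimes>\<^sub>M C.sceneries) (\<lambda>\<omega>. (walk_steps \<omega>, \<lambda>x. \<xi> x \<omega>))) (A \<times> B)" .
qed simp

lemma walk_eq_pos: "\<omega> \<in> space M \<Longrightarrow> S n \<omega> = pos n (walk_steps \<omega>)"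
  by (induction n) (simp_all add: walk_start pos_def walk_steps_def)

lemma rwrs_max_eq_peak:
  assumes "\<omega> \<in> space M"
  shows "rwrs_max S \<xi> (Suc n) \<omega> = peak n (sites (walk_steps \<omega>)) (\<lambda>x. \<xi> x \<omega>)"
proof -
  have "rwrs S \<xi> k \<omega> = site_sum k (sites (walk_steps \<omega>)) (\<lambda>x. \<xi> x \<omega>)" for k
  proof -
    have "{1..k} = Suc ` {..<k}" by (auto simp: image_Suc_lessThan)
    then show ?thesis
      using assms by (simp add: rwrs_def site_sum_def sum.reindex sites_def walk_eq_pos)
  qed
  then show ?thesis by (simp only: rwrs_max_def peak_eq_Max)
qed

text \<open>Fubini's theorem on the canonical space; the \<open>Suc n\<close> on the left is the
  shift built into \<open>peak\<close>.\<close>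

lemma prob_rwrs_max:
  "prob {\<omega> \<in> space M. rwrs_max S \<xi> (Suc n) \<omega> \<le> m} = C.persist n m"
proof -
  interpret P: pair_prob_space C.W.steps "C.sceneries :: (int ^ 'd \<Rightarrow> real) measure" ..
  let ?E = "{z. peak n (sites (fst z)) (snd z) \<le> m} :: ((nat \<Rightarrow> int ^ 'd) \<times> (int ^ 'd \<Rightarrow> real)) set"
  have space: "space (C.W.steps \<Otimes>\<^sub>M C.sceneries) = UNIV" by (simp add: space_pair_measure)
  have "(\<lambda>z. peak n (sites (fst z)) (snd z)) \<in> borel_measurable (C.W.steps \<Otimes>\<^sub>M C.sceneries)"
    using C.measurable_peak_pair[of n] by (simp add: case_prod_beta)
  from measurable_sets[OF this, of "{..m}"]
  have E: "?E \<in> sets (C.W.steps \<Otimes>\<^sub>M C.sceneries)" by (simp add: space vimage_def)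
  have m: "(\<lambda>\<omega>. (walk_steps \<omega>, \<lambda>x. \<xi> x \<omega>)) \<in> measurable M (C.W.steps \<Otimes>\<^sub>M C.sceneries)"
    by (intro measurable_Pair measurable_walk_steps measurable_sceneries)
  have "prob {\<omega> \<in> space M. rwrs_max S \<xi> (Suc n) \<omega> \<le> m} =
      prob ((\<lambda>\<omega>. (walk_steps \<omega>, \<lambda>x. \<xi> x \<omega>)) -` ?E \<inter> space M)"
    by (intro arg_cong[of _ _ prob]) (auto simp: rwrs_max_eq_peak)
  also have "\<dots> = measure (distr M (C.W.steps \<Otimes>\<^sub>M C.sceneries) (\<lambda>\<omega>. (walk_steps \<omega>, \<lambda>x. \<xi> x \<omega>))) ?E"
    by (rule measure_distr[OF m E, symmetric])
  also have "\<dots> = (\<integral>z. indicator ?E z \<partial>(C.W.steps \<Otimes>\<^sub>M C.sceneries))"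
    using E by (simp add: distr_joint)
  also have "\<dots> = (\<integral>y. \<integral>x. indicator ?E (y, x) \<partial>C.sceneries \<partial>C.W.steps)"
  proof -
    have "integrable (C.W.steps \<Otimes>\<^sub>M C.sceneries) (indicator ?E :: _ \<Rightarrow> real)"
      using E by (simp add: P.emeasure_eq_measure)
    from P.integral_fst'[OF this] show ?thesis by simp
  qed
  also have "\<dots> = C.persist n m"
  proof -
    have "(\<integral>x. indicator ?E (y, x) \<partial>C.sceneries) = C.X.prob {x. peak n (sites y) x \<le> m}" for y
    proof -
      have "(\<lambda>x. indicator ?E (y, x) :: real) = indicator {x. peak n (sites y) x \<le> m}"
        by (auto simp: fun_eq_iff indicator_def)
      then show ?thesis by simp
    qed
    then show ?thesis by (simp add: C.persist_def)
  qed
  finally show ?thesis .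
qed

text \<open>Used in contraposition, to carry transience of \<open>S\<close> over to the canonical
  walk.\<close>

lemma recurrent_walkI:
  assumes "AE y in C.W.steps. \<exists>\<^sub>\<infinity>n. pos n y = 0"
  shows "recurrent_walk M S"
proof -
  have "AE \<omega> in M. \<exists>\<^sub>\<infinity>n. pos n (walk_steps \<omega>) = 0"
    using AE_distrD[OF measurable_walk_steps] assms unfolding distr_walk_steps' by blast
  then have "AE \<omega> in M. \<exists>\<^sub>\<infinity>n. S n \<omega> = 0"
    using AE_space by eventually_elim (simp add: walk_eq_pos)
  then show ?thesis by (simp add: recurrent_walk_def)
qed

lemma attracted:
  assumes "recurrent_walk M S"
  shows "\<exists>\<mu>. attracted_walk step_law \<alpha> \<mu>"
proof -
  obtain \<mu> :: "(real ^ 'd) measure" where st: "stable_law \<alpha> \<mu>"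
    and cv: "converges_in_distribution euclidean M (scaled_walk \<alpha> S) \<mu> (\<lambda>x. x)"
    using attraction[OF assms] unfolding normal_domain_of_attraction_def by blast
  interpret lattice_walk step_law by unfold_locales
  have "attracted_walk step_law \<alpha> \<mu>"
  proof (intro attracted_walk.intro attracted_walk_axioms.intro st)
    show "lattice_walk step_law" by unfold_locales
    have "real CARD('d) > 0" by simp
    then show "0 < \<alpha>" using index_range[OF assms] by linarith
    fix F :: "real ^ 'd \<Rightarrow> real" assume F: "continuous_on UNIV F" "bounded (range F)"
    have "(\<lambda>n. \<integral>\<omega>. F (scaled_walk \<alpha> S n \<omega>) \<partial>M) \<longlonglongrightarrow> (\<integral>x. F x \<partial>\<mu>)"
      using cv F unfolding converges_in_distribution_def by simp
    moreover have "(\<integral>\<omega>. F (scaled_walk \<alpha> S n \<omega>) \<partial>M) =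
        (\<integral>y. F (real n powr (- 1 / \<alpha>) *\<^sub>R lattice_embed (pos n y)) \<partial>C.W.steps)" for n
    proof -
      have "(\<integral>y. F (real n powr (- 1 / \<alpha>) *\<^sub>R lattice_embed (pos n y)) \<partial>C.W.steps) =
          (\<integral>\<omega>. F (real n powr (- 1 / \<alpha>) *\<^sub>R lattice_embed (pos n (walk_steps \<omega>))) \<partial>M)"
        by (subst distr_walk_steps'[symmetric], rule integral_distr[OF measurable_walk_steps])
           (rule measurable_fun_pos)
      also have "\<dots> = (\<integral>\<omega>. F (scaled_walk \<alpha> S n \<omega>) \<partial>M)"
        by (intro Bochner_Integration.integral_cong refl) (simp add: scaled_walk_def walk_eq_pos)
      finally show ?thesis by simp
    qed
    ultimately show "(\<lambda>n. \<integral>y. F (real n powr (- 1 / \<alpha>) *\<^sub>R lattice_embed (pos n y)) \<partial>C.W.steps)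
        \<longlonglongrightarrow> (\<integral>x. F x \<partial>\<mu>)" by simp
  qed
  then show ?thesis by blast
qed

lemma card_le_2: "recurrent_walk M S \<Longrightarrow> CARD('d) \<in> {1, 2}"
proof -
  assume "recurrent_walk M S"
  then have "real CARD('d) \<le> 2" using index_range by force
  then have "CARD('d) \<le> 2" by simp
  moreover have "0 < CARD('d)" by (rule zero_less_card_finite)
  ultimately have "CARD('d) = 1 \<or> CARD('d) = 2" by arith
  then show ?thesis by simp
qed

text \<open>In the recurrent case d \<le> \<alpha> \<le> 2, so outside d = 1 < \<alpha> one has
  \<alpha> = d. The last branch of \<open>rwrs_norm\<close> is thus reached by transient walks
  only.\<close>

lemma norm_cases:
  obtains (power) "recurrent_walk M S" "CARD('d) = 1" "1 < \<alpha>" "\<alpha> \<le> 2"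
      "rwrs_norm M S \<alpha> = (\<lambda>n. real n powr (1 - 1 / (2 * \<alpha>)))"
  | (log) "recurrent_walk M S" "\<alpha> = real CARD('d)"
      "rwrs_norm M S \<alpha> = (\<lambda>n. if n = 1 then 1 else sqrt (real n * ln (real n)))"
  | (transient) "\<not> recurrent_walk M S" "rwrs_norm M S \<alpha> = (\<lambda>n. sqrt (real n))"
proof (cases "recurrent_walk M S")
  case True
  have r: "real CARD('d) \<le> \<alpha>" "\<alpha> \<le> 2" using index_range[OF True] by auto
  show ?thesis
  proof (cases "CARD('d) = 1 \<and> 1 < \<alpha>")
    case True
    with \<open>recurrent_walk M S\<close> r show ?thesis
      by (intro power) (auto simp: rwrs_norm_def fun_eq_iff)
  next
    case False
    then have "\<alpha> = real CARD('d)" using r card_le_2[OF True] by auto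
    with False True card_le_2[OF True] show ?thesis
      by (intro log) (auto simp: rwrs_norm_def fun_eq_iff)
  qed
next
  case False
  then show ?thesis by (intro transient) (auto simp: rwrs_norm_def fun_eq_iff)
qed

lemma sqrt_pairs_bounds:
  "\<exists>c1>0. \<exists>c2>0. \<forall>n\<ge>1. c1 * rwrs_norm M S \<alpha> n \<le> C.W.mean_sqrt_pairs n \<and>
    C.W.mean_sqrt_pairs n \<le> c2 * rwrs_norm M S \<alpha> n"
proof (cases rule: norm_cases)
  case power
  then obtain \<mu> where "attracted_walk step_law \<alpha> \<mu>" using attracted by blast
  then interpret attracted_walk step_law \<alpha> \<mu> .
  show ?thesis unfolding power(5) by (rule sqrt_pairs_bounds_powr[OF power(2,3)])
next
  case log
  then obtain \<mu> where "attracted_walk step_law \<alpha> \<mu>" using attracted by blast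
  then interpret attracted_walk step_law \<alpha> \<mu> .
  show ?thesis unfolding log(3) by (rule sqrt_pairs_bounds_log[OF log(2)])
next
  case transient
  then show ?thesis unfolding transient(2)
    using recurrent_walkI by (intro C.W.sqrt_pairs_bounds_transient) blast
qed

lemma norm_growth:
  assumes n: "n \<ge> 1"
  shows "0 < rwrs_norm M S \<alpha> n" "rwrs_norm M S \<alpha> n \<le> real n"
    "L \<ge> 3 \<Longrightarrow> sqrt (real L) * rwrs_norm M S \<alpha> n \<le> rwrs_norm M S \<alpha> (L * n)"
proof -
  have "0 < rwrs_norm M S \<alpha> n \<and> rwrs_norm M S \<alpha> n \<le> real n \<and>
    (L \<ge> 3 \<longrightarrow> sqrt (real L) * rwrs_norm M S \<alpha> n \<le> rwrs_norm M S \<alpha> (L * n))"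
  proof (cases rule: norm_cases)
    case power
    have e: "1 / 2 \<le> 1 - 1 / (2 * \<alpha>)" "1 - 1 / (2 * \<alpha>) \<le> 1" using power by (auto simp: field_simps)
    show ?thesis unfolding power(5) using powr_norm_growth(1,2)[OF e n] powr_norm_growth(3)[OF e n, of L] by auto
  next
    case log
    show ?thesis unfolding log(3) using log_norm_growth(1,2)[OF n] log_norm_growth(3)[OF n, of L] by blast
  next
    case transient
    show ?thesis unfolding transient(2)
      using powr_norm_growth(1,2)[of "1 / 2" n] powr_norm_growth(3)[of "1 / 2" n L] n
      by (auto simp: powr_half_sqrt)
  qed
  then show "0 < rwrs_norm M S \<alpha> n" "rwrs_norm M S \<alpha> n \<le> real n"
    "L \<ge> 3 \<Longrightarrow> sqrt (real L) * rwrs_norm M S \<alpha> n \<le> rwrs_norm M S \<alpha> (L * n)"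
    by auto
qed

end

theorem proposition15:
  fixes M :: "'w measure"
    and S :: "nat \<Rightarrow> 'w \<Rightarrow> int ^ 'd"
    and \<xi> :: "int ^ 'd \<Rightarrow> 'w \<Rightarrow> real"
    and \<alpha> \<beta>' :: real
  assumes "random_walk_random_scenery M S \<xi> \<alpha>"
    and "\<beta>' > 1"
    and "integrable M (\<lambda>\<omega>. max 0 (- \<xi> 0 \<omega>) powr \<beta>')"
  shows
    "(\<forall>m. \<exists>c>0. \<forall>n\<ge>1.
        measure M {\<omega> \<in> space M. rwrs_max S \<xi> n \<omega> \<le> m} \<le> c * (rwrs_norm M S \<alpha> n / real n)) \<and>
     (\<forall>m\<ge>0. \<exists>c>0. \<forall>n\<ge>1.
        measure M {\<omega> \<in> space M. rwrs_max S \<xi> n \<omega> \<le> m} \<ge>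
          c * (rwrs_norm M S \<alpha> n / real n) powr (1 + 2 / \<beta>')) \<and>
     (\<forall>m<0. measure M {\<omega> \<in> space M. \<xi> 0 \<omega> \<le> m} > 0 \<longrightarrow>
        (\<exists>c>0. \<forall>n\<ge>1.
           measure M {\<omega> \<in> space M. rwrs_max S \<xi> n \<omega> \<le> m} \<ge>
             c * (rwrs_norm M S \<alpha> n / real n) powr (1 + 2 / \<beta>')))"
proof -
  interpret random_walk_random_scenery M S \<xi> \<alpha> by (rule assms(1))
  obtain c1 c2 where c: "c1 > 0" "c2 > 0"
    and lower: "\<And>n. n \<ge> 1 \<Longrightarrow> c1 * rwrs_norm M S \<alpha> n \<le> C.W.mean_sqrt_pairs n"
    and upper: "\<And>n. n \<ge> 1 \<Longrightarrow> C.W.mean_sqrt_pairs n \<le> c2 * rwrs_norm M S \<alpha> n"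
    using sqrt_pairs_bounds by blast
  have int: "integrable scenery_law (\<lambda>r. max 0 (- r) powr \<beta>')"
    unfolding scenery_law_def using assms(3) by (subst integrable_distr_eq) auto
  have neg: "measure scenery_law {..m} = prob {\<omega> \<in> space M. \<xi> 0 \<omega> \<le> m}" for m
    unfolding scenery_law_def by (subst measure_distr) (auto intro!: arg_cong[of _ _ prob])
  note bounds = C.persistence_bounds[OF lower c(1) upper c(2) norm_growth assms(2) int]
  \<comment> \<open>\<open>persist n\<close> belongs to time n + 1, so the claims for n \<ge> 1 are
    rewritten at successors.\<close>
  have Suc: "(\<forall>n\<ge>1. P n) \<longleftrightarrow> (\<forall>n. P (Suc n))" for P
    by (metis One_nat_def Suc_le_D Suc_le_mono le0)
  show ?thesis
    unfolding Suc prob_rwrs_max neg[symmetric]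
    using bounds by (intro conjI allI impI) auto
qed

end
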